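(* Let $(\phi_G,\phi_P):(G_1,P_1,\theta_1)\to(G_2,P_2,\theta_2)$ be a morphism of algebraic dynamical systems. Then $(\phi_G,\phi_P)$ induces a $*$-homomorphism $\varphi_G\rtimes\varphi_P:\mathcal A[G_1,P_1,\theta_1]\to\mathcal A[G_2,P_2,\theta_2]$ if and only if $(\phi_G,\phi_P)$ is admissible.
   Context: A semigroup $P$ with identity $1$ is right LCM if it is left cancellative and, for all $p,q\in P$, the set $pP\cap qP$ is either empty or equal to $rP$ for some $r\in P$. An algebraic dynamical system is a triple $(G,P,\theta)$ consisting of a countable discrete group $G$, a countable right LCM semigroup $P$ with identity, and an action $\theta$ of $P$ by injective group endomorphisms of $G$ (so $\theta_1=\mathrm{id}$, $\theta_{pq}=\theta_p\theta_q$) such that $\theta_p(G)\cap\theta_q(G)=\theta_r(G)$ whenever $p,q,r\in P$ satisfy $pP\cap qP=rP$. $\mathcal A[G,P,\theta]$ is the universal $C^*$-algebra generated by a unitary representation $u$ of $G$ and a representation $s$ of $P$ by isometries satisfying (A1) $s_pu_g=u_{\theta_p(g)}s_p$ for all $p\in P$, $g\in G$; (A2) for all $p,q\in P$, $g\in G$: $s_p^*u_gs_q=u_ks_{p'}s_{q'}^*u_\ell^*$ if $pP\cap qP=rP$ with $pp'=qq'=r$ and $g=\theta_p(k)\theta_q(\ell^{-1})$ for some $k,\ell\in G$; and $s_p^*u_gs_q=0$ otherwise. (This does not depend on the choices.) A morphism $(\phi_G,\phi_P):(G_1,P_1,\theta_1)\to(G_2,P_2,\theta_2)$ consists of a group homomorphism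 $\phi_G:G_1\to G_2$ and an identity preserving semigroup homomorphism $\phi_P:P_1\to P_2$ with $\phi_G\circ\theta_{1,p}=\theta_{2,\phi_P(p)}\circ\phi_G$ for all $p\in P_1$. It is admissible if for all $p,q\in P_1$: (iv) $\phi_P(p)P_2\cap\phi_P(q)P_2=\phi_P(pP_1\cap qP_1)P_2$; and (v) $\phi_G^{-1}\bigl(\phi_G(G_1)\cap\theta_{2,\phi_P(p)}(G_2)\theta_{2,\phi_P(q)}(G_2)\bigr)=\theta_{1,p}(G_1)\theta_{1,q}(G_1)$ if $pP_1\cap qP_1\neq\emptyset$. Here a product of subsets of a group is the set of products. "Induces a $*$-homomorphism" means that there is a $*$-homomorphism mapping $u_g\mapsto u_{\phi_G(g)}$ and $s_p\mapsto s_{\phi_P(p)}$ (generators of the first, respectively second, algebra) for all $g\in G_1$, $p\in P_1$. *)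

theory Defs
  imports
    Complex_Main
    "HOL-Library.Poly_Mapping"
    "HOL-Library.Countable_Set"
    "HOL-Algebra.Coset"
    "HOL-Algebra.Module"
begin

section \<open>Unital C*-algebras on carrier sets\<close>

record 'a star_algebra = "(complex, 'a) module" +
  adj :: "'a \<Rightarrow> 'a"
  cnorm :: "'a \<Rightarrow> real"

locale cstar_algebra = ring A for A (structure) +
  assumes smult_closed: "x \<in> carrier A \<Longrightarrow> c \<odot> x \<in> carrier A"
    and smult_l_distr: "x \<in> carrier A \<Longrightarrow> (c + d) \<odot> x = c \<odot> x \<oplus> d \<odot> x"
    and smult_r_distr: "x \<in> carrier A \<Longrightarrow> y \<in> carrier A \<Longrightarrow> c \<odot> (x \<oplus> y) = c \<odot> x \<oplus> c \<odot> y"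
    and smult_assoc: "x \<in> carrier A \<Longrightarrow> (c * d) \<odot> x = c \<odot> (d \<odot> x)"
    and smult_one: "x \<in> carrier A \<Longrightarrow> 1 \<odot> x = x"
    and smult_mult_left: "x \<in> carrier A \<Longrightarrow> y \<in> carrier A \<Longrightarrow> (c \<odot> x) \<otimes> y = c \<odot> (x \<otimes> y)"
    and smult_mult_right: "x \<in> carrier A \<Longrightarrow> y \<in> carrier A \<Longrightarrow> x \<otimes> (c \<odot> y) = c \<odot> (x \<otimes> y)"
    and adj_closed: "x \<in> carrier A \<Longrightarrow> adj A x \<in> carrier A"
    and adj_adj: "x \<in> carrier A \<Longrightarrow> adj A (adj A x) = x"
    and adj_add: "x \<in> carrier A \<Longrightarrow> y \<in> carrier A \<Longrightarrow> adj A (x \<oplus> y) = adj A x \<oplus> adj A y"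
    and adj_smult: "x \<in> carrier A \<Longrightarrow> adj A (c \<odot> x) = cnj c \<odot> adj A x"
    and adj_mult: "x \<in> carrier A \<Longrightarrow> y \<in> carrier A \<Longrightarrow> adj A (x \<otimes> y) = adj A y \<otimes> adj A x"
    and norm_eq_0: "x \<in> carrier A \<Longrightarrow> cnorm A x = 0 \<longleftrightarrow> x = \<zero>"
    and norm_triangle: "x \<in> carrier A \<Longrightarrow> y \<in> carrier A \<Longrightarrow> cnorm A (x \<oplus> y) \<le> cnorm A x + cnorm A y"
    and norm_smult: "x \<in> carrier A \<Longrightarrow> cnorm A (c \<odot> x) = cmod c * cnorm A x"
    and norm_mult: "x \<in> carrier A \<Longrightarrow> y \<in> carrier A \<Longrightarrow> cnorm A (x \<otimes> y) \<le> cnorm A x * cnorm A y"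
    and norm_adj_mult: "x \<in> carrier A \<Longrightarrow> cnorm A (adj A x \<otimes> x) = (cnorm A x)\<^sup>2"
    and complete: "(\<And>n::nat. f n \<in> carrier A) \<Longrightarrow>
      (\<And>e. e > 0 \<Longrightarrow> \<exists>N. \<forall>m\<ge>N. \<forall>n\<ge>N. cnorm A (f m \<ominus> f n) < e) \<Longrightarrow>
      \<exists>x\<in>carrier A. (\<lambda>n. cnorm A (f n \<ominus> x)) \<longlonglongrightarrow> 0"

definition star_hom :: "('a, 'm) star_algebra_scheme \<Rightarrow> ('b, 'n) star_algebra_scheme \<Rightarrow> ('a \<Rightarrow> 'b) set"
  where "star_hom A B = {f \<in> carrier A \<rightarrow> carrier B.
    (\<forall>x\<in>carrier A. \<forall>y\<in>carrier A. f (x \<oplus>\<^bsub>A\<^esub> y) = f x \<oplus>\<^bsub>B\<^esub> f y) \<and>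
    (\<forall>x\<in>carrier A. \<forall>c. f (c \<odot>\<^bsub>A\<^esub> x) = c \<odot>\<^bsub>B\<^esub> f x) \<and>
    (\<forall>x\<in>carrier A. \<forall>y\<in>carrier A. f (x \<otimes>\<^bsub>A\<^esub> y) = f x \<otimes>\<^bsub>B\<^esub> f y) \<and>
    (\<forall>x\<in>carrier A. f (adj A x) = adj B (f x))}"


section \<open>Free unital *-algebras\<close>

text \<open>
  The letter \<open>(x, False)\<close> stands for the generator \<open>x\<close> and \<open>(x, True)\<close> for its adjoint. The library
  multiplication on \<open>\<Rightarrow>\<^sub>0\<close> is convolution, so \<open>'x free_star\<close> is the free unital
  complex *-algebra on the type \<open>'x\<close>, and \<open>free_alg X\<close> is the subalgebra on the generators in \<open>X\<close>.
\<close>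

datatype 'x star_word = Word (letters: "('x \<times> bool) list")

instantiation star_word :: (type) monoid_add
begin
definition "0 = Word []"
definition "v + w = Word (letters v @ letters w)"
instance by standard (auto simp: zero_star_word_def plus_star_word_def)
end

type_synonym 'x free_star = "'x star_word \<Rightarrow>\<^sub>0 complex"

definition word_adj :: "'x star_word \<Rightarrow> 'x star_word"
  where "word_adj w = Word (rev (map (\<lambda>(x, b). (x, \<not> b)) (letters w)))"

definition fgen :: "'x \<Rightarrow> 'x free_star"
  where "fgen x = Poly_Mapping.single (Word [(x, False)]) 1"

definition fscale :: "complex \<Rightarrow> 'x free_star \<Rightarrow> 'x free_star"
  where "fscale c a = Poly_Mapping.single 0 c * a"

definition fadj :: "'x free_star \<Rightarrow> 'x free_star"
  where "fadj a = (\<Sum>w\<in>Poly_Mapping.keys a. Poly_Mapping.single (word_adj w) (cnj (Poly_Mapping.lookup a w)))"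

definition free_alg :: "'x set \<Rightarrow> 'x free_star set"
  where "free_alg X = {a. \<forall>w\<in>Poly_Mapping.keys a. fst ` set (letters w) \<subseteq> X}"

lemma fsa_decomp: "a = (\<Sum>w\<in>Poly_Mapping.keys a. Poly_Mapping.single w (Poly_Mapping.lookup a w))"
  for a :: "'x free_star"
  by (rule poly_mapping_eqI) (auto simp: lookup_sum lookup_single when_def in_keys_iff)

lemma free_alg_0 [simp]: "0 \<in> free_alg X"
  by (simp add: free_alg_def)

lemma free_alg_1 [simp]: "1 \<in> free_alg X"
  by (simp add: free_alg_def zero_star_word_def)

lemma free_alg_add [simp]: "a \<in> free_alg X \<Longrightarrow> b \<in> free_alg X \<Longrightarrow> a + b \<in> free_alg X"
  unfolding free_alg_def using Poly_Mapping.keys_add[of a b] by blast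

lemma free_alg_mult [simp]: "a \<in> free_alg X \<Longrightarrow> b \<in> free_alg X \<Longrightarrow> a * b \<in> free_alg X"
  unfolding free_alg_def using Poly_Mapping.keys_mult[of a b]
  by (fastforce simp: plus_star_word_def)

lemma free_alg_single: "fst ` set (letters w) \<subseteq> X \<Longrightarrow> Poly_Mapping.single w c \<in> free_alg X"
  by (simp add: free_alg_def)

lemma free_alg_scale [simp]: "a \<in> free_alg X \<Longrightarrow> fscale c a \<in> free_alg X"
  unfolding fscale_def by (intro free_alg_mult free_alg_single) (auto simp: zero_star_word_def)

lemma free_alg_sum: "(\<And>i. i \<in> I \<Longrightarrow> f i \<in> free_alg X) \<Longrightarrow> sum f I \<in> free_alg X"
  by (induction I rule: infinite_finite_induct) auto

lemma free_alg_adj [simp]: "a \<in> free_alg X \<Longrightarrow> fadj a \<in> free_alg X"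
  unfolding fadj_def
  by (intro free_alg_sum free_alg_single) (force simp: free_alg_def word_adj_def)

lemma fscale_minus_one: "fscale (-1) a = - a"
  by (simp add: fscale_def single_uminus)

lemma free_alg_uminus [simp]: "a \<in> free_alg X \<Longrightarrow> - a \<in> free_alg X"
  using free_alg_scale[of a X "-1"] by (simp only: fscale_minus_one)

lemma free_alg_diff [simp]: "a \<in> free_alg X \<Longrightarrow> b \<in> free_alg X \<Longrightarrow> a - b \<in> free_alg X"
  using free_alg_add[of a X "-b"] by simp

lemma free_alg_gen [simp]: "x \<in> X \<Longrightarrow> fgen x \<in> free_alg X"
  by (simp add: fgen_def free_alg_def)

lemma free_alg_induct [consumes 1, case_names zero add]:
  assumes "a \<in> free_alg X" "P 0"
    and "\<And>a w c. a \<in> free_alg X \<Longrightarrow> P a \<Longrightarrow> fst ` set (letters w) \<subseteq> X \<Longrightarrow> P (a + Poly_Mapping.single w c)"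
  shows "P a"
proof -
  have "sum (\<lambda>w. Poly_Mapping.single w (Poly_Mapping.lookup a w)) W \<in> free_alg X \<and>
      P (sum (\<lambda>w. Poly_Mapping.single w (Poly_Mapping.lookup a w)) W)"
    if "finite W" "W \<subseteq> Poly_Mapping.keys a" for W
    using that
  proof (induction W rule: finite_induct)
    case (insert w W)
    have "fst ` set (letters w) \<subseteq> X"
      using insert.prems assms(1) by (auto simp: free_alg_def)
    then show ?case
      using insert assms(3)[of "\<Sum>w\<in>W. Poly_Mapping.single w (Poly_Mapping.lookup a w)" w "Poly_Mapping.lookup a w"]
      by (simp add: add.commute[of "Poly_Mapping.single w _"] free_alg_single)
  qed (use assms in auto)
  from this[of "Poly_Mapping.keys a"] show ?thesis
    using fsa_decomp[of a] by simp
qed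

lemma word_adj_word_adj [simp]: "word_adj (word_adj w) = w"
  by (cases w) (auto simp: word_adj_def rev_map comp_def case_prod_beta)

lemma word_adj_0 [simp]: "word_adj 0 = 0"
  by (simp add: word_adj_def zero_star_word_def)

lemma word_adj_add: "word_adj (v + w) = word_adj w + word_adj v"
  by (simp add: word_adj_def plus_star_word_def)

lemma word_adj_eq_iff: "word_adj v = w \<longleftrightarrow> v = word_adj w"
  by auto

lemma lookup_fadj: "Poly_Mapping.lookup (fadj a) w = cnj (Poly_Mapping.lookup a (word_adj w))"
  by (auto simp: fadj_def lookup_sum lookup_single when_def in_keys_iff word_adj_eq_iff)

lemma fadj_single: "fadj (Poly_Mapping.single w c) = Poly_Mapping.single (word_adj w) (cnj c)"
  by (rule poly_mapping_eqI) (auto simp: lookup_fadj lookup_single when_def)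

lemma fadj_add: "fadj (a + b) = fadj a + fadj b"
  by (rule poly_mapping_eqI) (simp add: lookup_fadj lookup_add)

lemma fadj_diff: "fadj (a - b) = fadj a - fadj b"
  by (rule poly_mapping_eqI) (simp add: lookup_fadj lookup_minus)

lemma fadj_0 [simp]: "fadj 0 = 0"
  by (simp add: fadj_def)

lemma fadj_1 [simp]: "fadj 1 = 1"
  by (simp add: fadj_single flip: single_one)

lemma fadj_fadj [simp]: "fadj (fadj a) = a"
  by (rule poly_mapping_eqI) (simp add: lookup_fadj)

lemma fadj_mult: "fadj (a * b) = fadj b * fadj a"
proof -
  have "a \<in> free_alg UNIV" "b \<in> free_alg UNIV"
    by (auto simp: free_alg_def)
  then show ?thesis
  proof (induction a rule: free_alg_induct)
    case (add a w c)
    have "fadj (Poly_Mapping.single w c * b) = fadj b * fadj (Poly_Mapping.single w c)"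
      using add.prems
      by (induction b rule: free_alg_induct)
        (simp_all add: distrib_left distrib_right fadj_add mult_single fadj_single word_adj_add mult.commute)
    then show ?case
      using add by (simp add: distrib_left distrib_right fadj_add)
  qed simp
qed

lemma fscale_central: "Poly_Mapping.single 0 c * a = a * Poly_Mapping.single 0 c" for a :: "'x free_star"
proof -
  have "a \<in> free_alg UNIV"
    by (auto simp: free_alg_def)
  then show ?thesis
    by (induction a rule: free_alg_induct) (simp_all add: distrib_left distrib_right mult_single mult.commute)
qed

lemma fadj_scale: "fadj (fscale c a) = fscale (cnj c) (fadj a)"
  by (simp add: fscale_def fadj_mult fadj_single fscale_central)

lemma fscale_add: "fscale c (a + b) = fscale c a + fscale c b"
  by (simp add: fscale_def distrib_left)

lemma fscale_diff: "fscale c (a - b) = fscale c a - fscale c b"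
  by (simp add: fscale_def right_diff_distrib)

lemma fscale_add_left: "fscale (c + d) a = fscale c a + fscale d a"
  by (simp add: fscale_def single_add distrib_right)

lemma fscale_fscale: "fscale (c * d) a = fscale c (fscale d a)"
  by (simp add: fscale_def mult_single flip: mult.assoc)

lemma fscale_1 [simp]: "fscale 1 a = a"
  by (simp add: fscale_def)

lemma fscale_0 [simp]: "fscale 0 a = 0"
  by (simp add: fscale_def)

lemma fscale_mult_left: "fscale c a * b = fscale c (a * b)"
  by (simp add: fscale_def mult.assoc)

lemma fscale_mult_right: "a * fscale c b = fscale c (a * b)"
  by (metis fscale_def fscale_central mult.assoc)


section \<open>Universal C*-algebras\<close>

locale cstar_seminorm =
  fixes X :: "'x set" and \<rho> :: "'x free_star \<Rightarrow> real"
  assumes triangle: "a \<in> free_alg X \<Longrightarrow> b \<in> free_alg X \<Longrightarrow> \<rho> (a + b) \<le> \<rho> a + \<rho> b"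
    and scale: "a \<in> free_alg X \<Longrightarrow> \<rho> (fscale c a) = cmod c * \<rho> a"
    and submult: "a \<in> free_alg X \<Longrightarrow> b \<in> free_alg X \<Longrightarrow> \<rho> (a * b) \<le> \<rho> a * \<rho> b"
    and cstar: "a \<in> free_alg X \<Longrightarrow> \<rho> (fadj a * a) = (\<rho> a)\<^sup>2"

text \<open>
  The Hausdorff completion of \<open>free_alg X\<close> with respect to \<open>\<rho>\<close>: Cauchy sequences modulo null
  sequences, with the operations defined on representatives.
\<close>

definition cauchy_seqs :: "'x set \<Rightarrow> ('x free_star \<Rightarrow> real) \<Rightarrow> (nat \<Rightarrow> 'x free_star) set"
  where "cauchy_seqs X \<rho> = {a. (\<forall>n. a n \<in> free_alg X) \<and>
    (\<forall>e>0. \<exists>N. \<forall>m\<ge>N. \<forall>n\<ge>N. \<rho> (a m - a n) < e)}"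

definition null_rel :: "'x set \<Rightarrow> ('x free_star \<Rightarrow> real) \<Rightarrow> (nat \<Rightarrow> 'x free_star) rel"
  where "null_rel X \<rho> = {(a, b). a \<in> cauchy_seqs X \<rho> \<and> b \<in> cauchy_seqs X \<rho> \<and>
    (\<lambda>n. \<rho> (a n - b n)) \<longlonglongrightarrow> 0}"

abbreviation seq_class :: "'x set \<Rightarrow> ('x free_star \<Rightarrow> real) \<Rightarrow> (nat \<Rightarrow> 'x free_star) \<Rightarrow> (nat \<Rightarrow> 'x free_star) set"
  where "seq_class X \<rho> a \<equiv> null_rel X \<rho> `` {a}"

definition cstar_completion ::
    "'x set \<Rightarrow> ('x free_star \<Rightarrow> real) \<Rightarrow> (nat \<Rightarrow> 'x free_star) set star_algebra"
  where "cstar_completion X \<rho> =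
    \<lparr>carrier = cauchy_seqs X \<rho> // null_rel X \<rho>,
     monoid.mult = (\<lambda>\<alpha> \<beta>. \<Union>a\<in>\<alpha>. \<Union>b\<in>\<beta>. seq_class X \<rho> (\<lambda>n. a n * b n)),
     one = seq_class X \<rho> (\<lambda>_. 1),
     zero = seq_class X \<rho> (\<lambda>_. 0),
     add = (\<lambda>\<alpha> \<beta>. \<Union>a\<in>\<alpha>. \<Union>b\<in>\<beta>. seq_class X \<rho> (\<lambda>n. a n + b n)),
     smult = (\<lambda>c \<alpha>. \<Union>a\<in>\<alpha>. seq_class X \<rho> (\<lambda>n. fscale c (a n))),
     adj = (\<lambda>\<alpha>. \<Union>a\<in>\<alpha>. seq_class X \<rho> (\<lambda>n. fadj (a n))),
     cnorm = (\<lambda>\<alpha>. THE r. \<exists>a\<in>\<alpha>. (\<lambda>n. \<rho> (a n)) \<longlonglongrightarrow> r)\<rparr>"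

context cstar_seminorm
begin

lemma rho_0 [simp]: "\<rho> 0 = 0"
  using scale[of 0 0] by simp

lemma rho_uminus: "a \<in> free_alg X \<Longrightarrow> \<rho> (- a) = \<rho> a"
  using scale[of a "-1"] by (simp add: fscale_minus_one)

lemma rho_nonneg: "a \<in> free_alg X \<Longrightarrow> 0 \<le> \<rho> a"
  using triangle[of a "-a"] by (simp add: rho_uminus)

lemma rho_triangle_diff: "a \<in> free_alg X \<Longrightarrow> b \<in> free_alg X \<Longrightarrow> \<rho> (a - b) \<le> \<rho> a + \<rho> b"
  using triangle[of a "-b"] by (simp add: rho_uminus)

lemma rho_diff_commute: "a \<in> free_alg X \<Longrightarrow> b \<in> free_alg X \<Longrightarrow> \<rho> (a - b) = \<rho> (b - a)"
  using rho_uminus[of "a - b"] by simp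

lemma rho_triangle3:
  "a \<in> free_alg X \<Longrightarrow> b \<in> free_alg X \<Longrightarrow> c \<in> free_alg X \<Longrightarrow> \<rho> (a - c) \<le> \<rho> (a - b) + \<rho> (b - c)"
  using triangle[of "a - b" "b - c"] by simp

lemma rho_reverse_triangle:
  "a \<in> free_alg X \<Longrightarrow> b \<in> free_alg X \<Longrightarrow> \<bar>\<rho> a - \<rho> b\<bar> \<le> \<rho> (a - b)"
  using triangle[of "a - b" b] triangle[of "b - a" a] by (simp add: rho_diff_commute abs_le_iff)

lemma rho_adj: assumes "a \<in> free_alg X" shows "\<rho> (fadj a) = \<rho> a"
proof -
  have le: "\<rho> b \<le> \<rho> (fadj b)" if "b \<in> free_alg X" for b
  proof (cases "\<rho> b = 0")
    case False
    then have pos: "\<rho> b > 0"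
      using rho_nonneg[OF that] by simp
    have "\<rho> b * \<rho> b \<le> \<rho> (fadj b) * \<rho> b"
      using submult[of "fadj b" b] cstar[of b] that by (simp add: power2_eq_square)
    then show ?thesis
      using pos by simp
  qed (use rho_nonneg that in simp)
  from le[of a] le[of "fadj a"] show ?thesis
    using assms by simp
qed

lemma rho_1_le: "\<rho> 1 \<le> 1"
proof -
  have "\<rho> 1 = \<rho> 1 * \<rho> 1"
    using cstar[of 1] by (simp add: power2_eq_square)
  then show ?thesis
    by (metis mult_cancel_right2 order.refl zero_le_one)
qed

abbreviation "CS \<equiv> cauchy_seqs X \<rho>"
abbreviation "NR \<equiv> null_rel X \<rho>"
abbreviation "cls \<equiv> seq_class X \<rho>"
abbreviation "CA \<equiv> cstar_completion X \<rho>"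

lemma CS_free: "a \<in> CS \<Longrightarrow> a n \<in> free_alg X"
  by (simp add: cauchy_seqs_def)

lemma CS_cauchy: "a \<in> CS \<Longrightarrow> e > 0 \<Longrightarrow> \<exists>N. \<forall>m\<ge>N. \<forall>n\<ge>N. \<rho> (a m - a n) < e"
  by (simp add: cauchy_seqs_def)

lemma CS_I:
  assumes "\<And>n. a n \<in> free_alg X"
    and "\<And>e. e > 0 \<Longrightarrow> \<exists>N. \<forall>m\<ge>N. \<forall>n\<ge>N. \<rho> (a m - a n) < e"
  shows "a \<in> CS"
  using assms by (simp add: cauchy_seqs_def)

lemma CS_domI:
  assumes a: "a \<in> CS" and b: "b \<in> CS" and c: "\<And>n. c n \<in> free_alg X" and K: "K \<ge> 0" "L \<ge> 0"
    and le: "\<And>m n. \<rho> (c m - c n) \<le> K * \<rho> (a m - a n) + L * \<rho> (b m - b n)"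
  shows "c \<in> CS"
proof (rule CS_I)
  fix e :: real assume e: "e > 0"
  define d where "d = e / (K + L + 1)"
  have d: "d > 0" "(K + L) * d < e"
    using e K by (auto simp: d_def field_simps)
  obtain N1 N2 where N: "\<forall>m\<ge>N1. \<forall>n\<ge>N1. \<rho> (a m - a n) < d" "\<forall>m\<ge>N2. \<forall>n\<ge>N2. \<rho> (b m - b n) < d"
    using CS_cauchy[OF a d(1)] CS_cauchy[OF b d(1)] by blast
  have "\<rho> (c m - c n) < e" if "m \<ge> max N1 N2" "n \<ge> max N1 N2" for m n
  proof -
    have "K * \<rho> (a m - a n) \<le> K * d" "L * \<rho> (b m - b n) \<le> L * d"
      using N that K by (auto intro!: mult_left_mono simp: less_imp_le)
    then show ?thesis
      using le[of m n] d by (simp add: algebra_simps)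
  qed
  then show "\<exists>N. \<forall>m\<ge>N. \<forall>n\<ge>N. \<rho> (c m - c n) < e"
    by blast
qed (rule c)

lemma CS_const [simp]: "a \<in> free_alg X \<Longrightarrow> (\<lambda>_. a) \<in> CS"
  by (rule CS_I) auto

lemma CS_rho_convergent: assumes "a \<in> CS" shows "convergent (\<lambda>n. \<rho> (a n))"
proof -
  have "Cauchy (\<lambda>n. \<rho> (a n))"
  proof (rule metric_CauchyI)
    fix e :: real assume "e > 0"
    then obtain N where "\<forall>m\<ge>N. \<forall>n\<ge>N. \<rho> (a m - a n) < e"
      using CS_cauchy assms by blast
    moreover have "dist (\<rho> (a m)) (\<rho> (a n)) \<le> \<rho> (a m - a n)" for m n
      using rho_reverse_triangle CS_free[OF assms] by (simp add: dist_real_def)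
    ultimately have "\<forall>m\<ge>N. \<forall>n\<ge>N. dist (\<rho> (a m)) (\<rho> (a n)) < e"
      by (meson le_less_trans)
    then show "\<exists>M. \<forall>m\<ge>M. \<forall>n\<ge>M. dist (\<rho> (a m)) (\<rho> (a n)) < e"
      by blast
  qed
  then show ?thesis
    by (simp add: Cauchy_convergent_iff)
qed

lemma CS_bounded: assumes "a \<in> CS" shows "\<exists>K\<ge>0. \<forall>n. \<rho> (a n) \<le> K"
proof -
  have "Bseq (\<lambda>n. \<rho> (a n))"
    using CS_rho_convergent[OF assms] convergent_imp_Bseq by blast
  then obtain K where "K > 0" "\<And>n. \<bar>\<rho> (a n)\<bar> \<le> K"
    by (auto simp: Bseq_def)
  then show ?thesis
    by (intro exI[of _ K]) (auto intro: abs_le_D1)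
qed

lemma rho_mult_diff:
  assumes "a \<in> free_alg X" "b \<in> free_alg X" "a' \<in> free_alg X" "b' \<in> free_alg X"
    "\<rho> a \<le> K" "\<rho> b' \<le> L"
  shows "\<rho> (a * b - a' * b') \<le> L * \<rho> (a - a') + K * \<rho> (b - b')"
proof -
  have "a * b - a' * b' = (a - a') * b' + a * (b - b')"
    by (simp add: algebra_simps)
  then have "\<rho> (a * b - a' * b') \<le> \<rho> ((a - a') * b') + \<rho> (a * (b - b'))"
    using triangle[of "(a - a') * b'" "a * (b - b')"] assms by simp
  also have "\<dots> \<le> \<rho> (a - a') * \<rho> b' + \<rho> a * \<rho> (b - b')"
    using assms by (intro add_mono submult) auto
  also have "\<dots> \<le> \<rho> (a - a') * L + K * \<rho> (b - b')"
    using assms by (intro add_mono mult_left_mono mult_right_mono rho_nonneg) auto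
  finally show ?thesis
    by (simp add: mult.commute)
qed

lemma rho_add_diff:
  assumes "a \<in> free_alg X" "b \<in> free_alg X" "a' \<in> free_alg X" "b' \<in> free_alg X"
  shows "\<rho> (a + b - (a' + b')) \<le> \<rho> (a - a') + \<rho> (b - b')"
  using triangle[of "a - a'" "b - b'"] assms by (simp add: algebra_simps)

lemma CS_mult [simp]: assumes a: "a \<in> CS" and b: "b \<in> CS" shows "(\<lambda>n. a n * b n) \<in> CS"
proof -
  obtain K where K: "K \<ge> 0" "\<forall>n. \<rho> (a n) \<le> K" using CS_bounded[OF a] by blast
  obtain L where L: "L \<ge> 0" "\<forall>n. \<rho> (b n) \<le> L" using CS_bounded[OF b] by blast
  show ?thesis
    using K L a b by (intro CS_domI[OF a b, of _ L K] rho_mult_diff) (auto simp: CS_free)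
qed

lemma CS_add [simp]: assumes a: "a \<in> CS" and b: "b \<in> CS" shows "(\<lambda>n. a n + b n) \<in> CS"
  using rho_add_diff a b by (intro CS_domI[OF a b, of _ 1 1]) (auto simp: CS_free)

lemma CS_scale [simp]: assumes a: "a \<in> CS" shows "(\<lambda>n. fscale c (a n)) \<in> CS"
  using a by (intro CS_domI[OF a a, of _ "cmod c" 0]) (auto simp: CS_free scale simp flip: fscale_diff)

lemma CS_adj [simp]: assumes a: "a \<in> CS" shows "(\<lambda>n. fadj (a n)) \<in> CS"
  using a by (intro CS_domI[OF a a, of _ 1 0]) (auto simp: CS_free rho_adj simp flip: fadj_diff)

lemma NR_iff: "(a, b) \<in> NR \<longleftrightarrow> a \<in> CS \<and> b \<in> CS \<and> (\<lambda>n. \<rho> (a n - b n)) \<longlonglongrightarrow> 0"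
  by (simp add: null_rel_def)

lemma null_domI:
  assumes "(a, a') \<in> NR" "(b, b') \<in> NR" "c \<in> CS" "c' \<in> CS"
    and "\<And>n. \<rho> (c n - c' n) \<le> K * \<rho> (a n - a' n) + L * \<rho> (b n - b' n)"
  shows "(c, c') \<in> NR"
proof -
  have "(\<lambda>n. K * \<rho> (a n - a' n) + L * \<rho> (b n - b' n)) \<longlonglongrightarrow> K * 0 + L * 0"
    using assms by (intro tendsto_intros) (auto simp: NR_iff)
  then have lim: "(\<lambda>n. K * \<rho> (a n - a' n) + L * \<rho> (b n - b' n)) \<longlonglongrightarrow> 0"
    by simp
  have "(\<lambda>n. \<rho> (c n - c' n)) \<longlonglongrightarrow> 0"
    by (rule real_tendsto_sandwich[OF _ _ tendsto_const lim]) (use assms in \<open>auto simp: rho_nonneg CS_free\<close>)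
  then show ?thesis
    using assms by (simp add: NR_iff)
qed

lemma NR_refl: "a \<in> CS \<Longrightarrow> (a, a) \<in> NR"
  by (simp add: NR_iff)

lemma NR_equiv: "equiv CS NR"
proof (rule equivI)
  show "NR \<subseteq> CS \<times> CS"
    by (auto simp: NR_iff)
  show "refl_on CS NR"
    by (auto simp: refl_on_def NR_iff)
  show "sym NR"
    by (auto simp: sym_def NR_iff rho_diff_commute CS_free)
  show "trans NR"
  proof (rule transI)
    fix a b c assume ab: "(a, b) \<in> NR" and bc: "(b, c) \<in> NR"
    then show "(a, c) \<in> NR"
      by (intro null_domI[OF ab bc, of _ _ 1 1]) (auto simp: NR_iff CS_free rho_triangle3)
  qed
qed

lemma cls_eq_iff: "a \<in> CS \<Longrightarrow> b \<in> CS \<Longrightarrow> cls a = cls b \<longleftrightarrow> (\<lambda>n. \<rho> (a n - b n)) \<longlonglongrightarrow> 0"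
  using eq_equiv_class_iff[OF NR_equiv, of a b] by (simp add: NR_iff)

lemma carrier_CA: "carrier CA = CS // NR"
  by (simp add: cstar_completion_def)

lemma cls_carrier [simp]: "a \<in> CS \<Longrightarrow> cls a \<in> carrier CA"
  by (simp add: carrier_CA quotientI)

lemma carrierE: assumes "\<alpha> \<in> carrier CA" obtains a where "a \<in> CS" "\<alpha> = cls a"
  using assms by (auto simp: carrier_CA elim: quotientE)

lemma cls_mult [simp]: assumes "a \<in> CS" "b \<in> CS" shows "cls a \<otimes>\<^bsub>CA\<^esub> cls b = cls (\<lambda>n. a n * b n)"
proof -
  have "congruent2 NR NR (\<lambda>a b. cls (\<lambda>n. a n * b n))"
  proof (rule congruent2I')
    fix a a' b b' assume n: "(a, a') \<in> NR" "(b, b') \<in> NR"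
    then have CS: "a \<in> CS" "b \<in> CS" "a' \<in> CS" "b' \<in> CS"
      by (auto simp: NR_iff)
    obtain K where K: "K \<ge> 0" "\<forall>n. \<rho> (a n) \<le> K" using CS_bounded[OF CS(1)] by blast
    obtain L where L: "L \<ge> 0" "\<forall>n. \<rho> (b' n) \<le> L" using CS_bounded[OF CS(4)] by blast
    have "((\<lambda>n. a n * b n), (\<lambda>n. a' n * b' n)) \<in> NR"
      using CS K L by (intro null_domI[OF n, of _ _ L K] rho_mult_diff) (auto simp: CS_free)
    then show "cls (\<lambda>n. a n * b n) = cls (\<lambda>n. a' n * b' n)"
      using NR_equiv by (rule equiv_class_eq[rotated])
  qed
  from UN_equiv_class2[OF NR_equiv NR_equiv this assms] show ?thesis
    by (simp add: cstar_completion_def)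
qed

lemma cls_add [simp]: assumes "a \<in> CS" "b \<in> CS" shows "cls a \<oplus>\<^bsub>CA\<^esub> cls b = cls (\<lambda>n. a n + b n)"
proof -
  have "congruent2 NR NR (\<lambda>a b. cls (\<lambda>n. a n + b n))"
  proof (rule congruent2I')
    fix a a' b b' assume n: "(a, a') \<in> NR" "(b, b') \<in> NR"
    then have "((\<lambda>n. a n + b n), (\<lambda>n. a' n + b' n)) \<in> NR"
      using rho_add_diff by (intro null_domI[OF n, of _ _ 1 1]) (auto simp: NR_iff CS_free)
    then show "cls (\<lambda>n. a n + b n) = cls (\<lambda>n. a' n + b' n)"
      using NR_equiv by (rule equiv_class_eq[rotated])
  qed
  from UN_equiv_class2[OF NR_equiv NR_equiv this assms] show ?thesis
    by (simp add: cstar_completion_def)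
qed

lemma cls_smult [simp]: assumes "a \<in> CS" shows "c \<odot>\<^bsub>CA\<^esub> cls a = cls (\<lambda>n. fscale c (a n))"
proof -
  have "(\<lambda>a. cls (\<lambda>n. fscale c (a n))) respects NR"
  proof (rule congruentI)
    fix a a' assume n: "(a, a') \<in> NR"
    then have "((\<lambda>n. fscale c (a n)), (\<lambda>n. fscale c (a' n))) \<in> NR"
      by (intro null_domI[OF n n, of _ _ "cmod c" 0]) (auto simp: NR_iff CS_free scale simp flip: fscale_diff)
    then show "cls (\<lambda>n. fscale c (a n)) = cls (\<lambda>n. fscale c (a' n))"
      using NR_equiv by (rule equiv_class_eq[rotated])
  qed
  from UN_equiv_class[OF NR_equiv this assms] show ?thesis
    by (simp add: cstar_completion_def)
qed

lemma cls_adj [simp]: assumes "a \<in> CS" shows "adj CA (cls a) = cls (\<lambda>n. fadj (a n))"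
proof -
  have "(\<lambda>a. cls (\<lambda>n. fadj (a n))) respects NR"
  proof (rule congruentI)
    fix a a' assume n: "(a, a') \<in> NR"
    then have "((\<lambda>n. fadj (a n)), (\<lambda>n. fadj (a' n))) \<in> NR"
      by (intro null_domI[OF n n, of _ _ 1 0]) (auto simp: NR_iff CS_free rho_adj simp flip: fadj_diff)
    then show "cls (\<lambda>n. fadj (a n)) = cls (\<lambda>n. fadj (a' n))"
      using NR_equiv by (rule equiv_class_eq[rotated])
  qed
  from UN_equiv_class[OF NR_equiv this assms] show ?thesis
    by (simp add: cstar_completion_def)
qed

lemma cls_one: "\<one>\<^bsub>CA\<^esub> = cls (\<lambda>_. 1)"
  by (simp add: cstar_completion_def)

lemma cls_zero: "\<zero>\<^bsub>CA\<^esub> = cls (\<lambda>_. 0)"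
  by (simp add: cstar_completion_def)

lemma rho_tendsto_cong:
  assumes "(a, b) \<in> NR" "(\<lambda>n. \<rho> (a n)) \<longlonglongrightarrow> r" shows "(\<lambda>n. \<rho> (b n)) \<longlonglongrightarrow> r"
proof -
  have "(\<lambda>n. \<rho> (b n) - \<rho> (a n)) \<longlonglongrightarrow> 0"
    by (rule tendsto_0_le[of "\<lambda>n. \<rho> (a n - b n)" _ _ 1])
      (use assms rho_reverse_triangle in \<open>auto simp: NR_iff CS_free rho_nonneg abs_minus_commute\<close>)
  from tendsto_add[OF this assms(2)] show ?thesis
    by simp
qed

lemma cls_norm_tendsto: assumes "a \<in> CS" shows "(\<lambda>n. \<rho> (a n)) \<longlonglongrightarrow> cnorm CA (cls a)"
proof -
  obtain r where r: "(\<lambda>n. \<rho> (a n)) \<longlonglongrightarrow> r"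
    using CS_rho_convergent[OF assms] by (auto simp: convergent_def)
  have "cnorm CA (cls a) = r"
    unfolding cstar_completion_def star_algebra.simps
  proof (rule the_equality)
    show "\<exists>b\<in>cls a. (\<lambda>n. \<rho> (b n)) \<longlonglongrightarrow> r"
      using r NR_refl[OF assms] by blast
    fix r' assume "\<exists>b\<in>cls a. (\<lambda>n. \<rho> (b n)) \<longlonglongrightarrow> r'"
    then obtain b where "(a, b) \<in> NR" "(\<lambda>n. \<rho> (b n)) \<longlonglongrightarrow> r'"
      by blast
    then show "r' = r"
      using rho_tendsto_cong[OF _ r] LIMSEQ_unique by blast
  qed
  then show ?thesis
    using r by simp
qed

lemma cls_norm_const: "a \<in> free_alg X \<Longrightarrow> cnorm CA (cls (\<lambda>_. a)) = \<rho> a"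
  using LIMSEQ_unique[OF cls_norm_tendsto[of "\<lambda>_. a"] tendsto_const] by simp

lemma CA_ring: "ring CA"
proof (rule ringI)
  show "abelian_group CA"
  proof (rule abelian_groupI)
    fix \<alpha> assume "\<alpha> \<in> carrier CA"
    then obtain a where a: "a \<in> CS" "\<alpha> = cls a"
      by (rule carrierE)
    have "cls (\<lambda>n. fscale (-1) (a n)) \<oplus>\<^bsub>CA\<^esub> \<alpha> = \<zero>\<^bsub>CA\<^esub>"
      using a by (simp add: cls_zero del: CS_scale add: CS_scale[OF a(1)]) (simp add: fscale_minus_one)
    then show "\<exists>\<beta>\<in>carrier CA. \<beta> \<oplus>\<^bsub>CA\<^esub> \<alpha> = \<zero>\<^bsub>CA\<^esub>"
      using a by (intro bexI[of _ "cls (\<lambda>n. fscale (-1) (a n))"]) auto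
  qed (auto elim!: carrierE simp: cls_zero add_ac)
  show "Group.monoid CA"
    by (rule monoidI) (auto elim!: carrierE simp: cls_one mult.assoc)
qed (auto elim!: carrierE simp: distrib_left distrib_right)

sublocale CA: ring CA
  by (rule CA_ring)

lemma cls_minus [simp]: assumes "a \<in> CS" "b \<in> CS" shows "cls a \<ominus>\<^bsub>CA\<^esub> cls b = cls (\<lambda>n. a n - b n)"
proof -
  have m: "(\<lambda>n. - b n) \<in> CS"
    using CS_scale[OF assms(2), of "-1"] by (simp add: fscale_minus_one)
  have "\<ominus>\<^bsub>CA\<^esub> cls b = cls (\<lambda>n. - b n)"
    using assms m by (intro CA.minus_equality) (simp_all add: cls_zero)
  then show ?thesis
    using assms m by (simp add: a_minus_def)
qed

lemma CS_minus [simp]: "a \<in> CS \<Longrightarrow> b \<in> CS \<Longrightarrow> (\<lambda>n. a n - b n) \<in> CS"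
  using CS_add[OF _ CS_scale[of b "-1"], of a] by (simp add: fscale_minus_one)

lemma cls_norm_unique: "a \<in> CS \<Longrightarrow> (\<lambda>n. \<rho> (a n)) \<longlonglongrightarrow> r \<Longrightarrow> cnorm CA (cls a) = r"
  using cls_norm_tendsto LIMSEQ_unique by blast

lemma cls_norm_nonneg: "a \<in> CS \<Longrightarrow> 0 \<le> cnorm CA (cls a)"
  by (rule LIMSEQ_le_const[OF cls_norm_tendsto]) (auto simp: rho_nonneg CS_free)

lemma cls_norm_le: 
  assumes "a \<in> CS" "\<And>n. n \<ge> N \<Longrightarrow> \<rho> (a n) \<le> r" shows "cnorm CA (cls a) \<le> r"
  by (rule LIMSEQ_le_const2[OF cls_norm_tendsto]) (use assms in auto)

lemma CA_norm_triangle: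
  assumes "a \<in> CS" "b \<in> CS" shows "cnorm CA (cls (\<lambda>n. a n + b n)) \<le> cnorm CA (cls a) + cnorm CA (cls b)"
  using assms
  by (intro LIMSEQ_le[OF cls_norm_tendsto tendsto_add[OF cls_norm_tendsto cls_norm_tendsto]])
    (auto simp: triangle CS_free)

lemma CA_norm_0: "a \<in> CS \<Longrightarrow> cnorm CA (cls a) = 0 \<longleftrightarrow> cls a = \<zero>\<^bsub>CA\<^esub>"
  using cls_norm_tendsto[of a] cls_norm_unique[of a 0] by (auto simp: cls_zero cls_eq_iff)

lemma CA_complete:
  assumes f: "\<And>n::nat. f n \<in> carrier CA"
    and cauchy: "\<And>e. e > 0 \<Longrightarrow> \<exists>N. \<forall>m\<ge>N. \<forall>n\<ge>N. cnorm CA (f m \<ominus>\<^bsub>CA\<^esub> f n) < e"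
  shows "\<exists>\<alpha>\<in>carrier CA. (\<lambda>n. cnorm CA (f n \<ominus>\<^bsub>CA\<^esub> \<alpha>)) \<longlonglongrightarrow> 0"
proof -
  have "\<exists>a. a \<in> CS \<and> f k = cls a" for k
    using carrierE[OF f[of k]] by blast
  then have "\<exists>a. \<forall>k. a k \<in> CS \<and> f k = cls (a k)"
    by (intro choice allI)
  then obtain a where a: "\<And>k. a k \<in> CS" "\<And>k. f k = cls (a k)"
    by blast
  have "\<exists>N. \<forall>k. \<forall>m\<ge>N k. \<forall>n\<ge>N k. \<rho> (a k m - a k n) < 1 / real (Suc k)"
    using CS_cauchy[OF a(1)] by (intro choice allI) auto
  then obtain N where N: "\<And>k m n. m \<ge> N k \<Longrightarrow> n \<ge> N k \<Longrightarrow> \<rho> (a k m - a k n) < 1 / real (Suc k)"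
    by blast
  define b where "b k = a k (N k)" for k
  have bF [simp]: "b k \<in> free_alg X" for k
    using CS_free[OF a(1)] by (simp add: b_def)
  have near: "cnorm CA (cls (\<lambda>n. a k n - b k)) \<le> 1 / real (Suc k)" for k
    using a(1) N by (intro cls_norm_le[of _ "N k"]) (auto simp: b_def less_imp_le CS_free)
  have near': "cnorm CA (cls (\<lambda>n. b k - a k n)) \<le> 1 / real (Suc k)" for k
    using a(1) N by (intro cls_norm_le[of _ "N k"]) (auto simp: b_def less_imp_le CS_free)
  have bcauchy: "b \<in> CS"
  proof (rule CS_I)
    fix e :: real assume e: "e > 0"
    then have "e / 3 > 0" by simp
    then obtain M1 where M1: "\<forall>m\<ge>M1. \<forall>n\<ge>M1. cnorm CA (f m \<ominus>\<^bsub>CA\<^esub> f n) < e / 3"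
      using cauchy by blast
    obtain M2 where M2: "1 / real (Suc M2) < e / 3"
      using \<open>e / 3 > 0\<close> by (metis nat_approx_posE)
    have small: "1 / real (Suc m) < e / 3" if "m \<ge> M2" for m
    proof -
      have "1 / real (Suc m) \<le> 1 / real (Suc M2)"
        using that by (simp add: frac_le)
      then show ?thesis using M2 by simp
    qed
    have "\<rho> (b m - b n) < e" if "m \<ge> max M1 M2" "n \<ge> max M1 M2" for m n
    proof -
      have eq: "(\<lambda>i. b m - b n) = (\<lambda>i. (b m - a m i) + ((a m i - a n i) + (a n i - b n)))"
        by (rule ext) simp
      have "\<rho> (b m - b n) = cnorm CA (cls (\<lambda>i. b m - b n))"
        by (simp add: cls_norm_const)
      also have "\<dots> = cnorm CA (cls (\<lambda>i. (b m - a m i) + ((a m i - a n i) + (a n i - b n))))"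
        by (simp only: eq)
      also have "\<dots> \<le> cnorm CA (cls (\<lambda>i. b m - a m i)) + (cnorm CA (cls (\<lambda>i. a m i - a n i)) + cnorm CA (cls (\<lambda>i. a n i - b n)))"
        using a(1) by (intro order.trans[OF CA_norm_triangle] add_left_mono CA_norm_triangle) auto
      also have "\<dots> < e / 3 + (e / 3 + e / 3)"
      proof -
        have "cnorm CA (cls (\<lambda>i. a m i - a n i)) < e / 3"
          using M1 that a by simp
        moreover have "1 / real (Suc m) < e / 3" "1 / real (Suc n) < e / 3"
          using small that by auto
        ultimately show ?thesis
          using near'[of m] near[of n] by linarith
      qed
      finally show ?thesis by simp
    qed
    then show "\<exists>N. \<forall>m\<ge>N. \<forall>n\<ge>N. \<rho> (b m - b n) < e"
      by blast
  qed simp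
  have "(\<lambda>k. cnorm CA (f k \<ominus>\<^bsub>CA\<^esub> cls b)) \<longlonglongrightarrow> 0"
  proof (rule LIMSEQ_I)
    fix e :: real assume e: "e > 0"
    then have "e / 3 > 0" by simp
    then obtain M1 where M1: "\<forall>m\<ge>M1. \<forall>n\<ge>M1. \<rho> (b m - b n) < e / 3"
      using CS_cauchy bcauchy by blast
    obtain M2 where M2: "1 / real (Suc M2) < e / 3"
      using \<open>e / 3 > 0\<close> by (metis nat_approx_posE)
    have "norm (cnorm CA (f k \<ominus>\<^bsub>CA\<^esub> cls b) - 0) < e" if k: "k \<ge> max M1 M2" for k
    proof -
      have eq: "a k i - b i = (a k i - b k) + (b k - b i)" for i
        by simp
      have "cnorm CA (f k \<ominus>\<^bsub>CA\<^esub> cls b) = cnorm CA (cls (\<lambda>i. (a k i - b k) + (b k - b i)))"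
        using a bcauchy by (simp flip: eq)
      also have "\<dots> \<le> cnorm CA (cls (\<lambda>i. a k i - b k)) + cnorm CA (cls (\<lambda>i. b k - b i))"
        using a bcauchy by (intro CA_norm_triangle) auto
      also have "\<dots> \<le> 1 / real (Suc k) + e / 3"
        using M1 k bcauchy by (intro add_mono near cls_norm_le[of _ M1]) (auto simp: less_imp_le)
      also have "1 / real (Suc k) \<le> 1 / real (Suc M2)"
        using k by (simp add: frac_le)
      finally have "cnorm CA (f k \<ominus>\<^bsub>CA\<^esub> cls b) < e"
        using M2 e by simp
      moreover have "0 \<le> cnorm CA (f k \<ominus>\<^bsub>CA\<^esub> cls b)"
        using a bcauchy by (simp add: cls_norm_nonneg)
      ultimately show ?thesis by simp
    qed
    then show "\<exists>K. \<forall>k\<ge>K. norm (cnorm CA (f k \<ominus>\<^bsub>CA\<^esub> cls b) - 0) < e"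
      by blast
  qed
  then show ?thesis
    using bcauchy by (intro bexI[of _ "cls b"]) auto
qed

theorem cstar_algebra_completion: "cstar_algebra CA"
proof
  fix \<alpha> \<beta> c d
  assume "\<alpha> \<in> carrier CA"
  then obtain a where a: "a \<in> CS" and \<alpha>: "\<alpha> = cls a"
    by (rule carrierE)
  show "c \<odot>\<^bsub>CA\<^esub> \<alpha> \<in> carrier CA" "adj CA \<alpha> \<in> carrier CA" "1 \<odot>\<^bsub>CA\<^esub> \<alpha> = \<alpha>"
    "(c + d) \<odot>\<^bsub>CA\<^esub> \<alpha> = c \<odot>\<^bsub>CA\<^esub> \<alpha> \<oplus>\<^bsub>CA\<^esub> d \<odot>\<^bsub>CA\<^esub> \<alpha>"
    "(c * d) \<odot>\<^bsub>CA\<^esub> \<alpha> = c \<odot>\<^bsub>CA\<^esub> (d \<odot>\<^bsub>CA\<^esub> \<alpha>)"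
    "adj CA (adj CA \<alpha>) = \<alpha>" "adj CA (c \<odot>\<^bsub>CA\<^esub> \<alpha>) = cnj c \<odot>\<^bsub>CA\<^esub> adj CA \<alpha>"
    using a by (simp_all add: \<alpha> fscale_add_left fscale_fscale fadj_scale)
  show "cnorm CA \<alpha> = 0 \<longleftrightarrow> \<alpha> = \<zero>\<^bsub>CA\<^esub>"
    using a by (simp add: \<alpha> CA_norm_0)
  show "cnorm CA (c \<odot>\<^bsub>CA\<^esub> \<alpha>) = cmod c * cnorm CA \<alpha>"
    using tendsto_mult_left[OF cls_norm_tendsto[OF a], of "cmod c"] a
    by (auto simp: \<alpha> scale CS_free intro!: cls_norm_unique)
  show "cnorm CA (adj CA \<alpha> \<otimes>\<^bsub>CA\<^esub> \<alpha>) = (cnorm CA \<alpha>)\<^sup>2"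
    using tendsto_power[OF cls_norm_tendsto[OF a], of 2] a
    by (auto simp: \<alpha> cstar CS_free intro!: cls_norm_unique)
  assume "\<beta> \<in> carrier CA"
  then obtain b where b: "b \<in> CS" and \<beta>: "\<beta> = cls b"
    by (rule carrierE)
  show "c \<odot>\<^bsub>CA\<^esub> (\<alpha> \<oplus>\<^bsub>CA\<^esub> \<beta>) = c \<odot>\<^bsub>CA\<^esub> \<alpha> \<oplus>\<^bsub>CA\<^esub> c \<odot>\<^bsub>CA\<^esub> \<beta>"
    "(c \<odot>\<^bsub>CA\<^esub> \<alpha>) \<otimes>\<^bsub>CA\<^esub> \<beta> = c \<odot>\<^bsub>CA\<^esub> (\<alpha> \<otimes>\<^bsub>CA\<^esub> \<beta>)"
    "\<alpha> \<otimes>\<^bsub>CA\<^esub> (c \<odot>\<^bsub>CA\<^esub> \<beta>) = c \<odot>\<^bsub>CA\<^esub> (\<alpha> \<otimes>\<^bsub>CA\<^esub> \<beta>)"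
    "adj CA (\<alpha> \<oplus>\<^bsub>CA\<^esub> \<beta>) = adj CA \<alpha> \<oplus>\<^bsub>CA\<^esub> adj CA \<beta>"
    "adj CA (\<alpha> \<otimes>\<^bsub>CA\<^esub> \<beta>) = adj CA \<beta> \<otimes>\<^bsub>CA\<^esub> adj CA \<alpha>"
    using a b by (simp_all add: \<alpha> \<beta> fscale_add fscale_mult_left fscale_mult_right fadj_add fadj_mult)
  show "cnorm CA (\<alpha> \<oplus>\<^bsub>CA\<^esub> \<beta>) \<le> cnorm CA \<alpha> + cnorm CA \<beta>"
    using a b by (simp add: \<alpha> \<beta> CA_norm_triangle)
  have "cnorm CA (cls (\<lambda>n. a n * b n)) \<le> cnorm CA (cls a) * cnorm CA (cls b)"
    using a b by (intro LIMSEQ_le[OF cls_norm_tendsto tendsto_mult[OF cls_norm_tendsto cls_norm_tendsto]])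
      (auto simp: submult CS_free)
  then show "cnorm CA (\<alpha> \<otimes>\<^bsub>CA\<^esub> \<beta>) \<le> cnorm CA \<alpha> * cnorm CA \<beta>"
    using a b by (simp add: \<alpha> \<beta>)
qed (rule CA_complete)

lemma CA_dense:
  assumes "\<alpha> \<in> carrier CA" "e > 0"
  shows "\<exists>a\<in>free_alg X. cnorm CA (\<alpha> \<ominus>\<^bsub>CA\<^esub> cls (\<lambda>_. a)) < e"
proof -
  obtain a where a: "a \<in> CS" "\<alpha> = cls a"
    using assms(1) by (rule carrierE)
  obtain N where N: "\<forall>m\<ge>N. \<forall>n\<ge>N. \<rho> (a m - a n) < e / 2"
    using CS_cauchy[OF a(1), of "e / 2"] assms(2) by auto
  have "cnorm CA (cls (\<lambda>n. a n - a N)) \<le> e / 2"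
    using a N by (intro cls_norm_le[of _ N]) (auto simp: CS_free less_imp_le)
  then have "cnorm CA (\<alpha> \<ominus>\<^bsub>CA\<^esub> cls (\<lambda>_. a N)) < e"
    using a assms(2) by (simp add: CS_free)
  then show ?thesis
    using a by (auto simp: CS_free)
qed

end

text \<open>
  C*-seminorms vanishing on \<open>R\<close> are the same as the functions \<open>a \<mapsto> \<parallel>\<pi> a\<parallel>\<close> for *-homomorphisms \<open>\<pi>\<close>
  of \<open>free_alg X\<close> to C*-algebras with \<open>\<pi> r = 0\<close> for \<open>r \<in> R\<close>. Hence \<open>univ_norm\<close> is the usual
  universal seminorm of the presentation (provided the supremum is finite), expressed without
  quantifying over types.
\<close>

definition rel_seminorms :: "'x set \<Rightarrow> 'x free_star set \<Rightarrow> ('x free_star \<Rightarrow> real) set"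
  where "rel_seminorms X R = {\<rho>. cstar_seminorm X \<rho> \<and> (\<forall>r\<in>R. \<rho> r = 0)}"

definition univ_norm :: "'x set \<Rightarrow> 'x free_star set \<Rightarrow> 'x free_star \<Rightarrow> real"
  where "univ_norm X R a = (SUP \<rho>\<in>rel_seminorms X R. \<rho> a)"

definition univ_cstar :: "'x set \<Rightarrow> 'x free_star set \<Rightarrow> (nat \<Rightarrow> 'x free_star) set star_algebra"
  where "univ_cstar X R = cstar_completion X (univ_norm X R)"

definition univ_elem :: "'x set \<Rightarrow> 'x free_star set \<Rightarrow> 'x free_star \<Rightarrow> (nat \<Rightarrow> 'x free_star) set"
  where "univ_elem X R a = seq_class X (univ_norm X R) (\<lambda>_. a)"

definition word_eval :: "('a, 'm) star_algebra_scheme \<Rightarrow> ('x \<Rightarrow> 'a) \<Rightarrow> 'x star_word \<Rightarrow> 'a"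
  where "word_eval B v w =
    foldr (\<lambda>(x, b) y. (if b then adj B (v x) else v x) \<otimes>\<^bsub>B\<^esub> y) (letters w) \<one>\<^bsub>B\<^esub>"

definition free_eval :: "('a, 'm) star_algebra_scheme \<Rightarrow> ('x \<Rightarrow> 'a) \<Rightarrow> 'x free_star \<Rightarrow> 'a"
  where "free_eval B v a =
    (\<Oplus>\<^bsub>B\<^esub>w\<in>Poly_Mapping.keys a. Poly_Mapping.lookup a w \<odot>\<^bsub>B\<^esub> word_eval B v w)"

lemma fst_letters_word_adj [simp]: "fst ` set (letters (word_adj w)) = fst ` set (letters w)"
  by (simp add: word_adj_def image_image case_prod_beta)

context cstar_algebra
begin

declare smult_closed [simp] adj_closed [simp] smult_one [simp] adj_adj [simp]

lemma smult_0_left [simp]: "x \<in> carrier A \<Longrightarrow> 0 \<odot> x = \<zero>"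
  using smult_l_distr[of x 0 0] add.l_cancel_one'[of "0 \<odot> x" "0 \<odot> x"] by simp

lemma smult_0_right [simp]: "c \<odot> \<zero> = \<zero>"
  using smult_assoc[of \<zero> c 0] by simp

lemma smult_minus_one: "x \<in> carrier A \<Longrightarrow> (- 1) \<odot> x = \<ominus> x"
  using smult_l_distr[of x "-1" 1] by (intro minus_equality[symmetric]) auto

lemma adj_zero [simp]: "adj A \<zero> = \<zero>"
  using adj_smult[of \<zero> 0] by simp

lemma adj_one [simp]: "adj A \<one> = \<one>"
  using adj_mult[of \<one> "adj A \<one>"] by simp

lemma adj_uminus: "x \<in> carrier A \<Longrightarrow> adj A (\<ominus> x) = \<ominus> adj A x"
  using adj_smult[of x "-1"] by (simp add: smult_minus_one)

lemma adj_minus: "x \<in> carrier A \<Longrightarrow> y \<in> carrier A \<Longrightarrow> adj A (x \<ominus> y) = adj A x \<ominus> adj A y"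
  by (simp add: a_minus_def adj_add adj_uminus)

lemma smult_uminus: "x \<in> carrier A \<Longrightarrow> c \<odot> (\<ominus> x) = \<ominus> (c \<odot> x)"
  by (simp flip: smult_minus_one smult_assoc)

lemma smult_minus: "x \<in> carrier A \<Longrightarrow> y \<in> carrier A \<Longrightarrow> c \<odot> (x \<ominus> y) = c \<odot> x \<ominus> c \<odot> y"
  by (simp add: a_minus_def smult_r_distr smult_uminus)

lemma norm_zero [simp]: "cnorm A \<zero> = 0"
  by (simp add: norm_eq_0)

lemma norm_uminus: "x \<in> carrier A \<Longrightarrow> cnorm A (\<ominus> x) = cnorm A x"
  using norm_smult[of x "-1"] by (simp add: smult_minus_one)

lemma norm_nonneg: "x \<in> carrier A \<Longrightarrow> 0 \<le> cnorm A x"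
  using norm_triangle[of x "\<ominus> x"] by (simp add: norm_uminus r_neg)

lemma minus_minus_swap: "x \<in> carrier A \<Longrightarrow> y \<in> carrier A \<Longrightarrow> \<ominus> (x \<ominus> y) = y \<ominus> x"
  by (simp add: a_minus_def minus_add a_comm)

lemma norm_minus_commute:
  "x \<in> carrier A \<Longrightarrow> y \<in> carrier A \<Longrightarrow> cnorm A (x \<ominus> y) = cnorm A (y \<ominus> x)"
  using norm_uminus[of "x \<ominus> y"] by (simp add: minus_minus_swap)

lemma minus_add_minus:
  assumes "x \<in> carrier A" "y \<in> carrier A" "z \<in> carrier A"
  shows "(x \<ominus> y) \<oplus> (y \<ominus> z) = x \<ominus> z"
  using assms by (simp add: a_minus_def a_assoc r_neg1)

lemma norm_triangle3:
  assumes "x \<in> carrier A" "y \<in> carrier A" "z \<in> carrier A"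
  shows "cnorm A (x \<ominus> z) \<le> cnorm A (x \<ominus> y) + cnorm A (y \<ominus> z)"
  using norm_triangle[of "x \<ominus> y" "y \<ominus> z"] assms by (simp add: minus_add_minus)

lemma norm_le_minus: "x \<in> carrier A \<Longrightarrow> y \<in> carrier A \<Longrightarrow> cnorm A x \<le> cnorm A (x \<ominus> y) + cnorm A y"
  using norm_triangle3[of x y \<zero>] by (simp add: a_minus_def)

lemma norm_adj: assumes "x \<in> carrier A" shows "cnorm A (adj A x) = cnorm A x"
proof -
  have le: "cnorm A y \<le> cnorm A (adj A y)" if "y \<in> carrier A" for y
  proof (cases "cnorm A y = 0")
    case False
    then have pos: "cnorm A y > 0"
      using norm_nonneg[OF that] by simp
    have "cnorm A y * cnorm A y \<le> cnorm A (adj A y) * cnorm A y"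
      using norm_mult[of "adj A y" y] norm_adj_mult[of y] that by (simp add: power2_eq_square)
    then show ?thesis
      using pos by simp
  qed (use norm_nonneg that in simp)
  from le[of x] le[of "adj A x"] show ?thesis
    using assms by simp
qed

definition tends :: "(nat \<Rightarrow> 'a) \<Rightarrow> 'a \<Rightarrow> bool"
  where "tends x y \<longleftrightarrow> (\<forall>n. x n \<in> carrier A) \<and> y \<in> carrier A \<and> (\<lambda>n. cnorm A (x n \<ominus> y)) \<longlonglongrightarrow> 0"

lemma tendsI:
  assumes "\<And>n. x n \<in> carrier A" "y \<in> carrier A" "\<And>n. cnorm A (x n \<ominus> y) \<le> r n" "r \<longlonglongrightarrow> 0"
  shows "tends x y"
  unfolding tends_def using assms
  by (auto intro!: tendsto_sandwich[OF _ _ tendsto_const \<open>r \<longlonglongrightarrow> 0\<close>] simp: norm_nonneg)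

lemma tends_unique: assumes "tends x y" "tends x z" shows "y = z"
proof -
  have *: "y \<in> carrier A" "z \<in> carrier A" "\<And>n. x n \<in> carrier A"
    using assms by (auto simp: tends_def)
  have "(\<lambda>n. cnorm A (x n \<ominus> y) + cnorm A (x n \<ominus> z)) \<longlonglongrightarrow> 0 + 0"
    using assms by (intro tendsto_add) (auto simp: tends_def)
  moreover have "cnorm A (y \<ominus> z) \<le> cnorm A (x n \<ominus> y) + cnorm A (x n \<ominus> z)" for n
    using norm_triangle3[of y "x n" z] norm_minus_commute[of y "x n"] * by simp
  ultimately have "cnorm A (y \<ominus> z) \<le> 0"
    by (intro LIMSEQ_le_const) auto
  then have "y \<ominus> z = \<zero>"
    using norm_eq_0[of "y \<ominus> z"] norm_nonneg[of "y \<ominus> z"] * by simp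
  moreover have "y = (y \<ominus> z) \<oplus> z"
    using * by (simp add: a_minus_def a_assoc l_neg)
  ultimately show ?thesis
    using * by simp
qed

lemma tends_const: "x \<in> carrier A \<Longrightarrow> tends (\<lambda>_. x) x"
  by (simp add: tends_def a_minus_def r_neg)

lemma tends_add: assumes "tends x y" "tends x' y'" shows "tends (\<lambda>n. x n \<oplus> x' n) (y \<oplus> y')"
proof (rule tendsI)
  have *: "y \<in> carrier A" "y' \<in> carrier A" "\<And>n. x n \<in> carrier A" "\<And>n. x' n \<in> carrier A"
    using assms by (auto simp: tends_def)
  show "cnorm A ((x n \<oplus> x' n) \<ominus> (y \<oplus> y')) \<le> cnorm A (x n \<ominus> y) + cnorm A (x' n \<ominus> y')" for n
  proof -
    have "(x n \<oplus> x' n) \<ominus> (y \<oplus> y') = (x n \<ominus> y) \<oplus> (x' n \<ominus> y')"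
      using * by (simp add: a_minus_def minus_add a_ac)
    then show ?thesis
      using norm_triangle[of "x n \<ominus> y" "x' n \<ominus> y'"] * by simp
  qed
  show "(\<lambda>n. cnorm A (x n \<ominus> y) + cnorm A (x' n \<ominus> y')) \<longlonglongrightarrow> 0"
    using assms tendsto_add[of "\<lambda>n. cnorm A (x n \<ominus> y)" 0 sequentially "\<lambda>n. cnorm A (x' n \<ominus> y')" 0]
    by (simp add: tends_def)
qed (use assms in \<open>auto simp: tends_def\<close>)

lemma tends_smult: assumes "tends x y" shows "tends (\<lambda>n. c \<odot> x n) (c \<odot> y)"
proof (rule tendsI)
  show "cnorm A (c \<odot> x n \<ominus> c \<odot> y) \<le> cmod c * cnorm A (x n \<ominus> y)" for n
    using assms by (simp add: tends_def norm_smult flip: smult_minus)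
  show "(\<lambda>n. cmod c * cnorm A (x n \<ominus> y)) \<longlonglongrightarrow> 0"
    using assms tendsto_mult_left[of "\<lambda>n. cnorm A (x n \<ominus> y)" 0 sequentially "cmod c"]
    by (simp add: tends_def)
qed (use assms in \<open>auto simp: tends_def\<close>)

lemma tends_adj: assumes "tends x y" shows "tends (\<lambda>n. adj A (x n)) (adj A y)"
  using assms by (auto simp: tends_def norm_adj simp flip: adj_minus)

lemma tends_mult: assumes "tends x y" "tends x' y'" shows "tends (\<lambda>n. x n \<otimes> x' n) (y \<otimes> y')"
proof (rule tendsI)
  have *: "y \<in> carrier A" "y' \<in> carrier A" "\<And>n. x n \<in> carrier A" "\<And>n. x' n \<in> carrier A"
    using assms by (auto simp: tends_def)
  let ?d = "\<lambda>n. cnorm A (x n \<ominus> y)" and ?d' = "\<lambda>n. cnorm A (x' n \<ominus> y')"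
  show "cnorm A ((x n \<otimes> x' n) \<ominus> (y \<otimes> y')) \<le> ?d n * (?d' n + cnorm A y') + cnorm A y * ?d' n" for n
  proof -
    have "(x n \<otimes> x' n) \<ominus> (y \<otimes> y') = ((x n \<ominus> y) \<otimes> x' n) \<oplus> (y \<otimes> (x' n \<ominus> y'))"
      using * by (simp add: a_minus_def l_distr r_distr l_minus r_minus a_assoc r_neg1)
    then have "cnorm A ((x n \<otimes> x' n) \<ominus> (y \<otimes> y')) \<le> cnorm A ((x n \<ominus> y) \<otimes> x' n) + cnorm A (y \<otimes> (x' n \<ominus> y'))"
      using norm_triangle * by simp
    also have "\<dots> \<le> ?d n * cnorm A (x' n) + cnorm A y * ?d' n"
      using * by (intro add_mono norm_mult) auto
    also have "\<dots> \<le> ?d n * (?d' n + cnorm A y') + cnorm A y * ?d' n"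
      using * by (intro add_mono mult_left_mono norm_le_minus) (auto simp: norm_nonneg)
    finally show ?thesis .
  qed
  have "(\<lambda>n. ?d n * (?d' n + cnorm A y') + cnorm A y * ?d' n) \<longlonglongrightarrow> 0 * (0 + cnorm A y') + cnorm A y * 0"
    using assms by (intro tendsto_intros) (auto simp: tends_def)
  then show "(\<lambda>n. ?d n * (?d' n + cnorm A y') + cnorm A y * ?d' n) \<longlonglongrightarrow> 0"
    by simp
qed (use assms in \<open>auto simp: tends_def\<close>)

lemma tends_cong:
  assumes "tends x y" "\<And>n. x' n \<in> carrier A" "(\<lambda>n. cnorm A (x' n \<ominus> x n)) \<longlonglongrightarrow> 0" shows "tends x' y"
proof (rule tendsI)
  show "cnorm A (x' n \<ominus> y) \<le> cnorm A (x' n \<ominus> x n) + cnorm A (x n \<ominus> y)" for n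
    using assms by (intro norm_triangle3) (auto simp: tends_def)
  show "(\<lambda>n. cnorm A (x' n \<ominus> x n) + cnorm A (x n \<ominus> y)) \<longlonglongrightarrow> 0"
    using tendsto_add[OF assms(3), of "\<lambda>n. cnorm A (x n \<ominus> y)" 0] assms(1) by (simp add: tends_def)
qed (use assms in \<open>auto simp: tends_def\<close>)

lemma tends_norm_le:
  assumes "tends x y" "\<And>n. cnorm A (x n) \<le> r n" "r \<longlonglongrightarrow> s" shows "cnorm A y \<le> s"
proof -
  have *: "y \<in> carrier A" "\<And>n. x n \<in> carrier A"
    using assms by (auto simp: tends_def)
  have "(\<lambda>n. cnorm A (x n \<ominus> y) + r n) \<longlonglongrightarrow> 0 + s"
    using assms by (intro tendsto_add) (auto simp: tends_def)
  moreover have "cnorm A y \<le> cnorm A (x n \<ominus> y) + r n" for n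
    using norm_le_minus[of y "x n"] norm_minus_commute[of y "x n"] * assms(2)[of n] by simp
  ultimately show ?thesis
    by (intro LIMSEQ_le_const) auto
qed

lemma word_eval_closed [simp]:
  assumes "v \<in> X \<rightarrow> carrier A" "fst ` set (letters w) \<subseteq> X" shows "word_eval A v w \<in> carrier A"
proof -
  have "foldr (\<lambda>(x, b) y. (if b then adj A (v x) else v x) \<otimes> y) ls \<one> \<in> carrier A"
    if "fst ` set ls \<subseteq> X" for ls
    using that assms(1) by (induction ls) (auto simp: Pi_iff)
  then show ?thesis
    using assms(2) by (simp add: word_eval_def)
qed

lemma word_eval_0 [simp]: "word_eval A v 0 = \<one>"
  by (simp add: word_eval_def zero_star_word_def)

lemma word_eval_add:
  assumes v: "v \<in> X \<rightarrow> carrier A" and w: "fst ` set (letters w) \<subseteq> X" "fst ` set (letters w') \<subseteq> X"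
  shows "word_eval A v (w + w') = word_eval A v w \<otimes> word_eval A v w'"
proof -
  have "word_eval A v (Word (ls @ letters w')) = word_eval A v (Word ls) \<otimes> word_eval A v w'"
    if "fst ` set ls \<subseteq> X" for ls
    using that
  proof (induction ls)
    case (Cons l ls)
    have "word_eval A v (Word ls) \<in> carrier A" "word_eval A v w' \<in> carrier A"
      "word_eval A v (Word (ls @ letters w')) \<in> carrier A"
      using Cons.prems w by (simp_all add: word_eval_closed[OF v] image_Un)
    then show ?case
      using Cons v by (cases l) (auto simp: word_eval_def m_assoc Pi_iff)
  next
    case Nil
    then show ?case
      using w by (simp add: word_eval_closed[OF v] flip: zero_star_word_def)
  qed
  from this[of "letters w"] show ?thesis
    using w by (simp add: plus_star_word_def)
qed

lemma word_eval_adj: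
  assumes v: "v \<in> X \<rightarrow> carrier A" and w: "fst ` set (letters w) \<subseteq> X"
  shows "word_eval A v (word_adj w) = adj A (word_eval A v w)"
proof -
  have "word_eval A v (word_adj (Word ls)) = adj A (word_eval A v (Word ls))"
    if "fst ` set ls \<subseteq> X" for ls
    using that
  proof (induction ls)
    case Nil
    then show ?case
      by (simp flip: zero_star_word_def)
  next
    case (Cons l ls)
    have eq: "Word (l # ls) = Word [l] + Word ls"
      by (simp add: plus_star_word_def)
    have one: "word_eval A v (word_adj (Word [l])) = adj A (word_eval A v (Word [l]))"
      using Cons.prems v by (cases l) (auto simp: word_adj_def word_eval_def Pi_iff)
    have X: "fst ` set (letters (word_adj (Word [l]))) \<subseteq> X" "fst ` set (letters (word_adj (Word ls))) \<subseteq> X"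
      using Cons.prems by simp_all
    have "word_eval A v (word_adj (Word (l # ls))) = word_eval A v (word_adj (Word ls)) \<otimes> word_eval A v (word_adj (Word [l]))"
      unfolding eq word_adj_add using X by (intro word_eval_add[OF v]) auto
    also have "\<dots> = adj A (word_eval A v (Word [l]) \<otimes> word_eval A v (Word ls))"
      using Cons one by (subst adj_mult) (simp_all add: word_eval_closed[OF v])
    also have "word_eval A v (Word [l]) \<otimes> word_eval A v (Word ls) = word_eval A v (Word (l # ls))"
      unfolding eq using Cons.prems by (intro word_eval_add[OF v, symmetric]) auto
    finally show ?case .
  qed
  from this[of "letters w"] show ?thesis
    using w by simp
qed

lemma free_eval_closed [simp]:
  assumes "v \<in> X \<rightarrow> carrier A" "a \<in> free_alg X" shows "free_eval A v a \<in> carrier A"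
  using assms unfolding free_eval_def
  by (intro finsum_closed) (auto simp: free_alg_def intro!: smult_closed word_eval_closed[OF assms(1)])

lemma free_eval_superset:
  assumes v: "v \<in> X \<rightarrow> carrier A" and "finite S" "Poly_Mapping.keys a \<subseteq> S" "\<And>w. w \<in> S \<Longrightarrow> fst ` set (letters w) \<subseteq> X"
  shows "free_eval A v a = (\<Oplus>w\<in>S. Poly_Mapping.lookup a w \<odot> word_eval A v w)"
  unfolding free_eval_def using assms
  by (intro add.finprod_mono_neutral_cong_left) (auto simp: in_keys_iff intro!: smult_closed word_eval_closed[OF v])

lemma free_eval_0 [simp]: "free_eval A v 0 = \<zero>"
  by (simp add: free_eval_def)

lemma free_eval_add:
  assumes v: "v \<in> X \<rightarrow> carrier A" and "a \<in> free_alg X" "b \<in> free_alg X"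
  shows "free_eval A v (a + b) = free_eval A v a \<oplus> free_eval A v b"
proof -
  let ?S = "Poly_Mapping.keys a \<union> Poly_Mapping.keys b"
  have S: "finite ?S" "\<And>w. w \<in> ?S \<Longrightarrow> fst ` set (letters w) \<subseteq> X"
    using assms unfolding free_alg_def by (simp, blast)
  have W: "\<And>w. w \<in> ?S \<Longrightarrow> word_eval A v w \<in> carrier A"
    using S by (intro word_eval_closed[OF v])
  have "free_eval A v (a + b) = (\<Oplus>w\<in>?S. Poly_Mapping.lookup (a + b) w \<odot> word_eval A v w)"
    using S by (intro free_eval_superset[OF v] Poly_Mapping.keys_add)
  also have "\<dots> = (\<Oplus>w\<in>?S. Poly_Mapping.lookup a w \<odot> word_eval A v w \<oplus> Poly_Mapping.lookup b w \<odot> word_eval A v w)"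
    using W by (intro finsum_cong') (auto simp: lookup_add smult_l_distr)
  also have "\<dots> = (\<Oplus>w\<in>?S. Poly_Mapping.lookup a w \<odot> word_eval A v w) \<oplus> (\<Oplus>w\<in>?S. Poly_Mapping.lookup b w \<odot> word_eval A v w)"
    using W by (intro finsum_addf) auto
  also have "(\<Oplus>w\<in>?S. Poly_Mapping.lookup a w \<odot> word_eval A v w) = free_eval A v a"
    using S by (intro free_eval_superset[OF v, symmetric]) auto
  also have "(\<Oplus>w\<in>?S. Poly_Mapping.lookup b w \<odot> word_eval A v w) = free_eval A v b"
    using S by (intro free_eval_superset[OF v, symmetric]) auto
  finally show ?thesis .
qed

lemma free_eval_single:
  assumes v: "v \<in> X \<rightarrow> carrier A" and w: "fst ` set (letters w) \<subseteq> X"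
  shows "free_eval A v (Poly_Mapping.single w c) = c \<odot> word_eval A v w"
proof -
  have "free_eval A v (Poly_Mapping.single w c) = (\<Oplus>w'\<in>{w}. Poly_Mapping.lookup (Poly_Mapping.single w c) w' \<odot> word_eval A v w')"
    using w by (intro free_eval_superset[OF v]) auto
  also have "\<dots> = c \<odot> word_eval A v w"
    using word_eval_closed[OF v w] by (subst finsum_insert) auto
  finally show ?thesis .
qed

lemma free_eval_gen: assumes "v \<in> X \<rightarrow> carrier A" "x \<in> X" shows "free_eval A v (fgen x) = v x"
  using assms free_eval_single[OF assms(1), of "Word [(x, False)]" 1]
  by (auto simp: fgen_def word_eval_def Pi_iff)

lemma free_eval_1: assumes "v \<in> X \<rightarrow> carrier A" shows "free_eval A v 1 = \<one>"
  using free_eval_single[OF assms, of 0 1] by (simp add: zero_star_word_def flip: single_one) (simp flip: zero_star_word_def)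

lemma free_eval_mult:
  assumes v: "v \<in> X \<rightarrow> carrier A" and "a \<in> free_alg X" "b \<in> free_alg X"
  shows "free_eval A v (a * b) = free_eval A v a \<otimes> free_eval A v b"
  using assms(2,3)
proof (induction a rule: free_alg_induct)
  case zero
  then show ?case
    using v by simp
next
  case (add a w c)
  have s: "Poly_Mapping.single w c \<in> free_alg X"
    using add by (simp add: free_alg_single)
  have "free_eval A v (Poly_Mapping.single w c * b) = free_eval A v (Poly_Mapping.single w c) \<otimes> free_eval A v b"
    using add.prems
  proof (induction b rule: free_alg_induct)
    case zero
    then show ?case
      using v s by simp
  next
    case (add b w' c')
    have s': "Poly_Mapping.single w' c' \<in> free_alg X"
      using add by (simp add: free_alg_single)
    have ww: "fst ` set (letters (w + w')) \<subseteq> X" "fst ` set (letters w) \<subseteq> X"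
      using add \<open>fst ` set (letters w) \<subseteq> X\<close> by (auto simp: plus_star_word_def)
    have W: "word_eval A v w \<in> carrier A" "word_eval A v w' \<in> carrier A"
      using add ww by (simp_all add: word_eval_closed[OF v])
    have "free_eval A v (Poly_Mapping.single w c * Poly_Mapping.single w' c')
        = free_eval A v (Poly_Mapping.single w c) \<otimes> free_eval A v (Poly_Mapping.single w' c')"
      using add W ww by (simp add: mult_single free_eval_single[OF v] word_eval_add[OF v]
          smult_mult_left smult_mult_right mult.commute flip: smult_assoc)
    then show ?case
      using add s s' v by (simp add: distrib_left free_eval_add[OF v] r_distr free_eval_closed[OF v])
  qed
  then show ?case
    using add s by (simp add: distrib_right free_eval_add[OF v] l_distr free_eval_closed[OF v])
qed

lemma free_eval_scale:
  assumes v: "v \<in> X \<rightarrow> carrier A" and "a \<in> free_alg X"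
  shows "free_eval A v (fscale c a) = c \<odot> free_eval A v a"
proof -
  have s: "Poly_Mapping.single 0 c \<in> free_alg X"
    by (rule free_alg_single) (simp add: zero_star_word_def)
  have "free_eval A v (Poly_Mapping.single 0 c) = c \<odot> \<one>"
    using free_eval_single[OF v, of 0 c] by (simp add: zero_star_word_def) (simp flip: zero_star_word_def)
  then show ?thesis
    using assms s by (simp add: fscale_def free_eval_mult[OF v] smult_mult_left free_eval_closed[OF v])
qed

lemma free_eval_minus:
  assumes v: "v \<in> X \<rightarrow> carrier A" and "a \<in> free_alg X" "b \<in> free_alg X"
  shows "free_eval A v (a - b) = free_eval A v a \<ominus> free_eval A v b"
  using free_eval_add[OF v, of a "fscale (-1) b"] assms
  by (simp add: free_eval_scale[OF v] smult_minus_one free_eval_closed[OF v] a_minus_def)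
    (simp add: fscale_minus_one)

lemma free_eval_adj:
  assumes v: "v \<in> X \<rightarrow> carrier A" and "a \<in> free_alg X"
  shows "free_eval A v (fadj a) = adj A (free_eval A v a)"
  using assms(2)
proof (induction a rule: free_alg_induct)
  case (add a w c)
  have s: "Poly_Mapping.single w c \<in> free_alg X" "fst ` set (letters (word_adj w)) \<subseteq> X"
    using add by (simp_all add: free_alg_single)
  then show ?case
    using add by (simp add: fadj_add fadj_single free_eval_add[OF v] free_eval_single[OF v] free_alg_single
        word_eval_adj[OF v] adj_add adj_smult word_eval_closed[OF v] free_eval_closed[OF v])
qed simp

lemma cstar_seminorm_free_eval:
  assumes v: "v \<in> X \<rightarrow> carrier A"
  shows "cstar_seminorm X (\<lambda>a. cnorm A (free_eval A v a))"
  by standard (simp_all add: free_eval_add[OF v] free_eval_mult[OF v] free_eval_scale[OF v] free_eval_adj[OF v]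
      free_eval_closed[OF v] norm_triangle norm_smult norm_mult norm_adj_mult)

end

definition bounded_presentation :: "'x set \<Rightarrow> 'x free_star set \<Rightarrow> bool"
  where "bounded_presentation X R \<longleftrightarrow> (\<forall>x\<in>X. \<exists>K. \<forall>\<rho>\<in>rel_seminorms X R. \<rho> (fgen x) \<le> K)"

lemma zero_rel_seminorm: "(\<lambda>_. 0) \<in> rel_seminorms X R"
  by (auto simp: rel_seminorms_def intro: cstar_seminorm.intro)

lemma rel_seminorms_bounded:
  assumes "bounded_presentation X R" "a \<in> free_alg X"
  shows "\<exists>K. \<forall>\<rho>\<in>rel_seminorms X R. \<rho> a \<le> K"
  using assms(2)
proof (induction a rule: free_alg_induct)
  case zero
  then show ?case
    by (auto simp: rel_seminorms_def dest!: cstar_seminorm.rho_0 intro!: exI[of _ 0])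
next
  case (add a w c)
  have "\<exists>K\<ge>0. \<forall>\<rho>\<in>rel_seminorms X R. \<rho> (Poly_Mapping.single (Word ls) 1) \<le> K" if "fst ` set ls \<subseteq> X" for ls
    using that
  proof (induction ls)
    case Nil
    have "\<forall>\<rho>\<in>rel_seminorms X R. \<rho> (Poly_Mapping.single (Word []) 1) \<le> 1"
      by (auto simp: rel_seminorms_def simp flip: zero_star_word_def dest: cstar_seminorm.rho_1_le)
    then show ?case
      by (intro exI[of _ 1]) simp
  next
    case (Cons l ls)
    obtain x b where l: "l = (x, b)" "x \<in> X"
      using Cons.prems by (cases l) auto
    obtain K where K: "K \<ge> 0" "\<forall>\<rho>\<in>rel_seminorms X R. \<rho> (Poly_Mapping.single (Word ls) 1) \<le> K"
      using Cons by auto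
    obtain L where L: "\<forall>\<rho>\<in>rel_seminorms X R. \<rho> (fgen x) \<le> L"
      using assms(1) l by (auto simp: bounded_presentation_def)
    define g where "g = Poly_Mapping.single (Word [l]) (1 :: complex)"
    have g: "g = (if b then fadj (fgen x) else fgen x)"
      by (simp add: g_def l fgen_def fadj_single word_adj_def)
    have gX: "g \<in> free_alg X" "Poly_Mapping.single (Word ls) 1 \<in> free_alg X"
      using l Cons.prems by (auto simp: g) (auto simp: free_alg_single)
    have "Poly_Mapping.single (Word (l # ls)) 1 = g * Poly_Mapping.single (Word ls) 1"
      by (simp add: g_def mult_single plus_star_word_def)
    moreover have "\<rho> (g * Poly_Mapping.single (Word ls) 1) \<le> max L 0 * K" if \<rho>: "\<rho> \<in> rel_seminorms X R" for \<rho>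
    proof -
      interpret cstar_seminorm X \<rho>
        using \<rho> by (simp add: rel_seminorms_def)
      have "\<rho> (g * Poly_Mapping.single (Word ls) 1) \<le> \<rho> g * \<rho> (Poly_Mapping.single (Word ls) 1)"
        using gX by (rule submult)
      also have "\<rho> g = \<rho> (fgen x)"
        using l by (simp add: g rho_adj)
      also have "\<rho> (fgen x) * \<rho> (Poly_Mapping.single (Word ls) 1) \<le> max L 0 * K"
        using K L \<rho> gX by (intro mult_mono rho_nonneg) (auto simp: max.coboundedI1)
      finally show ?thesis .
    qed
    ultimately show ?case
      using K by (intro exI[of _ "max L 0 * K"]) auto
  qed
  from this[of "letters w"] obtain K where K: "\<forall>\<rho>\<in>rel_seminorms X R. \<rho> (Poly_Mapping.single w 1) \<le> K"
    using add by auto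
  obtain L where L: "\<forall>\<rho>\<in>rel_seminorms X R. \<rho> a \<le> L"
    using add by auto
  have "\<rho> (a + Poly_Mapping.single w c) \<le> L + cmod c * K" if \<rho>: "\<rho> \<in> rel_seminorms X R" for \<rho>
  proof -
    interpret cstar_seminorm X \<rho>
      using \<rho> by (simp add: rel_seminorms_def)
    have eq: "Poly_Mapping.single w c = fscale c (Poly_Mapping.single w 1)"
      by (simp add: fscale_def mult_single)
    have s: "Poly_Mapping.single w 1 \<in> free_alg X"
      using add by (simp add: free_alg_single)
    have "\<rho> (a + Poly_Mapping.single w c) \<le> \<rho> a + cmod c * \<rho> (Poly_Mapping.single w 1)"
      unfolding eq using add s by (metis triangle scale free_alg_scale)
    also have "\<dots> \<le> L + cmod c * K"
      using K L \<rho> by (intro add_mono mult_left_mono) auto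
    finally show ?thesis .
  qed
  then show ?case by blast
qed

lemma univ_norm_upper:
  assumes "bounded_presentation X R" "a \<in> free_alg X" "\<rho> \<in> rel_seminorms X R"
  shows "\<rho> a \<le> univ_norm X R a"
proof -
  have "bdd_above ((\<lambda>\<rho>. \<rho> a) ` rel_seminorms X R)"
    using rel_seminorms_bounded[OF assms(1,2)] by (auto simp: bdd_above_def)
  then show ?thesis
    unfolding univ_norm_def using assms(3) by (intro cSUP_upper)
qed

lemma univ_norm_least: "(\<And>\<rho>. \<rho> \<in> rel_seminorms X R \<Longrightarrow> \<rho> a \<le> K) \<Longrightarrow> univ_norm X R a \<le> K"
  unfolding univ_norm_def using zero_rel_seminorm by (intro cSUP_least) auto

lemma cstar_seminorm_univ_norm:
  assumes bd: "bounded_presentation X R"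
  shows "cstar_seminorm X (univ_norm X R)"
proof
  fix a b and c :: complex
  assume a: "a \<in> free_alg X"
  note up = univ_norm_upper[OF bd]
  have sem: "cstar_seminorm X \<rho>" if "\<rho> \<in> rel_seminorms X R" for \<rho>
    using that by (simp add: rel_seminorms_def)
  have nn: "0 \<le> univ_norm X R a" if "a \<in> free_alg X" for a
    using up[OF that zero_rel_seminorm] .
  have scale_le: "univ_norm X R (fscale c a) \<le> cmod c * univ_norm X R a" if "a \<in> free_alg X" for a c
    using that by (intro univ_norm_least) (auto simp: cstar_seminorm.scale[OF sem] intro!: mult_left_mono up)
  show "univ_norm X R (fscale c a) = cmod c * univ_norm X R a"
  proof (cases "c = 0")
    case True
    then show ?thesis
      using scale_le[OF a, of 0] nn[of 0] by simp
  next
    case False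
    then have "a = fscale (inverse c) (fscale c a)"
      by (simp flip: fscale_fscale)
    then have "univ_norm X R a \<le> cmod (inverse c) * univ_norm X R (fscale c a)"
      using scale_le[of "fscale c a" "inverse c"] a by simp
    then have "univ_norm X R a \<le> univ_norm X R (fscale c a) / cmod c"
      by (simp add: norm_inverse divide_inverse mult.commute)
    then have "cmod c * univ_norm X R a \<le> univ_norm X R (fscale c a)"
      using False by (simp add: pos_le_divide_eq mult.commute)
    then show ?thesis
      using scale_le[OF a, of c] by simp
  qed
  show "univ_norm X R (fadj a * a) = (univ_norm X R a)\<^sup>2"
  proof (rule antisym)
    show "univ_norm X R (fadj a * a) \<le> (univ_norm X R a)\<^sup>2"
      using a by (intro univ_norm_least)
        (auto simp: cstar_seminorm.cstar[OF sem] intro!: power_mono up cstar_seminorm.rho_nonneg[OF sem])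
    have "univ_norm X R a \<le> sqrt (univ_norm X R (fadj a * a))"
    proof (rule univ_norm_least)
      fix \<rho> assume \<rho>: "\<rho> \<in> rel_seminorms X R"
      have "(\<rho> a)\<^sup>2 \<le> univ_norm X R (fadj a * a)"
        using up[of "fadj a * a" \<rho>] a \<rho> by (simp add: cstar_seminorm.cstar[OF sem])
      then show "\<rho> a \<le> sqrt (univ_norm X R (fadj a * a))"
        by (rule real_le_rsqrt)
    qed
    then show "(univ_norm X R a)\<^sup>2 \<le> univ_norm X R (fadj a * a)"
      using power_mono[of "univ_norm X R a" "sqrt (univ_norm X R (fadj a * a))" 2] a nn by simp
  qed
  assume b: "b \<in> free_alg X"
  show "univ_norm X R (a + b) \<le> univ_norm X R a + univ_norm X R b"
  proof (rule univ_norm_least)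
    fix \<rho> assume \<rho>: "\<rho> \<in> rel_seminorms X R"
    show "\<rho> (a + b) \<le> univ_norm X R a + univ_norm X R b"
      using cstar_seminorm.triangle[OF sem[OF \<rho>] a b] up[OF a \<rho>] up[OF b \<rho>] by simp
  qed
  show "univ_norm X R (a * b) \<le> univ_norm X R a * univ_norm X R b"
  proof (rule univ_norm_least)
    fix \<rho> assume \<rho>: "\<rho> \<in> rel_seminorms X R"
    have "\<rho> a * \<rho> b \<le> univ_norm X R a * univ_norm X R b"
      using up[OF a \<rho>] up[OF b \<rho>] nn[OF a] cstar_seminorm.rho_nonneg[OF sem[OF \<rho>] b]
      by (intro mult_mono)
    then show "\<rho> (a * b) \<le> univ_norm X R a * univ_norm X R b"
      using cstar_seminorm.submult[OF sem[OF \<rho>] a b] by simp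
  qed
qed

theorem cstar_algebra_univ_cstar: "bounded_presentation X R \<Longrightarrow> cstar_algebra (univ_cstar X R)"
  unfolding univ_cstar_def by (intro cstar_seminorm.cstar_algebra_completion cstar_seminorm_univ_norm)

lemma univ_norm_rel:
  assumes "bounded_presentation X R" "r \<in> R" "R \<subseteq> free_alg X" shows "univ_norm X R r = 0"
  using univ_norm_least[of X R r 0] univ_norm_upper[OF assms(1) _ zero_rel_seminorm, of r] assms
  by (force simp: rel_seminorms_def)

context
  fixes X :: "'x set" and R
  assumes bd: "bounded_presentation X R"
begin

interpretation U: cstar_seminorm X "univ_norm X R"
  by (rule cstar_seminorm_univ_norm[OF bd])

lemma univ_elem_closed [simp]: "a \<in> free_alg X \<Longrightarrow> univ_elem X R a \<in> carrier (univ_cstar X R)"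
  by (simp add: univ_elem_def univ_cstar_def)

lemma univ_elem_binary:
  assumes "a \<in> free_alg X" "b \<in> free_alg X"
  shows "univ_elem X R (a + b) = univ_elem X R a \<oplus>\<^bsub>univ_cstar X R\<^esub> univ_elem X R b"
    and "univ_elem X R (a * b) = univ_elem X R a \<otimes>\<^bsub>univ_cstar X R\<^esub> univ_elem X R b"
    and "univ_elem X R (a - b) = univ_elem X R a \<ominus>\<^bsub>univ_cstar X R\<^esub> univ_elem X R b"
  using assms by (simp_all add: univ_elem_def univ_cstar_def)

lemma univ_elem_unary:
  assumes "a \<in> free_alg X"
  shows "univ_elem X R (fscale c a) = c \<odot>\<^bsub>univ_cstar X R\<^esub> univ_elem X R a"
    and "univ_elem X R (fadj a) = adj (univ_cstar X R) (univ_elem X R a)"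
  using assms by (simp_all add: univ_elem_def univ_cstar_def)

lemma univ_elem_consts:
  shows "univ_elem X R 1 = \<one>\<^bsub>univ_cstar X R\<^esub>" and "univ_elem X R 0 = \<zero>\<^bsub>univ_cstar X R\<^esub>"
  by (simp_all add: univ_elem_def univ_cstar_def U.cls_one U.cls_zero)

lemma univ_elem_norm: "a \<in> free_alg X \<Longrightarrow> cnorm (univ_cstar X R) (univ_elem X R a) = univ_norm X R a"
  by (simp add: univ_elem_def univ_cstar_def U.cls_norm_const)

lemma univ_elem_rel:
  assumes "R \<subseteq> free_alg X" "r \<in> R" shows "univ_elem X R r = \<zero>\<^bsub>univ_cstar X R\<^esub>"
proof -
  interpret cstar_algebra "univ_cstar X R"
    by (rule cstar_algebra_univ_cstar[OF bd])
  show ?thesis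
    using assms norm_eq_0[of "univ_elem X R r"] univ_norm_rel[OF bd, of r] univ_elem_norm[of r]
    by (auto simp: subset_iff)
qed

lemma univ_elem_dense:
  assumes "\<alpha> \<in> carrier (univ_cstar X R)" "e > 0"
  shows "\<exists>a\<in>free_alg X. cnorm (univ_cstar X R) (\<alpha> \<ominus>\<^bsub>univ_cstar X R\<^esub> univ_elem X R a) < e"
  using U.CA_dense assms by (simp add: univ_elem_def univ_cstar_def)

theorem univ_cstar_universal:
  assumes B: "cstar_algebra B" and v: "v \<in> X \<rightarrow> carrier B"
    and rel: "\<And>r. r \<in> R \<Longrightarrow> free_eval B v r = \<zero>\<^bsub>B\<^esub>"
  shows "\<exists>f\<in>star_hom (univ_cstar X R) B.
    (\<forall>a\<in>free_alg X. f (univ_elem X R a) = free_eval B v a) \<and>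
    (\<forall>\<alpha>\<in>carrier (univ_cstar X R). cnorm B (f \<alpha>) \<le> cnorm (univ_cstar X R) \<alpha>)"
proof -
  interpret B: cstar_algebra B by (rule B)
  let ?A = "cstar_completion X (univ_norm X R)"
  let ?ev = "free_eval B v"
  have evc [simp]: "?ev a \<in> carrier B" if "a \<in> free_alg X" for a
    using that v by simp
  have "(\<lambda>a. cnorm B (?ev a)) \<in> rel_seminorms X R"
    using B.cstar_seminorm_free_eval[OF v] rel by (simp add: rel_seminorms_def)
  from univ_norm_upper[OF bd _ this]
  have le: "cnorm B (?ev a) \<le> univ_norm X R a" if "a \<in> free_alg X" for a
    using that by simp
  have conv: "\<exists>y. B.tends (\<lambda>n. ?ev (a n)) y" if a: "a \<in> U.CS" for a
  proof -
    have "\<exists>y\<in>carrier B. (\<lambda>n. cnorm B (?ev (a n) \<ominus>\<^bsub>B\<^esub> y)) \<longlonglongrightarrow> 0"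
    proof (rule B.complete)
      fix e :: real assume "e > 0"
      then obtain N where N: "\<forall>m\<ge>N. \<forall>n\<ge>N. univ_norm X R (a m - a n) < e"
        using U.CS_cauchy a by blast
      have "cnorm B (?ev (a m) \<ominus>\<^bsub>B\<^esub> ?ev (a n)) \<le> univ_norm X R (a m - a n)" for m n
        using le[of "a m - a n"] a by (simp add: B.free_eval_minus[OF v] U.CS_free)
      then show "\<exists>N. \<forall>m\<ge>N. \<forall>n\<ge>N. cnorm B (?ev (a m) \<ominus>\<^bsub>B\<^esub> ?ev (a n)) < e"
        using N by (meson le_less_trans)
    qed (use a in \<open>simp add: U.CS_free\<close>)
    then show ?thesis
      using a by (auto simp: B.tends_def U.CS_free)
  qed
  define f where "f \<alpha> = (THE y. \<exists>a\<in>\<alpha>. B.tends (\<lambda>n. ?ev (a n)) y)" for \<alpha>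
  have f_cls: "B.tends (\<lambda>n. ?ev (a n)) (f (U.cls a))" if a: "a \<in> U.CS" for a
  proof -
    obtain y where y: "B.tends (\<lambda>n. ?ev (a n)) y"
      using conv[OF a] ..
    have "f (U.cls a) = y"
      unfolding f_def
    proof (rule the_equality)
      show "\<exists>b\<in>U.cls a. B.tends (\<lambda>n. ?ev (b n)) y"
        using y U.NR_refl[OF a] by blast
      fix z assume "\<exists>b\<in>U.cls a. B.tends (\<lambda>n. ?ev (b n)) z"
      then obtain b where b: "(a, b) \<in> U.NR" "B.tends (\<lambda>n. ?ev (b n)) z"
        by blast
      have CS: "b \<in> U.CS"
        using b by (simp add: U.NR_iff)
      have "(\<lambda>n. cnorm B (?ev (a n) \<ominus>\<^bsub>B\<^esub> ?ev (b n))) \<longlonglongrightarrow> 0"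
      proof (rule tendsto_0_le[of "\<lambda>n. univ_norm X R (a n - b n)" _ _ 1])
        show "(\<lambda>n. univ_norm X R (a n - b n)) \<longlonglongrightarrow> 0"
          using b by (simp add: U.NR_iff)
        have "cnorm B (?ev (a n) \<ominus>\<^bsub>B\<^esub> ?ev (b n)) \<le> univ_norm X R (a n - b n)" for n
          using le[of "a n - b n"] a CS by (simp add: B.free_eval_minus[OF v] U.CS_free)
        then show "\<forall>\<^sub>F n in sequentially. norm (cnorm B (?ev (a n) \<ominus>\<^bsub>B\<^esub> ?ev (b n))) \<le> norm (univ_norm X R (a n - b n)) * 1"
          using a CS by (simp add: B.norm_nonneg U.CS_free U.rho_nonneg)
      qed
      then have "B.tends (\<lambda>n. ?ev (a n)) z"
        using a by (intro B.tends_cong[OF b(2)]) (auto simp: U.CS_free)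
      then show "z = y"
        using y B.tends_unique by blast
    qed
    then show ?thesis
      using y by simp
  qed
  have f_eq: "f (U.cls a) = y" if "a \<in> U.CS" "B.tends (\<lambda>n. ?ev (a n)) y" for a y
    using B.tends_unique[OF f_cls] that by blast
  have f_closed: "f (U.cls a) \<in> carrier B" if "a \<in> U.CS" for a
    using f_cls[OF that] by (simp add: B.tends_def)
  have fA: "f \<in> carrier ?A \<rightarrow> carrier B"
    by (auto elim!: U.carrierE simp: f_closed)
  have "f \<in> star_hom ?A B"
    unfolding star_hom_def
  proof (intro CollectI conjI fA ballI allI)
    fix \<alpha> \<beta> c
    assume "\<alpha> \<in> carrier ?A"
    then obtain a where a: "a \<in> U.CS" "\<alpha> = U.cls a"
      by (rule U.carrierE)
    show "f (c \<odot>\<^bsub>?A\<^esub> \<alpha>) = c \<odot>\<^bsub>B\<^esub> f \<alpha>"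
      using a B.tends_smult[OF f_cls[OF a(1)], of c]
      by (auto intro!: f_eq simp: B.free_eval_scale[OF v] U.CS_free)
    show "f (adj ?A \<alpha>) = adj B (f \<alpha>)"
      using a B.tends_adj[OF f_cls[OF a(1)]]
      by (auto intro!: f_eq simp: B.free_eval_adj[OF v] U.CS_free)
    assume "\<beta> \<in> carrier ?A"
    then obtain b where b: "b \<in> U.CS" "\<beta> = U.cls b"
      by (rule U.carrierE)
    show "f (\<alpha> \<oplus>\<^bsub>?A\<^esub> \<beta>) = f \<alpha> \<oplus>\<^bsub>B\<^esub> f \<beta>"
      using a b B.tends_add[OF f_cls[OF a(1)] f_cls[OF b(1)]]
      by (auto intro!: f_eq simp: B.free_eval_add[OF v] U.CS_free)
    show "f (\<alpha> \<otimes>\<^bsub>?A\<^esub> \<beta>) = f \<alpha> \<otimes>\<^bsub>B\<^esub> f \<beta>"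
      using a b B.tends_mult[OF f_cls[OF a(1)] f_cls[OF b(1)]]
      by (auto intro!: f_eq simp: B.free_eval_mult[OF v] U.CS_free)
  qed
  moreover have "f (univ_elem X R a) = ?ev a" if "a \<in> free_alg X" for a
    unfolding univ_elem_def using that by (intro f_eq) (auto intro!: B.tends_const)
  moreover have "cnorm B (f \<alpha>) \<le> cnorm ?A \<alpha>" if \<alpha>: "\<alpha> \<in> carrier ?A" for \<alpha>
  proof -
    obtain a where a: "a \<in> U.CS" "\<alpha> = U.cls a"
      using \<alpha> by (rule U.carrierE)
    show ?thesis
      using B.tends_norm_le[OF f_cls[OF a(1)] _ U.cls_norm_tendsto[OF a(1)]] le a by (simp add: U.CS_free)
  qed
  ultimately show ?thesis
    unfolding univ_cstar_def by blast
qed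

end

section \<open>Algebraic dynamical systems\<close>

locale right_lcm_monoid = Group.monoid P for P (structure) +
  assumes left_cancel: "\<lbrakk>p \<in> carrier P; q \<in> carrier P; r \<in> carrier P; p \<otimes> q = p \<otimes> r\<rbrakk> \<Longrightarrow> q = r"
    and right_lcm: "\<lbrakk>p \<in> carrier P; q \<in> carrier P\<rbrakk> \<Longrightarrow>
      (p <# carrier P) \<inter> (q <# carrier P) = {} \<or>
      (\<exists>r\<in>carrier P. (p <# carrier P) \<inter> (q <# carrier P) = r <# carrier P)"

locale algebraic_dynamical_system =
  G: group G + P: right_lcm_monoid P
  for G :: "('g, 'm) monoid_scheme" and P :: "('p, 'n) monoid_scheme" +
  fixes \<theta> :: "'p \<Rightarrow> 'g \<Rightarrow> 'g"
  assumes countable_G: "countable (carrier G)"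
    and countable_P: "countable (carrier P)"
    and action_hom: "p \<in> carrier P \<Longrightarrow> \<theta> p \<in> hom G G"
    and action_inj: "p \<in> carrier P \<Longrightarrow> inj_on (\<theta> p) (carrier G)"
    and action_one: "g \<in> carrier G \<Longrightarrow> \<theta> \<one>\<^bsub>P\<^esub> g = g"
    and action_mult: "\<lbrakk>p \<in> carrier P; q \<in> carrier P; g \<in> carrier G\<rbrakk> \<Longrightarrow> \<theta> (p \<otimes>\<^bsub>P\<^esub> q) g = \<theta> p (\<theta> q g)"
    and action_lcm: "\<lbrakk>p \<in> carrier P; q \<in> carrier P; r \<in> carrier P;
        (p <#\<^bsub>P\<^esub> carrier P) \<inter> (q <#\<^bsub>P\<^esub> carrier P) = r <#\<^bsub>P\<^esub> carrier P\<rbrakk> \<Longrightarrow>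
      \<theta> p ` carrier G \<inter> \<theta> q ` carrier G = \<theta> r ` carrier G"

definition ads_morphism where
  "ads_morphism G\<^sub>1 P\<^sub>1 \<theta>\<^sub>1 G\<^sub>2 P\<^sub>2 \<theta>\<^sub>2 \<phi>\<^sub>G \<phi>\<^sub>P \<longleftrightarrow>
    \<phi>\<^sub>G \<in> hom G\<^sub>1 G\<^sub>2 \<and> \<phi>\<^sub>P \<in> hom P\<^sub>1 P\<^sub>2 \<and> \<phi>\<^sub>P \<one>\<^bsub>P\<^sub>1\<^esub> = \<one>\<^bsub>P\<^sub>2\<^esub> \<and>
    (\<forall>p\<in>carrier P\<^sub>1. \<forall>g\<in>carrier G\<^sub>1. \<phi>\<^sub>G (\<theta>\<^sub>1 p g) = \<theta>\<^sub>2 (\<phi>\<^sub>P p) (\<phi>\<^sub>G g))"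

definition ads_admissible where
  "ads_admissible G\<^sub>1 P\<^sub>1 \<theta>\<^sub>1 G\<^sub>2 P\<^sub>2 \<theta>\<^sub>2 \<phi>\<^sub>G \<phi>\<^sub>P \<longleftrightarrow>
    (\<forall>p\<in>carrier P\<^sub>1. \<forall>q\<in>carrier P\<^sub>1.
      (\<phi>\<^sub>P p <#\<^bsub>P\<^sub>2\<^esub> carrier P\<^sub>2) \<inter> (\<phi>\<^sub>P q <#\<^bsub>P\<^sub>2\<^esub> carrier P\<^sub>2) =
        \<phi>\<^sub>P ` ((p <#\<^bsub>P\<^sub>1\<^esub> carrier P\<^sub>1) \<inter> (q <#\<^bsub>P\<^sub>1\<^esub> carrier P\<^sub>1)) <#>\<^bsub>P\<^sub>2\<^esub> carrier P\<^sub>2) \<and>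
    (\<forall>p\<in>carrier P\<^sub>1. \<forall>q\<in>carrier P\<^sub>1.
      (p <#\<^bsub>P\<^sub>1\<^esub> carrier P\<^sub>1) \<inter> (q <#\<^bsub>P\<^sub>1\<^esub> carrier P\<^sub>1) \<noteq> {} \<longrightarrow>
      {g \<in> carrier G\<^sub>1. \<phi>\<^sub>G g \<in> \<phi>\<^sub>G ` carrier G\<^sub>1 \<inter>
          (\<theta>\<^sub>2 (\<phi>\<^sub>P p) ` carrier G\<^sub>2 <#>\<^bsub>G\<^sub>2\<^esub> \<theta>\<^sub>2 (\<phi>\<^sub>P q) ` carrier G\<^sub>2)} =
        \<theta>\<^sub>1 p ` carrier G\<^sub>1 <#>\<^bsub>G\<^sub>1\<^esub> \<theta>\<^sub>1 q ` carrier G\<^sub>1)"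


section \<open>The C*-algebra of an algebraic dynamical system\<close>

text \<open>
  The data \<open>p', q', k, l\<close> for which \<open>s\<^sub>p\<^sup>* u\<^sub>g s\<^sub>q = u\<^sub>k s\<^sub>p\<^sub>' s\<^sub>q\<^sub>'\<^sup>* u\<^sub>l\<^sup>*\<close> is imposed; the element \<open>r\<close> with
  \<open>pP \<inter> qP = rP\<close> and \<open>p p' = q q' = r\<close> is eliminated as \<open>p p'\<close>.
\<close>

definition ads_factor where
  "ads_factor G P \<theta> p q g p' q' k l \<longleftrightarrow>
    p' \<in> carrier P \<and> q' \<in> carrier P \<and> k \<in> carrier G \<and> l \<in> carrier G \<and>
    p \<otimes>\<^bsub>P\<^esub> p' = q \<otimes>\<^bsub>P\<^esub> q' \<and>
    (p <#\<^bsub>P\<^esub> carrier P) \<inter> (q <#\<^bsub>P\<^esub> carrier P) = (p \<otimes>\<^bsub>P\<^esub> p') <#\<^bsub>P\<^esub> carrier P \<and>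
    g = \<theta> p k \<otimes>\<^bsub>G\<^esub> \<theta> q (inv\<^bsub>G\<^esub> l)"

datatype ('g, 'p) ads_gen = GenU 'g | GenS 'p

definition ads_gens :: "('g, 'm) monoid_scheme \<Rightarrow> ('p, 'n) monoid_scheme \<Rightarrow> ('g, 'p) ads_gen set"
  where "ads_gens G P = GenU ` carrier G \<union> GenS ` carrier P"

abbreviation gen_u :: "'g \<Rightarrow> ('g, 'p) ads_gen free_star" where "gen_u g \<equiv> fgen (GenU g)"
abbreviation gen_s :: "'p \<Rightarrow> ('g, 'p) ads_gen free_star" where "gen_s p \<equiv> fgen (GenS p)"

inductive_set ads_relators ::
    "('g, 'm) monoid_scheme \<Rightarrow> ('p, 'n) monoid_scheme \<Rightarrow> ('p \<Rightarrow> 'g \<Rightarrow> 'g) \<Rightarrow> ('g, 'p) ads_gen free_star set"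
  for G :: "('g, 'm) monoid_scheme" and P :: "('p, 'n) monoid_scheme" and \<theta> :: "'p \<Rightarrow> 'g \<Rightarrow> 'g"
  where
    unitary_left: "g \<in> carrier G \<Longrightarrow> fadj (gen_u g) * gen_u g - 1 \<in> ads_relators G P \<theta>"
  | unitary_right: "g \<in> carrier G \<Longrightarrow> gen_u g * fadj (gen_u g) - 1 \<in> ads_relators G P \<theta>"
  | u_mult: "\<lbrakk>g \<in> carrier G; h \<in> carrier G\<rbrakk> \<Longrightarrow> gen_u (g \<otimes>\<^bsub>G\<^esub> h) - gen_u g * gen_u h \<in> ads_relators G P \<theta>"
  | isometry: "p \<in> carrier P \<Longrightarrow> fadj (gen_s p) * gen_s p - 1 \<in> ads_relators G P \<theta>"
  | s_one: "gen_s \<one>\<^bsub>P\<^esub> - 1 \<in> ads_relators G P \<theta>"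
  | s_mult: "\<lbrakk>p \<in> carrier P; q \<in> carrier P\<rbrakk> \<Longrightarrow> gen_s (p \<otimes>\<^bsub>P\<^esub> q) - gen_s p * gen_s q \<in> ads_relators G P \<theta>"
  | covariance: "\<lbrakk>p \<in> carrier P; g \<in> carrier G\<rbrakk> \<Longrightarrow> gen_s p * gen_u g - gen_u (\<theta> p g) * gen_s p \<in> ads_relators G P \<theta>"
  | compress: "\<lbrakk>p \<in> carrier P; q \<in> carrier P; g \<in> carrier G; ads_factor G P \<theta> p q g p' q' k l\<rbrakk> \<Longrightarrow>
      fadj (gen_s p) * gen_u g * gen_s q - gen_u k * gen_s p' * fadj (gen_s q') * fadj (gen_u l) \<in> ads_relators G P \<theta>"
  | compress_zero: "\<lbrakk>p \<in> carrier P; q \<in> carrier P; g \<in> carrier G;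
        \<nexists>p' q' k l. ads_factor G P \<theta> p q g p' q' k l\<rbrakk> \<Longrightarrow>
      fadj (gen_s p) * gen_u g * gen_s q \<in> ads_relators G P \<theta>"

definition ads_cstar where
  "ads_cstar G P \<theta> = univ_cstar (ads_gens G P) (ads_relators G P \<theta>)"

definition ads_u where
  "ads_u G P \<theta> g = univ_elem (ads_gens G P) (ads_relators G P \<theta>) (gen_u g)"

definition ads_s where
  "ads_s G P \<theta> p = univ_elem (ads_gens G P) (ads_relators G P \<theta>) (gen_s p)"

text \<open>
  The remaining results confirm that \<open>ads_cstar G P \<theta>\<close> is a C*-algebra generated by a representation of
  the system (\<open>ads_cstar_representation\<close>, \<open>ads_cstar_dense\<close>), and that every representation in a
  C*-algebra, on a carrier in an arbitrary type, factors through it (\<open>ads_cstar_universal\<close>).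
\<close>

locale ads_representation = algebraic_dynamical_system G P \<theta> + B: cstar_algebra B
  for G :: "('g, 'm) monoid_scheme" and P :: "('p, 'n) monoid_scheme" and \<theta>
    and B :: "('b, 'o) star_algebra_scheme" +
  fixes u :: "'g \<Rightarrow> 'b" and s :: "'p \<Rightarrow> 'b"
  assumes u_closed: "g \<in> carrier G \<Longrightarrow> u g \<in> carrier B"
    and s_closed: "p \<in> carrier P \<Longrightarrow> s p \<in> carrier B"
    and u_unitary: "g \<in> carrier G \<Longrightarrow> adj B (u g) \<otimes>\<^bsub>B\<^esub> u g = \<one>\<^bsub>B\<^esub>"
      "g \<in> carrier G \<Longrightarrow> u g \<otimes>\<^bsub>B\<^esub> adj B (u g) = \<one>\<^bsub>B\<^esub>"
    and u_mult: "g \<in> carrier G \<Longrightarrow> h \<in> carrier G \<Longrightarrow> u (g \<otimes>\<^bsub>G\<^esub> h) = u g \<otimes>\<^bsub>B\<^esub> u h"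
    and s_isometry: "p \<in> carrier P \<Longrightarrow> adj B (s p) \<otimes>\<^bsub>B\<^esub> s p = \<one>\<^bsub>B\<^esub>"
    and s_one: "s \<one>\<^bsub>P\<^esub> = \<one>\<^bsub>B\<^esub>"
    and s_mult: "p \<in> carrier P \<Longrightarrow> q \<in> carrier P \<Longrightarrow> s (p \<otimes>\<^bsub>P\<^esub> q) = s p \<otimes>\<^bsub>B\<^esub> s q"
    and covariance: "p \<in> carrier P \<Longrightarrow> g \<in> carrier G \<Longrightarrow> s p \<otimes>\<^bsub>B\<^esub> u g = u (\<theta> p g) \<otimes>\<^bsub>B\<^esub> s p"
    and compress: "\<lbrakk>p \<in> carrier P; q \<in> carrier P; g \<in> carrier G; ads_factor G P \<theta> p q g p' q' k l\<rbrakk> \<Longrightarrow>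
      adj B (s p) \<otimes>\<^bsub>B\<^esub> u g \<otimes>\<^bsub>B\<^esub> s q = u k \<otimes>\<^bsub>B\<^esub> s p' \<otimes>\<^bsub>B\<^esub> adj B (s q') \<otimes>\<^bsub>B\<^esub> adj B (u l)"
    and compress_zero: "\<lbrakk>p \<in> carrier P; q \<in> carrier P; g \<in> carrier G;
        \<nexists>p' q' k l. ads_factor G P \<theta> p q g p' q' k l\<rbrakk> \<Longrightarrow>
      adj B (s p) \<otimes>\<^bsub>B\<^esub> u g \<otimes>\<^bsub>B\<^esub> s q = \<zero>\<^bsub>B\<^esub>"

context algebraic_dynamical_system
begin

lemma action_closed: "p \<in> carrier P \<Longrightarrow> g \<in> carrier G \<Longrightarrow> \<theta> p g \<in> carrier G"
  using action_hom by (auto simp: hom_def)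

lemma fu_free: "g \<in> carrier G \<Longrightarrow> gen_u g \<in> free_alg (ads_gens G P)"
  by (simp add: ads_gens_def)

lemma fs_free: "p \<in> carrier P \<Longrightarrow> gen_s p \<in> free_alg (ads_gens G P)"
  by (simp add: ads_gens_def)

lemma ads_relators_free: "ads_relators G P \<theta> \<subseteq> free_alg (ads_gens G P)"
proof
  fix r assume "r \<in> ads_relators G P \<theta>"
  then show "r \<in> free_alg (ads_gens G P)"
    by cases (simp_all add: fu_free fs_free action_closed ads_factor_def)
qed

lemma ads_bounded: "bounded_presentation (ads_gens G P) (ads_relators G P \<theta>)"
  unfolding bounded_presentation_def
proof (intro ballI exI)
  fix x \<rho> assume x: "x \<in> ads_gens G P" and \<rho>: "\<rho> \<in> rel_seminorms (ads_gens G P) (ads_relators G P \<theta>)"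
  interpret cstar_seminorm "ads_gens G P" \<rho>
    using \<rho> by (simp add: rel_seminorms_def)
  have xF: "fgen x \<in> free_alg (ads_gens G P)"
    using x by simp
  have "fadj (fgen x) * fgen x - 1 \<in> ads_relators G P \<theta>"
    using x by (auto simp: ads_gens_def intro: ads_relators.intros)
  then have "\<rho> (fadj (fgen x) * fgen x - 1) = 0"
    using \<rho> by (simp add: rel_seminorms_def)
  then have "\<rho> (fadj (fgen x) * fgen x) \<le> \<rho> 1"
    using rho_reverse_triangle[of "fadj (fgen x) * fgen x" 1] xF by simp
  then have "(\<rho> (fgen x))\<^sup>2 \<le> 1\<^sup>2"
    using rho_1_le cstar[OF xF] by simp
  then show "\<rho> (fgen x) \<le> 1"
    by (rule power2_le_imp_le) simp
qed

lemmas ads_elem_hom = univ_elem_binary(1,2)[OF ads_bounded, folded ads_cstar_def]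
  univ_elem_unary(2)[OF ads_bounded, folded ads_cstar_def] univ_elem_consts(1)[OF ads_bounded, folded ads_cstar_def]

theorem ads_cstar_representation:
  "ads_representation G P \<theta> (ads_cstar G P \<theta>) (ads_u G P \<theta>) (ads_s G P \<theta>)"
proof -
  let ?e = "univ_elem (ads_gens G P) (ads_relators G P \<theta>)" and ?F = "free_alg (ads_gens G P)"
  interpret A: cstar_algebra "ads_cstar G P \<theta>"
    unfolding ads_cstar_def by (rule cstar_algebra_univ_cstar[OF ads_bounded])
  have closed: "?e a \<in> carrier (ads_cstar G P \<theta>)" if "a \<in> ?F" for a
    using univ_elem_closed[OF ads_bounded that] by (simp add: ads_cstar_def)
  have zero: "?e r = \<zero>\<^bsub>ads_cstar G P \<theta>\<^esub>" if "r \<in> ads_relators G P \<theta>" for r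
    using univ_elem_rel[OF ads_bounded ads_relators_free that] by (simp add: ads_cstar_def)
  have eq: "?e a = ?e b" if r: "a - b \<in> ads_relators G P \<theta>" and F: "a \<in> ?F" "b \<in> ?F" for a b
  proof -
    have "?e a = ?e (a - b) \<oplus>\<^bsub>ads_cstar G P \<theta>\<^esub> ?e b"
      using F by (simp flip: ads_elem_hom(1))
    then show ?thesis
      using F by (simp add: zero[OF r] closed)
  qed
  note F = fu_free fs_free action_closed
  note h = ads_u_def ads_s_def ads_elem_hom(2-4)[symmetric] F
  show ?thesis
  proof
    fix g h assume g: "g \<in> carrier G"
    show "ads_u G P \<theta> g \<in> carrier (ads_cstar G P \<theta>)"
      using g by (simp add: h closed)
    show "adj (ads_cstar G P \<theta>) (ads_u G P \<theta> g) \<otimes>\<^bsub>ads_cstar G P \<theta>\<^esub> ads_u G P \<theta> g = \<one>\<^bsub>ads_cstar G P \<theta>\<^esub>"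
      using g ads_relators.unitary_left[OF g, THEN eq] by (simp add: h)
    show "ads_u G P \<theta> g \<otimes>\<^bsub>ads_cstar G P \<theta>\<^esub> adj (ads_cstar G P \<theta>) (ads_u G P \<theta> g) = \<one>\<^bsub>ads_cstar G P \<theta>\<^esub>"
      using g ads_relators.unitary_right[OF g, THEN eq] by (simp add: h)
    assume g': "h \<in> carrier G"
    show "ads_u G P \<theta> (g \<otimes>\<^bsub>G\<^esub> h) = ads_u G P \<theta> g \<otimes>\<^bsub>ads_cstar G P \<theta>\<^esub> ads_u G P \<theta> h"
      using g g' ads_relators.u_mult[OF g g', THEN eq] by (simp add: h)
  next
    show "ads_s G P \<theta> \<one>\<^bsub>P\<^esub> = \<one>\<^bsub>ads_cstar G P \<theta>\<^esub>"
      using ads_relators.s_one[THEN eq] by (simp add: h)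
  next
    fix p q assume p: "p \<in> carrier P"
    show "ads_s G P \<theta> p \<in> carrier (ads_cstar G P \<theta>)"
      using p by (simp add: h closed)
    show "adj (ads_cstar G P \<theta>) (ads_s G P \<theta> p) \<otimes>\<^bsub>ads_cstar G P \<theta>\<^esub> ads_s G P \<theta> p = \<one>\<^bsub>ads_cstar G P \<theta>\<^esub>"
      using p ads_relators.isometry[OF p, THEN eq] by (simp add: h)
    assume q: "q \<in> carrier P"
    show "ads_s G P \<theta> (p \<otimes>\<^bsub>P\<^esub> q) = ads_s G P \<theta> p \<otimes>\<^bsub>ads_cstar G P \<theta>\<^esub> ads_s G P \<theta> q"
      using p q ads_relators.s_mult[OF p q, THEN eq] by (simp add: h)
  next
    fix p g assume pg: "p \<in> carrier P" "g \<in> carrier G"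
    show "ads_s G P \<theta> p \<otimes>\<^bsub>ads_cstar G P \<theta>\<^esub> ads_u G P \<theta> g = ads_u G P \<theta> (\<theta> p g) \<otimes>\<^bsub>ads_cstar G P \<theta>\<^esub> ads_s G P \<theta> p"
      using pg ads_relators.covariance[OF pg, THEN eq] by (simp add: h)
  next
    fix p q g p' q' k l
    assume *: "p \<in> carrier P" "q \<in> carrier P" "g \<in> carrier G" "ads_factor G P \<theta> p q g p' q' k l"
    moreover from *(4) have "p' \<in> carrier P" "q' \<in> carrier P" "k \<in> carrier G" "l \<in> carrier G"
      by (auto simp: ads_factor_def)
    ultimately show "adj (ads_cstar G P \<theta>) (ads_s G P \<theta> p) \<otimes>\<^bsub>ads_cstar G P \<theta>\<^esub> ads_u G P \<theta> g \<otimes>\<^bsub>ads_cstar G P \<theta>\<^esub> ads_s G P \<theta> q =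
        ads_u G P \<theta> k \<otimes>\<^bsub>ads_cstar G P \<theta>\<^esub> ads_s G P \<theta> p' \<otimes>\<^bsub>ads_cstar G P \<theta>\<^esub>
        adj (ads_cstar G P \<theta>) (ads_s G P \<theta> q') \<otimes>\<^bsub>ads_cstar G P \<theta>\<^esub> adj (ads_cstar G P \<theta>) (ads_u G P \<theta> l)"
      using ads_relators.compress[OF *, THEN eq] by (simp add: h)
  next
    fix p q g
    assume *: "p \<in> carrier P" "q \<in> carrier P" "g \<in> carrier G" "\<nexists>p' q' k l. ads_factor G P \<theta> p q g p' q' k l"
    then show "adj (ads_cstar G P \<theta>) (ads_s G P \<theta> p) \<otimes>\<^bsub>ads_cstar G P \<theta>\<^esub> ads_u G P \<theta> g \<otimes>\<^bsub>ads_cstar G P \<theta>\<^esub> ads_s G P \<theta> q =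
        \<zero>\<^bsub>ads_cstar G P \<theta>\<^esub>"
      using ads_relators.compress_zero[OF *, THEN zero] by (simp add: h)
  qed
qed

theorem ads_cstar_dense:
  assumes "\<alpha> \<in> carrier (ads_cstar G P \<theta>)" "e > 0"
  shows "\<exists>a\<in>free_alg (ads_gens G P). cnorm (ads_cstar G P \<theta>)
    (\<alpha> \<ominus>\<^bsub>ads_cstar G P \<theta>\<^esub> univ_elem (ads_gens G P) (ads_relators G P \<theta>) a) < e"
  using univ_elem_dense[OF ads_bounded] assms by (simp add: ads_cstar_def)

end

theorem (in ads_representation) ads_cstar_universal:
  "\<exists>f\<in>star_hom (ads_cstar G P \<theta>) B.
    (\<forall>g\<in>carrier G. f (ads_u G P \<theta> g) = u g) \<and> (\<forall>p\<in>carrier P. f (ads_s G P \<theta> p) = s p) \<and>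
    (\<forall>\<alpha>\<in>carrier (ads_cstar G P \<theta>). cnorm B (f \<alpha>) \<le> cnorm (ads_cstar G P \<theta>) \<alpha>)"
proof -
  define v where "v x = (case x of GenU g \<Rightarrow> u g | GenS p \<Rightarrow> s p)" for x
  have v: "v \<in> ads_gens G P \<rightarrow> carrier B"
    by (auto simp: v_def ads_gens_def u_closed s_closed)
  have gen: "free_eval B v (gen_u g) = u g" if "g \<in> carrier G" for g
    using B.free_eval_gen[OF v, of "GenU g"] that by (simp add: v_def ads_gens_def)
  have gen': "free_eval B v (gen_s p) = s p" if "p \<in> carrier P" for p
    using B.free_eval_gen[OF v, of "GenS p"] that by (simp add: v_def ads_gens_def)
  note ev = B.free_eval_minus[OF v] B.free_eval_mult[OF v] B.free_eval_adj[OF v] B.free_eval_1[OF v]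
    gen gen' fu_free fs_free action_closed u_closed s_closed a_minus_def
  have "free_eval B v r = \<zero>\<^bsub>B\<^esub>" if "r \<in> ads_relators G P \<theta>" for r
    using that
  proof cases
    case (compress p q g p' q' k l)
    moreover from compress have "p' \<in> carrier P" "q' \<in> carrier P" "k \<in> carrier G" "l \<in> carrier G"
      by (auto simp: ads_factor_def)
    ultimately show ?thesis
      using \<open>ads_factor G P \<theta> p q g p' q' k l\<close> by (simp add: ev B.r_neg
          ads_representation.compress[OF ads_representation_axioms])
  qed (simp_all add: ev u_unitary u_mult s_isometry s_one s_mult covariance compress_zero B.r_neg)
  from univ_cstar_universal[OF ads_bounded B.cstar_algebra_axioms v this, folded ads_cstar_def]
  obtain f where "f \<in> star_hom (ads_cstar G P \<theta>) B"
    and "\<forall>a\<in>free_alg (ads_gens G P). f (univ_elem (ads_gens G P) (ads_relators G P \<theta>) a) = free_eval B v a"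
    and "\<forall>\<alpha>\<in>carrier (ads_cstar G P \<theta>). cnorm B (f \<alpha>) \<le> cnorm (ads_cstar G P \<theta>) \<alpha>"
    by blast
  then show ?thesis
    by (intro bexI[of _ f]) (simp_all add: ads_u_def ads_s_def gen gen' fu_free fs_free)
qed

end

theory Submission
  imports Defs "HOL-Analysis.Inner_Product" "HOL-Analysis.Operator_Norm"
begin

text \<open>
  Admissibility consists of the ideal condition, \<open>\<phi>(p)P\<^sub>2 \<inter> \<phi>(q)P\<^sub>2 = \<phi>(pP\<^sub>1 \<inter> qP\<^sub>1)P\<^sub>2\<close>, and the product
  condition: if \<open>pP\<^sub>1 \<inter> qP\<^sub>1\<close> is not empty, then \<open>g\<close> is a product of values of \<open>\<theta>\<^sub>p\<close> and \<open>\<theta>\<^sub>q\<close> as soon as \<open>\<phi>(g)\<close>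
  is one for \<open>\<phi>(p)\<close> and \<open>\<phi>(q)\<close>.
  Together they imply that \<open>(p, q, g)\<close> has a factorisation in the sense of \<open>ads_factor\<close> exactly when its image
  has one, and that factorisations go to factorisations (\<open>factor_image\<close>, \<open>factor_reflect\<close>). So for an admissible morphism the images
  of the generators satisfy the relations of the first system, and the universal property gives the
  *-homomorphism.

  The converse needs a reason why \<open>s\<^sub>p\<^sup>* u\<^sub>g s\<^sub>q\<close> does not vanish in the second algebra, and why it is
  not equal to a wrong normal form. Both come from the left regular representation on the vectors of finite
  support on \<open>G \<times> P\<close>, where \<open>u\<^sub>g (h, t) = (g h, t)\<close> and \<open>s\<^sub>p (h, t) = (\<theta>\<^sub>p h, p t)\<close>. Generators, their
  adjoints and hence all words in them act as partial bijections of the index set, that is, as relations: a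
  product acts by the composite relation and an adjoint by the converse. So checking the defining relations of
  the algebra, and telling two words apart, are both matters of computing relations on \<open>G \<times> P\<close>.

  No Hilbert space has to be completed and no algebra of operators has to be formed. The universal norm is a
  supremum of C*-seminorms on the free *-algebra, so it is enough that the operator norm on the
  incomplete space is such a seminorm (\<open>cstar_seminorm_op_seminorm\<close>) and vanishes on the relators
  (\<open>op_seminorm_relator\<close>). Two words that agree in the universal algebra then have the same relation
  (\<open>word_rel_cong\<close>), and a word that vanishes there has the empty relation (\<open>word_rel_empty\<close>).

  Now let a *-homomorphism be induced. Suppose that \<open>\<phi>(q) t = \<phi>(p) t'\<close> and that \<open>\<phi>(g)\<close> times the value at \<open>h\<close> of
  the action of \<open>\<phi>(q)\<close> is the value at \<open>h'\<close> of the action of \<open>\<phi>(p)\<close>. Then the image of \<open>s\<^sub>p\<^sup>* u\<^sub>g s\<^sub>q\<close> maps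
  \<open>(h, t)\<close> to \<open>(h', t')\<close> and is not zero, so \<open>(p, q, g)\<close> has a factorisation. This gives the product condition.
  For \<open>g = 1\<close>, \<open>h = h' = 1\<close> and a factorisation with \<open>p p' = q q'\<close>, the image of the normal form
  \<open>u\<^sub>k s\<^sub>p\<^sub>' s\<^sub>q\<^sub>'\<^sup>* u\<^sub>l\<^sup>*\<close> is the same operator and hence defined at \<open>(1, t)\<close>. This forces \<open>t \<in> \<phi>(q')P\<^sub>2\<close>, so
  that \<open>\<phi>(q) t \<in> \<phi>(q q')P\<^sub>2\<close>, which is the ideal condition.
\<close>

section \<open>Finitely supported vectors\<close>

typedef 'i fin_vec = "{f :: 'i \<Rightarrow> complex. finite {i. f i \<noteq> 0}}"
  morphisms coord Abs_fin_vec
  by (rule exI[of _ "\<lambda>_. 0"]) simp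

lemma finite_support [simp]: "finite {i. coord x i \<noteq> 0}"
  using coord[of x] by simp

lemma coord_Abs: "finite {i. f i \<noteq> 0} \<Longrightarrow> coord (Abs_fin_vec f) = f"
  by (simp add: Abs_fin_vec_inverse)

lemma fin_vec_eqI: "(\<And>i. coord x i = coord y i) \<Longrightarrow> x = y"
  by (metis coord_inject ext)

definition cscale :: "complex \<Rightarrow> 'i fin_vec \<Rightarrow> 'i fin_vec"
  where "cscale c x = Abs_fin_vec (\<lambda>i. c * coord x i)"

definition unit_vec :: "'i \<Rightarrow> 'i fin_vec"
  where "unit_vec i = Abs_fin_vec (\<lambda>j. of_bool (j = i))"

lemma coord_cscale [simp]: "coord (cscale c x) i = c * coord x i"
  unfolding cscale_def by (subst coord_Abs) (auto intro: finite_subset[OF _ finite_support[of x]])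

lemma coord_unit_vec [simp]: "coord (unit_vec i) j = of_bool (j = i)"
  unfolding unit_vec_def by (subst coord_Abs) auto

instantiation fin_vec :: (type) real_vector
begin

definition "0 = Abs_fin_vec (\<lambda>_. 0)"
definition "x + y = Abs_fin_vec (\<lambda>i. coord x i + coord y i)"
definition "- x = cscale (-1) x"
definition "x - y = x + cscale (-1) y"
definition "scaleR a x = cscale (of_real a) x"

lemma coord_0 [simp]: "coord 0 i = 0"
  unfolding zero_fin_vec_def by (subst coord_Abs) auto

lemma coord_add [simp]: "coord (x + y) i = coord x i + coord y i"
  unfolding plus_fin_vec_def
  by (subst coord_Abs) (auto intro: finite_subset[OF _ finite_UnI[OF finite_support[of x] finite_support[of y]]])

lemma coord_uminus [simp]: "coord (- x) i = - coord x i"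
  by (simp add: uminus_fin_vec_def)

lemma coord_minus [simp]: "coord (x - y) i = coord x i - coord y i"
  by (simp add: minus_fin_vec_def)

lemma coord_scaleR [simp]: "coord (scaleR a x) i = scaleR a (coord x i)"
  by (simp add: scaleR_fin_vec_def scaleR_conv_of_real)

instance
  by standard (auto intro!: fin_vec_eqI simp: scaleR_add_right scaleR_add_left)

end

instantiation fin_vec :: (type) real_inner
begin

text \<open>
  The real part of the complex inner product. It determines the norm, and a complex linear map has the
  same adjoint with respect to either of them.
\<close>
definition "inner x y = (\<Sum>i | coord x i \<noteq> 0. inner (coord x i) (coord y i))"
definition "norm (x :: 'a fin_vec) = sqrt (inner x x)"
definition "sgn (x :: 'a fin_vec) = x /\<^sub>R norm x"
definition "dist (x :: 'a fin_vec) y = norm (x - y)"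
definition "uniformity = (INF e\<in>{0<..}. principal {(x, y). dist x (y :: 'a fin_vec) < e})"
definition "open (U :: 'a fin_vec set) \<longleftrightarrow> (\<forall>x\<in>U. eventually (\<lambda>(x', y). x' = x \<longrightarrow> y \<in> U) uniformity)"

text \<open>
  The defining sum runs over the support of \<open>x\<close>; symmetry and additivity need one index set for
  several vectors at a time.
\<close>
lemma inner_fin_vec_eq:
  assumes "finite S" "\<And>i. coord x i \<noteq> 0 \<Longrightarrow> coord y i \<noteq> 0 \<Longrightarrow> i \<in> S"
  shows "inner x y = (\<Sum>i\<in>S. inner (coord x i) (coord y i))"
proof -
  have "inner x y = (\<Sum>i | i \<in> S \<and> coord x i \<noteq> 0. inner (coord x i) (coord y i))"
    unfolding inner_fin_vec_def
  proof (rule sum.mono_neutral_right)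
    show "\<forall>i\<in>{i. coord x i \<noteq> 0} - {i \<in> S. coord x i \<noteq> 0}. inner (coord x i) (coord y i) = 0"
      using assms(2) by (metis (mono_tags, lifting) DiffE inner_zero_right mem_Collect_eq)
  qed auto
  also have "\<dots> = (\<Sum>i\<in>S. inner (coord x i) (coord y i))"
    using assms by (intro sum.mono_neutral_left) auto
  finally show ?thesis .
qed

instance
proof
  fix x y z :: "'a fin_vec" and a b :: real
  let ?S = "{i. coord x i \<noteq> 0} \<union> {i. coord y i \<noteq> 0} \<union> {i. coord z i \<noteq> 0}"
  have in_S: "inner v w = (\<Sum>i\<in>?S. inner (coord v i) (coord w i))" if "v \<in> {x, y, scaleR a x, x + y}" for v w
    using that by (intro inner_fin_vec_eq) auto
  show "inner x y = inner y x"
    by (simp add: in_S inner_commute)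
  show "inner (x + y) z = inner x z + inner y z"
    by (simp add: in_S inner_add_left sum.distrib)
  show "inner (scaleR a x) y = a * inner x y"
    by (simp add: in_S sum_distrib_left)
  show "0 \<le> inner x x"
    by (simp add: inner_fin_vec_def sum_nonneg)
  show "inner x x = 0 \<longleftrightarrow> x = 0"
    by (auto simp: inner_fin_vec_def sum_nonneg_eq_0_iff intro!: fin_vec_eqI)
qed (simp_all add: sgn_fin_vec_def dist_fin_vec_def norm_fin_vec_def uniformity_fin_vec_def open_fin_vec_def)

end

lemma inner_cscale: "inner (cscale c x) y = inner x (cscale (cnj c) y)"
proof -
  let ?S = "{i. coord x i \<noteq> 0}"
  have "inner (cscale c x) y = (\<Sum>i\<in>?S. inner (coord (cscale c x) i) (coord y i))"
    by (intro inner_fin_vec_eq) auto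
  also have "\<dots> = (\<Sum>i\<in>?S. inner (coord x i) (coord (cscale (cnj c) y) i))"
    by (intro sum.cong) (auto simp: inner_complex_def algebra_simps)
  also have "\<dots> = inner x (cscale (cnj c) y)"
    by (simp add: inner_fin_vec_def)
  finally show ?thesis .
qed

lemma cscale_cscale: "cscale c (cscale d x) = cscale (c * d) x"
  by (rule fin_vec_eqI) simp

lemma cscale_add: "cscale c (x + y) = cscale c x + cscale c y"
  by (rule fin_vec_eqI) (simp add: algebra_simps)

lemma cscale_scaleR: "cscale c (scaleR a x) = scaleR a (cscale c x)"
  by (rule fin_vec_eqI) simp

lemma cscale_1 [simp]: "cscale 1 x = x"
  by (rule fin_vec_eqI) simp

lemma cscale_0 [simp]: "cscale c 0 = 0"
  by (rule fin_vec_eqI) simp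

lemma cscale_0_left [simp]: "cscale 0 x = 0"
  by (rule fin_vec_eqI) simp

lemma norm_cscale: "norm (cscale c x) = cmod c * norm x"
proof -
  have "inner (cscale c x) (cscale c x) = inner x (scaleR ((cmod c)\<^sup>2) x)"
    by (simp add: inner_cscale cscale_cscale scaleR_fin_vec_def complex_norm_square mult.commute del: of_real_power)
  then show ?thesis
    by (simp add: norm_eq_sqrt_inner real_sqrt_mult)
qed

lemma bounded_linear_cscale: "bounded_linear (cscale c)"
  by (rule bounded_linear_intro[of _ "cmod c"]) (simp_all add: cscale_add cscale_scaleR norm_cscale mult.commute)


section \<open>Partial bijections as partial isometries\<close>

definition partial_bij :: "'i rel \<Rightarrow> bool"
  where "partial_bij R \<longleftrightarrow> single_valued R \<and> single_valued (R\<inverse>)"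

text \<open>
  For a partial bijection the sum has at most one term: the basis vector at \<open>i\<close> goes to the basis vector at
  the partner of \<open>i\<close>, or to zero if \<open>i\<close> has none.
\<close>
definition rel_op :: "'i rel \<Rightarrow> 'i fin_vec \<Rightarrow> 'i fin_vec"
  where "rel_op R x = Abs_fin_vec (\<lambda>j. \<Sum>i | (i, j) \<in> R. coord x i)"

lemma partial_bij_converse: "partial_bij R \<Longrightarrow> partial_bij (R\<inverse>)"
  by (simp add: partial_bij_def)

lemma partial_bij_comp: "partial_bij R \<Longrightarrow> partial_bij S \<Longrightarrow> partial_bij (R O S)"
  by (simp add: partial_bij_def single_valued_relcomp converse_relcomp)

lemma partial_bij_Id_on: "partial_bij (Id_on D)"
  by (auto simp add: partial_bij_def single_valued_def)

lemma coord_rel_op: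
  assumes "partial_bij R"
  shows "coord (rel_op R x) j = (\<Sum>i | (i, j) \<in> R. coord x i)"
proof -
  have "{j. (\<Sum>i | (i, j) \<in> R. coord x i) \<noteq> 0} \<subseteq> R `` {i. coord x i \<noteq> 0}"
  proof
    fix j assume "j \<in> {j. (\<Sum>i | (i, j) \<in> R. coord x i) \<noteq> 0}"
    then obtain i where "(i, j) \<in> R" "coord x i \<noteq> 0"
      using sum.not_neutral_contains_not_neutral[of "coord x" "{i. (i, j) \<in> R}"] by auto
    then show "j \<in> R `` {i. coord x i \<noteq> 0}" by blast
  qed
  moreover have "finite (R `` {i. coord x i \<noteq> 0})"
  proof -
    have "R `` {i} \<subseteq> {THE j. (i, j) \<in> R}" for i
      using assms by (auto simp: partial_bij_def single_valued_def intro!: the_equality[symmetric])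
    then have "finite (R `` {i})" for i
      by (rule finite_subset) simp
    then show ?thesis
      by (subst Image_eq_UN) simp
  qed
  ultimately show ?thesis
    unfolding rel_op_def by (subst coord_Abs) (auto intro: finite_subset)
qed

lemma coord_rel_op_in:
  assumes "partial_bij R" "(i, j) \<in> R" shows "coord (rel_op R x) j = coord x i"
proof -
  have "{i. (i, j) \<in> R} = {i}"
    using assms by (auto simp: partial_bij_def single_valued_def)
  then show ?thesis
    by (simp add: coord_rel_op assms)
qed

lemma coord_rel_op_out:
  assumes "partial_bij R" "\<And>i. (i, j) \<notin> R" shows "coord (rel_op R x) j = 0"
  by (simp add: coord_rel_op assms)

lemma rel_op_comp:
  assumes "partial_bij R" "partial_bij S"
  shows "rel_op S (rel_op R x) = rel_op (R O S) x"
proof (rule fin_vec_eqI)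
  note RS = partial_bij_comp[OF assms]
  fix k
  show "coord (rel_op S (rel_op R x)) k = coord (rel_op (R O S) x) k"
  proof (cases "\<exists>j. (j, k) \<in> S")
    case True
    then obtain j where j: "(j, k) \<in> S" ..
    show ?thesis
    proof (cases "\<exists>i. (i, j) \<in> R")
      case True
      then obtain i where i: "(i, j) \<in> R" ..
      then have "(i, k) \<in> R O S"
        using j by blast
      then show ?thesis
        by (simp add: coord_rel_op_in[OF assms(1) i] coord_rel_op_in[OF assms(2) j] coord_rel_op_in[OF RS])
    next
      case False
      have "j' = j" if "(j', k) \<in> S" for j'
        using j that assms(2) unfolding partial_bij_def single_valued_def converse_iff by blast
      then have "(i, k) \<notin> R O S" for i
        using False by blast
      then show ?thesis
        using False by (simp add: coord_rel_op_out[OF assms(1)] coord_rel_op_in[OF assms(2) j] coord_rel_op_out[OF RS])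
    qed
  next
    case False
    then have "(i, k) \<notin> R O S" for i by blast
    then show ?thesis
      using False by (simp add: coord_rel_op_out[OF assms(2)] coord_rel_op_out[OF RS])
  qed
qed

text \<open>
  The matrix of \<open>rel_op R\<close> is the indicator of \<open>R\<close>. In this form the roles of \<open>x\<close> and \<open>y\<close> are
  interchanged by passing to the converse, so that the converse gives the adjoint.
\<close>
lemma inner_rel_op_sum:
  assumes "partial_bij R"
  shows "inner (rel_op R x) y = (\<Sum>(i, j) | (i, j) \<in> R \<and> coord x i \<noteq> 0 \<and> coord y j \<noteq> 0. inner (coord x i) (coord y j))"
proof -
  let ?K = "{(i, j). (i, j) \<in> R \<and> coord x i \<noteq> 0 \<and> coord y j \<noteq> 0}"
  have fin: "finite ?K"
    by (rule finite_subset[OF _ finite_cartesian_product[OF finite_support[of x] finite_support[of y]]]) auto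
  have inj: "inj_on snd ?K"
    using assms by (auto simp: inj_on_def partial_bij_def single_valued_def)
  have "inner (rel_op R x) y = (\<Sum>j\<in>snd ` ?K. inner (coord (rel_op R x) j) (coord y j))"
  proof (rule inner_fin_vec_eq)
    fix j assume nz: "coord (rel_op R x) j \<noteq> 0" "coord y j \<noteq> 0"
    then obtain i where "(i, j) \<in> R"
      using coord_rel_op_out[OF assms] by blast
    then show "j \<in> snd ` ?K"
      using nz by (force simp: coord_rel_op_in[OF assms])
  qed (use fin in simp)
  also have "\<dots> = (\<Sum>(i, j)\<in>?K. inner (coord x i) (coord y j))"
    unfolding sum.reindex[OF inj] by (intro sum.cong) (auto simp: coord_rel_op_in[OF assms])
  finally show ?thesis .
qed

lemma inner_rel_op:
  assumes "partial_bij R"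
  shows "inner (rel_op R x) y = inner x (rel_op (R\<inverse>) y)"
proof -
  have "inner x (rel_op (R\<inverse>) y) = inner (rel_op (R\<inverse>) y) x"
    by (rule inner_commute)
  also have "\<dots> = (\<Sum>(j, i) | (j, i) \<in> R\<inverse> \<and> coord y j \<noteq> 0 \<and> coord x i \<noteq> 0. inner (coord y j) (coord x i))"
    by (rule inner_rel_op_sum[OF partial_bij_converse[OF assms]])
  also have "\<dots> = (\<Sum>(i, j) | (i, j) \<in> R \<and> coord x i \<noteq> 0 \<and> coord y j \<noteq> 0. inner (coord x i) (coord y j))"
    by (rule sum.reindex_bij_witness[of _ prod.swap prod.swap]) (auto simp: inner_commute)
  finally show ?thesis
    by (simp add: inner_rel_op_sum[OF assms])
qed

lemma rel_op_linear:
  assumes "partial_bij R"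
  shows "rel_op R (x + y) = rel_op R x + rel_op R y" "rel_op R (cscale c x) = cscale c (rel_op R x)"
  by (rule fin_vec_eqI, simp add: coord_rel_op[OF assms] sum.distrib sum_distrib_left)+

text \<open>
  A partial isometry is a contraction because \<open>R O R\<inverse>\<close> is a part of the identity: adjoint times operator is the
  projection to the coordinates in the domain of \<open>R\<close>.
\<close>
lemma norm_rel_op_le:
  assumes "partial_bij R"
  shows "norm (rel_op R x) \<le> norm x"
proof -
  let ?S = "{i. coord x i \<noteq> 0}" and ?D = "R O R\<inverse>"
  have D: "partial_bij ?D"
    using assms by (intro partial_bij_comp partial_bij_converse)
  have D_Id: "?D \<subseteq> Id"
    using assms by (auto simp: partial_bij_def single_valued_def)
  have "inner (rel_op R x) (rel_op R x) = inner (rel_op ?D x) x"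
    using inner_rel_op[OF partial_bij_converse[OF assms], of "rel_op R x" x]
    by (simp add: rel_op_comp assms partial_bij_converse)
  also have "\<dots> = (\<Sum>i\<in>?S. inner (coord (rel_op ?D x) i) (coord x i))"
    by (rule inner_fin_vec_eq) auto
  also have "\<dots> \<le> (\<Sum>i\<in>?S. inner (coord x i) (coord x i))"
  proof (rule sum_mono)
    fix i
    show "inner (coord (rel_op ?D x) i) (coord x i) \<le> inner (coord x i) (coord x i)"
    proof (cases "(i, i) \<in> ?D")
      case False
      then have "coord (rel_op ?D x) i = 0"
        using D D_Id by (intro coord_rel_op_out) auto
      then show ?thesis by simp
    qed (simp add: coord_rel_op_in[OF D])
  qed
  also have "\<dots> = inner x x"
    by (simp add: inner_fin_vec_def)
  finally show ?thesis
    by (simp add: norm_eq_sqrt_inner)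
qed

lemma bounded_linear_rel_op:
  assumes "partial_bij R" shows "bounded_linear (rel_op R)"
  using assms by (intro bounded_linear_intro[of _ 1])
    (simp_all add: rel_op_linear scaleR_fin_vec_def norm_rel_op_le)


section \<open>Representations of the free *-algebra by partial bijections\<close>

text \<open>
  The C*-identity in a possibly incomplete space. Cauchy-Schwarz gives
  \<open>\<parallel>S x\<parallel>\<^sup>2 = \<langle>x, T S x\<rangle> \<le> \<parallel>T S\<parallel> \<parallel>x\<parallel>\<^sup>2\<close>, hence \<open>\<parallel>S\<parallel>\<^sup>2 \<le> \<parallel>T S\<parallel> \<le> \<parallel>T\<parallel> \<parallel>S\<parallel>\<close> and so \<open>\<parallel>S\<parallel> \<le> \<parallel>T\<parallel>\<close>. By
  symmetry the norms of \<open>S\<close> and \<open>T\<close> agree, which gives the remaining inequality.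
\<close>
lemma onorm_adjoint_comp:
  fixes S T :: "'v::real_inner \<Rightarrow> 'v"
  assumes S: "bounded_linear S" and T: "bounded_linear T"
    and adj: "\<And>x y. inner (S x) y = inner x (T y)"
  shows "onorm (\<lambda>x. T (S x)) = (onorm S)\<^sup>2"
proof -
  have sq: "(onorm S)\<^sup>2 \<le> onorm (\<lambda>x. T (S x))"
    if S: "bounded_linear S" and T: "bounded_linear T" and adj: "\<And>x y. inner (S x) y = inner x (T y)"
    for S T :: "'v \<Rightarrow> 'v"
  proof -
    let ?N = "onorm (\<lambda>x. T (S x))"
    have TS: "bounded_linear (\<lambda>x. T (S x))"
      using bounded_linear_compose[OF T S] .
    have "norm (S x) \<le> sqrt ?N * norm x" for x
    proof -
      have "(norm (S x))\<^sup>2 = inner x (T (S x))"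
        by (simp add: power2_norm_eq_inner adj)
      also have "\<dots> \<le> norm x * norm (T (S x))"
        by (rule norm_cauchy_schwarz)
      also have "\<dots> \<le> norm x * (?N * norm x)"
        by (intro mult_left_mono onorm[OF TS]) auto
      also have "\<dots> = (sqrt ?N * norm x)\<^sup>2"
        using onorm_pos_le[OF TS] by (simp add: power_mult_distrib power2_eq_square)
      finally show ?thesis
        using onorm_pos_le[OF TS] by (auto intro: power2_le_imp_le)
    qed
    then have "onorm S \<le> sqrt ?N"
      using onorm_pos_le[OF TS] by (intro onorm_bound) auto
    then show ?thesis
      using onorm_pos_le[OF S] onorm_pos_le[OF TS] power_mono[of "onorm S" "sqrt ?N" 2] by simp
  qed
  have le: "onorm S \<le> onorm T"
    if S: "bounded_linear S" and T: "bounded_linear T" and adj: "\<And>x y. inner (S x) y = inner x (T y)"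
    for S T :: "'v \<Rightarrow> 'v"
  proof -
    have "onorm S * onorm S \<le> onorm T * onorm S"
      using sq[OF that] onorm_compose[OF T S] by (simp add: power2_eq_square comp_def)
    then show ?thesis
      using onorm_pos_le[OF S] onorm_pos_le[OF T] by (cases "onorm S = 0") auto
  qed
  have "onorm T = onorm S"
    using le[OF S T adj] le[OF T S] adj by (metis inner_commute order.antisym)
  then show ?thesis
    using sq[OF S T adj] onorm_compose[OF T S] by (simp add: power2_eq_square comp_def)
qed

locale partial_bij_action =
  fixes I :: "'i set" and r :: "'x \<Rightarrow> 'i rel"
  assumes r_subset: "r x \<subseteq> I \<times> I"
    and r_partial_bij: "partial_bij (r x)"
begin

lemma Id_on_comp_r [simp]: "Id_on I O r x = r x" "Id_on I O (r x)\<inverse> = (r x)\<inverse>"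
  using r_subset[of x] by auto

text \<open>
  A word acts from right to left whereas \<open>O\<close> composes from left to right, so the last letter comes first
  in the composite. The empty word acts as the identity of \<open>I\<close> and not of the whole index type: a unitary
  generator, for instance, is a bijection of \<open>I\<close> only, and \<open>x\<^sup>* x - 1\<close> still has to act as zero.
\<close>
definition word_rel :: "'x star_word \<Rightarrow> 'i rel"
  where "word_rel w = foldr (\<lambda>(x, b) R. R O (if b then (r x)\<inverse> else r x)) (letters w) (Id_on I)"

definition free_op :: "'x free_star \<Rightarrow> 'i fin_vec \<Rightarrow> 'i fin_vec"
  where "free_op a x = (\<Sum>w\<in>Poly_Mapping.keys a. cscale (Poly_Mapping.lookup a w) (rel_op (word_rel w) x))"

definition op_seminorm :: "'x free_star \<Rightarrow> real"
  where "op_seminorm a = onorm (free_op a)"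

lemma word_rel_Nil [simp]: "word_rel (Word []) = Id_on I"
  by (simp add: word_rel_def)

lemma word_rel_Cons [simp]:
  "word_rel (Word ((x, b) # ls)) = word_rel (Word ls) O (if b then (r x)\<inverse> else r x)"
  by (simp add: word_rel_def)

lemma word_rel_0: "word_rel 0 = Id_on I"
  by (simp add: zero_star_word_def)

lemma word_rel_subset: "word_rel w \<subseteq> I \<times> I"
proof (cases w)
  case (Word ls)
  have "word_rel (Word ls) \<subseteq> I \<times> I"
  proof (induction ls)
    case (Cons l ls)
    then show ?case
      using r_subset[of "fst l"] by (cases l) (auto split: if_splits)
  qed auto
  then show ?thesis by (simp add: Word)
qed

lemma partial_bij_word_rel: "partial_bij (word_rel w)"
proof (cases w)
  case (Word ls)
  have "partial_bij (word_rel (Word ls))"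
  proof (induction ls)
    case (Cons l ls)
    then show ?case
      using r_partial_bij[of "fst l"] by (cases l) (auto intro: partial_bij_comp partial_bij_converse)
  qed (auto intro: partial_bij_Id_on)
  then show ?thesis by (simp add: Word)
qed

lemma word_rel_add: "word_rel (v + w) = word_rel w O word_rel v"
proof -
  have "word_rel (Word (ls @ letters w)) = word_rel w O word_rel (Word ls)" for ls
  proof (induction ls)
    case Nil
    have "word_rel w O Id_on I = word_rel w"
      using word_rel_subset[of w] by auto
    then show ?case by simp
  next
    case (Cons l ls)
    then show ?case by (cases l) (simp add: O_assoc)
  qed
  from this[of "letters v"] show ?thesis
    by (simp add: plus_star_word_def)
qed

lemma word_rel_adj: "word_rel (word_adj w) = (word_rel w)\<inverse>"
proof -
  have "word_rel (word_adj (Word ls)) = (word_rel (Word ls))\<inverse>" for ls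
  proof (induction ls)
    case Nil
    then show ?case by (simp add: word_adj_def)
  next
    case (Cons l ls)
    obtain x b where l: "l = (x, b)" by (cases l)
    have "Word (l # ls) = Word [l] + Word ls"
      by (simp add: plus_star_word_def)
    then have "word_rel (word_adj (Word (l # ls))) = word_rel (word_adj (Word [l])) O word_rel (word_adj (Word ls))"
      by (simp add: word_adj_add word_rel_add)
    moreover have "word_rel (word_adj (Word [l])) = (word_rel (Word [l]))\<inverse>"
      using r_subset[of x] by (auto simp: l word_adj_def)
    moreover have "word_rel (Word (l # ls)) = word_rel (Word ls) O word_rel (Word [l])"
      using word_rel_add[of "Word [l]" "Word ls"] by (simp add: plus_star_word_def)
    ultimately show ?case
      by (simp add: Cons.IH converse_relcomp)
  qed
  from this[of "letters w"] show ?thesis by simp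
qed

lemma free_op_superset:
  assumes "finite S" "Poly_Mapping.keys a \<subseteq> S"
  shows "free_op a x = (\<Sum>w\<in>S. cscale (Poly_Mapping.lookup a w) (rel_op (word_rel w) x))"
  unfolding free_op_def using assms by (intro sum.mono_neutral_left) (auto simp: in_keys_iff)

lemma free_op_0 [simp]: "free_op 0 x = 0"
  by (simp add: free_op_def)

lemma free_op_single: "free_op (Poly_Mapping.single w c) x = cscale c (rel_op (word_rel w) x)"
  using free_op_superset[of "{w}" "Poly_Mapping.single w c" x] by simp

lemma free_op_add: "free_op (a + b) x = free_op a x + free_op b x"
proof -
  let ?S = "Poly_Mapping.keys a \<union> Poly_Mapping.keys b"
  have "cscale (Poly_Mapping.lookup (a + b) w) y =
      cscale (Poly_Mapping.lookup a w) y + cscale (Poly_Mapping.lookup b w) y" for w and y :: "'i fin_vec"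
    by (rule fin_vec_eqI) (simp add: lookup_add algebra_simps)
  then show ?thesis
    using free_op_superset[of ?S a x] free_op_superset[of ?S b x] free_op_superset[of ?S "a + b" x]
      Poly_Mapping.keys_add[of a b] by (simp add: sum.distrib)
qed

lemma free_star_induct [case_names zero add]:
  assumes "P 0" "\<And>a w c. P a \<Longrightarrow> P (a + Poly_Mapping.single w c)"
  shows "P (a :: 'y free_star)"
  by (rule free_alg_induct[of a UNIV]) (use assms in \<open>auto simp: free_alg_def\<close>)

lemma bounded_linear_free_op: "bounded_linear (free_op a)"
proof (induction a rule: free_star_induct)
  case (add a w c)
  show ?case
    unfolding free_op_add free_op_single
    by (intro bounded_linear_add add bounded_linear_compose[OF bounded_linear_cscale]
        bounded_linear_rel_op partial_bij_word_rel)
qed simp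

lemma free_op_mult: "free_op (a * b) x = free_op a (free_op b x)"
proof (induction a rule: free_star_induct)
  case (add a w c)
  have "free_op (Poly_Mapping.single w c * b) x = free_op (Poly_Mapping.single w c) (free_op b x)"
  proof (induction b rule: free_star_induct)
    case zero
    then show ?case
      using linear_0[OF bounded_linear.linear[OF bounded_linear_free_op]] by simp
  next
    case (add b v d)
    then show ?case
      by (simp add: distrib_left free_op_add mult_single free_op_single word_rel_add cscale_add cscale_cscale
        rel_op_linear[OF partial_bij_word_rel] flip: rel_op_comp[OF partial_bij_word_rel partial_bij_word_rel])
  qed
  then show ?case
    using add by (simp add: distrib_right free_op_add)
qed simp

lemma free_op_adj: "inner (free_op a x) y = inner x (free_op (fadj a) y)"
proof (induction a rule: free_star_induct)
  case (add a w c)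
  then show ?case
    by (simp add: fadj_add fadj_single free_op_add free_op_single inner_add_left inner_add_right inner_cscale
        inner_rel_op[OF partial_bij_word_rel] rel_op_linear[OF partial_bij_converse[OF partial_bij_word_rel]] word_rel_adj)
qed simp

lemma free_op_scale: "free_op (fscale c a) x = cscale c (free_op a x)"
  unfolding fscale_def free_op_mult free_op_single word_rel_0
proof (induction a rule: free_star_induct)
  case (add a w d)
  have "word_rel w O Id_on I = word_rel w"
    using word_rel_subset[of w] by auto
  then show ?case
    using add by (simp add: free_op_add free_op_single cscale_add rel_op_linear partial_bij_Id_on
        rel_op_comp partial_bij_word_rel)
qed (simp add: linear_0[OF bounded_linear.linear[OF bounded_linear_rel_op[OF partial_bij_Id_on]]])

lemma cstar_seminorm_op_seminorm: "cstar_seminorm X op_seminorm"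
proof
  fix a b :: "'x free_star" and c :: complex
  show "op_seminorm (a + b) \<le> op_seminorm a + op_seminorm b"
    unfolding op_seminorm_def free_op_add by (intro onorm_triangle bounded_linear_free_op)
  have "onorm (free_op (fscale c a)) = onorm (\<lambda>x. cmod c *\<^sub>R free_op a x)"
    by (simp add: onorm_def free_op_scale norm_cscale)
  then show "op_seminorm (fscale c a) = cmod c * op_seminorm a"
    by (simp add: op_seminorm_def onorm_scaleR bounded_linear_free_op)
  show "op_seminorm (a * b) \<le> op_seminorm a * op_seminorm b"
    using onorm_compose[OF bounded_linear_free_op[of a] bounded_linear_free_op[of b]]
    by (simp add: op_seminorm_def comp_def flip: free_op_mult)
  show "op_seminorm (fadj a * a) = (op_seminorm a)\<^sup>2"
    unfolding op_seminorm_def free_op_mult[abs_def]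
    by (intro onorm_adjoint_comp bounded_linear_free_op free_op_adj)
qed

lemma op_seminorm_eq_0_iff: "op_seminorm a = 0 \<longleftrightarrow> (\<forall>x. free_op a x = 0)"
  unfolding op_seminorm_def by (rule onorm_eq_0[OF bounded_linear_free_op])

text \<open>The relation of a word can be read off from the images of the basis vectors.\<close>
lemma op_seminorm_word_diff_eq_0_iff:
  "op_seminorm (Poly_Mapping.single v 1 - Poly_Mapping.single w 1) = 0 \<longleftrightarrow> word_rel v = word_rel w"
proof -
  have op: "free_op (Poly_Mapping.single v 1 - Poly_Mapping.single w 1) x = rel_op (word_rel v) x - rel_op (word_rel w) x"
    for v w x
    using free_op_add[of "Poly_Mapping.single v 1 - Poly_Mapping.single w 1" "Poly_Mapping.single w 1" x]
    by (simp add: free_op_single)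
  have sub: "word_rel v \<subseteq> word_rel w"
    if eq: "\<And>x. rel_op (word_rel v) x = rel_op (word_rel w) x" for v w
  proof (rule subrelI, rule ccontr)
    fix i j assume "(i, j) \<in> word_rel v" "(i, j) \<notin> word_rel w"
    then have "coord (rel_op (word_rel v) (unit_vec i)) j = 1"
      by (simp add: coord_rel_op_in[OF partial_bij_word_rel])
    moreover have "coord (rel_op (word_rel w) (unit_vec i)) j = 0"
      using \<open>(i, j) \<notin> word_rel w\<close>
      by (auto simp: coord_rel_op[OF partial_bij_word_rel] intro!: sum.neutral)
    ultimately show False
      by (simp add: eq)
  qed
  show ?thesis
    unfolding op_seminorm_eq_0_iff op using sub[of v w] sub[of w v] by auto
qed

lemma op_seminorm_word_eq_0_iff: "op_seminorm (Poly_Mapping.single w 1) = 0 \<longleftrightarrow> word_rel w = {}"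
proof
  assume "op_seminorm (Poly_Mapping.single w 1) = 0"
  then have z: "rel_op (word_rel w) x = 0" for x
    by (simp add: op_seminorm_eq_0_iff free_op_single)
  show "word_rel w = {}"
  proof (rule equals0I, clarify)
    fix i j assume "(i, j) \<in> word_rel w"
    then have "coord (rel_op (word_rel w) (unit_vec i)) j = 1"
      by (simp add: coord_rel_op_in[OF partial_bij_word_rel])
    then show False
      by (simp add: z)
  qed
next
  assume "word_rel w = {}"
  then show "op_seminorm (Poly_Mapping.single w 1) = 0"
    using partial_bij_word_rel[of w]
    by (auto simp: op_seminorm_eq_0_iff free_op_single coord_rel_op_out intro!: fin_vec_eqI)
qed

end


section \<open>The regular representation of an algebraic dynamical system\<close>

lemma one_eq_word: "1 = Poly_Mapping.single (Word []) 1"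
  by (simp add: flip: zero_star_word_def)

abbreviation compress_word :: "'p \<Rightarrow> 'g \<Rightarrow> 'p \<Rightarrow> ('g, 'p) ads_gen star_word"
  where "compress_word p g q \<equiv> Word [(GenS p, True), (GenU g, False), (GenS q, False)]"

abbreviation factored_word :: "'g \<Rightarrow> 'p \<Rightarrow> 'p \<Rightarrow> 'g \<Rightarrow> ('g, 'p) ads_gen star_word"
  where "factored_word k p q l \<equiv> Word [(GenU k, False), (GenS p, False), (GenS q, True), (GenU l, True)]"

context algebraic_dynamical_system
begin

text \<open>
  The left translations of the semidirect product of \<open>G\<close> and \<open>P\<close>, whose product is
  \<open>(g, p) (h, t) = (g \<theta>\<^sub>p(h), p t)\<close>, by the elements \<open>(g, 1)\<close> and \<open>(1, p)\<close>.
\<close>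
definition reg_rel :: "('g, 'p) ads_gen \<Rightarrow> ('g \<times> 'p) rel"
  where "reg_rel x = (case x of
      GenU g \<Rightarrow> {((h, t), (g \<otimes>\<^bsub>G\<^esub> h, t)) | h t. g \<in> carrier G \<and> h \<in> carrier G \<and> t \<in> carrier P}
    | GenS p \<Rightarrow> {((h, t), (\<theta> p h, p \<otimes>\<^bsub>P\<^esub> t)) | h t. p \<in> carrier P \<and> h \<in> carrier G \<and> t \<in> carrier P})"

lemma action_G_mult:
  "p \<in> carrier P \<Longrightarrow> g \<in> carrier G \<Longrightarrow> h \<in> carrier G \<Longrightarrow> \<theta> p (g \<otimes>\<^bsub>G\<^esub> h) = \<theta> p g \<otimes>\<^bsub>G\<^esub> \<theta> p h"
  by (rule hom_mult[OF action_hom])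

lemma action_G_one: "p \<in> carrier P \<Longrightarrow> \<theta> p \<one>\<^bsub>G\<^esub> = \<one>\<^bsub>G\<^esub>"
  by (rule hom_one[OF action_hom]) auto

lemma action_G_inv: "p \<in> carrier P \<Longrightarrow> g \<in> carrier G \<Longrightarrow> \<theta> p (inv\<^bsub>G\<^esub> g) = inv\<^bsub>G\<^esub> (\<theta> p g)"
  using group_hom.hom_inv[of G G "\<theta> p" g] action_hom
  by (simp add: group_hom_def group_hom_axioms_def)

lemma action_eq_iff:
  "p \<in> carrier P \<Longrightarrow> g \<in> carrier G \<Longrightarrow> h \<in> carrier G \<Longrightarrow> \<theta> p g = \<theta> p h \<longleftrightarrow> g = h"
  using action_inj by (auto dest: inj_onD)

lemma P_left_cancel_iff:
  "p \<in> carrier P \<Longrightarrow> q \<in> carrier P \<Longrightarrow> r \<in> carrier P \<Longrightarrow> p \<otimes>\<^bsub>P\<^esub> q = p \<otimes>\<^bsub>P\<^esub> r \<longleftrightarrow> q = r"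
  using P.left_cancel by blast

sublocale reg: partial_bij_action "carrier G \<times> carrier P" reg_rel
proof
  fix x :: "('g, 'p) ads_gen"
  show "reg_rel x \<subseteq> (carrier G \<times> carrier P) \<times> (carrier G \<times> carrier P)"
    by (cases x) (auto simp: reg_rel_def action_closed)
  show "partial_bij (reg_rel x)"
    by (cases x) (auto simp: reg_rel_def partial_bij_def single_valued_def action_eq_iff P_left_cancel_iff)
qed

lemma word_rel_compress_iff:
  "((h, t), (h', t')) \<in> reg.word_rel (compress_word p g q) \<longleftrightarrow>
    p \<in> carrier P \<and> q \<in> carrier P \<and> g \<in> carrier G \<and>
    h \<in> carrier G \<and> t \<in> carrier P \<and> h' \<in> carrier G \<and> t' \<in> carrier P \<and>
    g \<otimes>\<^bsub>G\<^esub> \<theta> q h = \<theta> p h' \<and> q \<otimes>\<^bsub>P\<^esub> t = p \<otimes>\<^bsub>P\<^esub> t'"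
  by (auto simp: reg_rel_def relcomp_unfold Id_on_iff action_closed)

lemma word_rel_factored_iff:
  "((h, t), (h', t')) \<in> reg.word_rel (factored_word k p q l) \<longleftrightarrow>
    p \<in> carrier P \<and> q \<in> carrier P \<and> k \<in> carrier G \<and> l \<in> carrier G \<and>
    (\<exists>m\<in>carrier G. \<exists>c\<in>carrier P. h = l \<otimes>\<^bsub>G\<^esub> \<theta> q m \<and> t = q \<otimes>\<^bsub>P\<^esub> c \<and> h' = k \<otimes>\<^bsub>G\<^esub> \<theta> p m \<and> t' = p \<otimes>\<^bsub>P\<^esub> c)"
  by (simp add: reg_rel_def relcomp_unfold Id_on_iff action_closed)
    (blast intro: action_closed G.m_closed P.m_closed)

text \<open>
  The right LCM property and its compatibility with the action enter here. If \<open>s\<^sub>p\<^sup>* u\<^sub>g s\<^sub>q\<close> is defined at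
  \<open>(h, t)\<close> with value \<open>(h', t')\<close>, then
  \<open>q t = p t'\<close> lies in \<open>pP \<inter> qP\<close>, and \<open>\<theta>\<^sub>q(l\<^sup>-\<^sup>1 h) = \<theta>\<^sub>p(k\<^sup>-\<^sup>1 h')\<close> lies in the intersection of the images of
  \<open>\<theta>\<^sub>p\<close> and \<open>\<theta>\<^sub>q\<close>. With \<open>r = p p' = q q'\<close> these two sets are \<open>rP\<close> and the image of \<open>\<theta>\<^sub>r\<close>, so cancelling
  \<open>p\<close> and \<open>q\<close> yields the common parameters \<open>c\<close> and \<open>m\<close> of the other word.
\<close>
lemma word_rel_compress_eq_factored:
  assumes pqg: "p \<in> carrier P" "q \<in> carrier P" "g \<in> carrier G" and fac: "ads_factor G P \<theta> p q g p' q' k l"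
  shows "reg.word_rel (compress_word p g q) =
    reg.word_rel (factored_word k p' q' l)"
proof -
  have cl: "p' \<in> carrier P" "q' \<in> carrier P" "k \<in> carrier G" "l \<in> carrier G"
    and r: "p \<otimes>\<^bsub>P\<^esub> p' = q \<otimes>\<^bsub>P\<^esub> q'"
    and lcm: "(p <#\<^bsub>P\<^esub> carrier P) \<inter> (q <#\<^bsub>P\<^esub> carrier P) = (p \<otimes>\<^bsub>P\<^esub> p') <#\<^bsub>P\<^esub> carrier P"
    and g: "g = \<theta> p k \<otimes>\<^bsub>G\<^esub> \<theta> q (inv\<^bsub>G\<^esub> l)"
    using fac by (auto simp: ads_factor_def)
  note closed = pqg cl action_closed
  have act: "\<theta> p (\<theta> p' m) = \<theta> q (\<theta> q' m)" if "m \<in> carrier G" for m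
    using that closed r by (metis action_mult)
  have mul: "p \<otimes>\<^bsub>P\<^esub> (p' \<otimes>\<^bsub>P\<^esub> c) = q \<otimes>\<^bsub>P\<^esub> (q' \<otimes>\<^bsub>P\<^esub> c)" if "c \<in> carrier P" for c
    using that closed r by (metis P.m_assoc)
  have g_act: "g \<otimes>\<^bsub>G\<^esub> \<theta> q h = \<theta> p k \<otimes>\<^bsub>G\<^esub> \<theta> q (inv\<^bsub>G\<^esub> l \<otimes>\<^bsub>G\<^esub> h)" if "h \<in> carrier G" for h
    using that closed by (simp add: g action_G_mult G.m_assoc)
  have "(g \<otimes>\<^bsub>G\<^esub> \<theta> q h = \<theta> p h' \<and> q \<otimes>\<^bsub>P\<^esub> t = p \<otimes>\<^bsub>P\<^esub> t') \<longleftrightarrow>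
      (\<exists>m\<in>carrier G. \<exists>c\<in>carrier P. h = l \<otimes>\<^bsub>G\<^esub> \<theta> q' m \<and> t = q' \<otimes>\<^bsub>P\<^esub> c \<and> h' = k \<otimes>\<^bsub>G\<^esub> \<theta> p' m \<and> t' = p' \<otimes>\<^bsub>P\<^esub> c)"
    if ht: "h \<in> carrier G" "t \<in> carrier P" "h' \<in> carrier G" "t' \<in> carrier P" for h t h' t'
  proof (intro iffI)
    assume eq: "g \<otimes>\<^bsub>G\<^esub> \<theta> q h = \<theta> p h' \<and> q \<otimes>\<^bsub>P\<^esub> t = p \<otimes>\<^bsub>P\<^esub> t'"
    have "q \<otimes>\<^bsub>P\<^esub> t \<in> (p <#\<^bsub>P\<^esub> carrier P) \<inter> (q <#\<^bsub>P\<^esub> carrier P)"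
      using eq ht by (auto simp: l_coset_def) metis
    then obtain c where c: "c \<in> carrier P" "q \<otimes>\<^bsub>P\<^esub> t = (p \<otimes>\<^bsub>P\<^esub> p') \<otimes>\<^bsub>P\<^esub> c"
      unfolding lcm by (auto simp: l_coset_def)
    then have "q \<otimes>\<^bsub>P\<^esub> t = q \<otimes>\<^bsub>P\<^esub> (q' \<otimes>\<^bsub>P\<^esub> c)" "p \<otimes>\<^bsub>P\<^esub> t' = p \<otimes>\<^bsub>P\<^esub> (p' \<otimes>\<^bsub>P\<^esub> c)"
      using eq ht closed r by (simp_all add: P.m_assoc flip: mul)
    then have t: "t = q' \<otimes>\<^bsub>P\<^esub> c" "t' = p' \<otimes>\<^bsub>P\<^esub> c"
      using ht c closed by (simp_all add: P_left_cancel_iff)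
    have "\<theta> p k \<otimes>\<^bsub>G\<^esub> \<theta> q (inv\<^bsub>G\<^esub> l \<otimes>\<^bsub>G\<^esub> h) = \<theta> p h'"
      using eq g_act ht by simp
    moreover have "\<theta> q (inv\<^bsub>G\<^esub> l \<otimes>\<^bsub>G\<^esub> h) = inv\<^bsub>G\<^esub> \<theta> p k \<otimes>\<^bsub>G\<^esub> (\<theta> p k \<otimes>\<^bsub>G\<^esub> \<theta> q (inv\<^bsub>G\<^esub> l \<otimes>\<^bsub>G\<^esub> h))"
      using ht closed by (simp flip: G.m_assoc)
    ultimately have qp: "\<theta> q (inv\<^bsub>G\<^esub> l \<otimes>\<^bsub>G\<^esub> h) = \<theta> p (inv\<^bsub>G\<^esub> k \<otimes>\<^bsub>G\<^esub> h')"
      using ht closed by (simp add: action_G_mult action_G_inv)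
    moreover have "\<theta> q (inv\<^bsub>G\<^esub> l \<otimes>\<^bsub>G\<^esub> h) \<in> \<theta> q ` carrier G" "\<theta> p (inv\<^bsub>G\<^esub> k \<otimes>\<^bsub>G\<^esub> h') \<in> \<theta> p ` carrier G"
      using ht closed by simp_all
    ultimately have "\<theta> q (inv\<^bsub>G\<^esub> l \<otimes>\<^bsub>G\<^esub> h) \<in> \<theta> (p \<otimes>\<^bsub>P\<^esub> p') ` carrier G"
      using action_lcm[OF _ _ _ lcm] closed by auto
    then obtain m where m: "m \<in> carrier G" "\<theta> q (inv\<^bsub>G\<^esub> l \<otimes>\<^bsub>G\<^esub> h) = \<theta> p (\<theta> p' m)"
      using closed by (auto simp: action_mult)
    then have "\<theta> q (inv\<^bsub>G\<^esub> l \<otimes>\<^bsub>G\<^esub> h) = \<theta> q (\<theta> q' m)" "\<theta> p (inv\<^bsub>G\<^esub> k \<otimes>\<^bsub>G\<^esub> h') = \<theta> p (\<theta> p' m)"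
      using act qp by simp_all
    note eqs = this
    have "inv\<^bsub>G\<^esub> l \<otimes>\<^bsub>G\<^esub> h = \<theta> q' m"
      by (rule inj_onD[OF action_inj eqs(1)]) (simp_all add: ht m(1) closed)
    moreover have "inv\<^bsub>G\<^esub> k \<otimes>\<^bsub>G\<^esub> h' = \<theta> p' m"
      by (rule inj_onD[OF action_inj eqs(2)]) (simp_all add: ht m(1) closed)
    ultimately have "l \<otimes>\<^bsub>G\<^esub> (inv\<^bsub>G\<^esub> l \<otimes>\<^bsub>G\<^esub> h) = l \<otimes>\<^bsub>G\<^esub> \<theta> q' m"
      "k \<otimes>\<^bsub>G\<^esub> (inv\<^bsub>G\<^esub> k \<otimes>\<^bsub>G\<^esub> h') = k \<otimes>\<^bsub>G\<^esub> \<theta> p' m"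
      by simp_all
    then have "h = l \<otimes>\<^bsub>G\<^esub> \<theta> q' m" "h' = k \<otimes>\<^bsub>G\<^esub> \<theta> p' m"
      using ht closed by (simp_all flip: G.m_assoc)
    then show "\<exists>m\<in>carrier G. \<exists>c\<in>carrier P. h = l \<otimes>\<^bsub>G\<^esub> \<theta> q' m \<and> t = q' \<otimes>\<^bsub>P\<^esub> c \<and> h' = k \<otimes>\<^bsub>G\<^esub> \<theta> p' m \<and> t' = p' \<otimes>\<^bsub>P\<^esub> c"
      using t m(1) c(1) by blast
  next
    assume "\<exists>m\<in>carrier G. \<exists>c\<in>carrier P. h = l \<otimes>\<^bsub>G\<^esub> \<theta> q' m \<and> t = q' \<otimes>\<^bsub>P\<^esub> c \<and> h' = k \<otimes>\<^bsub>G\<^esub> \<theta> p' m \<and> t' = p' \<otimes>\<^bsub>P\<^esub> c"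
    then obtain m c where m: "m \<in> carrier G" "h = l \<otimes>\<^bsub>G\<^esub> \<theta> q' m" "h' = k \<otimes>\<^bsub>G\<^esub> \<theta> p' m"
      and c: "c \<in> carrier P" "t = q' \<otimes>\<^bsub>P\<^esub> c" "t' = p' \<otimes>\<^bsub>P\<^esub> c"
      by blast
    have "inv\<^bsub>G\<^esub> l \<otimes>\<^bsub>G\<^esub> h = \<theta> q' m"
      using m closed by (simp flip: G.m_assoc)
    then show "g \<otimes>\<^bsub>G\<^esub> \<theta> q h = \<theta> p h' \<and> q \<otimes>\<^bsub>P\<^esub> t = p \<otimes>\<^bsub>P\<^esub> t'"
      using m c ht closed g_act[of h] by (simp add: action_G_mult act mul)
  qed
  note pointwise = this
  have "((h, t), (h', t')) \<in> reg.word_rel (compress_word p g q) \<longleftrightarrow>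
      ((h, t), (h', t')) \<in> reg.word_rel (factored_word k p' q' l)"
    for h t h' t'
  proof (cases "h \<in> carrier G \<and> t \<in> carrier P \<and> h' \<in> carrier G \<and> t' \<in> carrier P")
    case True
    then show ?thesis
      unfolding word_rel_compress_iff word_rel_factored_iff using pointwise closed by simp
  next
    case False
    then show ?thesis
      using reg.word_rel_subset by blast
  qed
  then show ?thesis
    by (auto simp del: reg.word_rel_Cons)
qed

text \<open>
  A single pair of the relation already is a factorisation of \<open>g\<close> and makes \<open>pP \<inter> qP\<close> nonempty. In particular
  the word acts as zero if there is no factorisation.
\<close>
lemma word_rel_compress_factor:
  assumes "((h, t), (h', t')) \<in> reg.word_rel (compress_word p g q)"
  shows "\<exists>p' q' k l. ads_factor G P \<theta> p q g p' q' k l"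
proof -
  have closed: "p \<in> carrier P" "q \<in> carrier P" "g \<in> carrier G" "h \<in> carrier G" "t \<in> carrier P" "h' \<in> carrier G" "t' \<in> carrier P"
    and eq: "g \<otimes>\<^bsub>G\<^esub> \<theta> q h = \<theta> p h'" "q \<otimes>\<^bsub>P\<^esub> t = p \<otimes>\<^bsub>P\<^esub> t'"
    using assms unfolding word_rel_compress_iff by auto
  have "q \<otimes>\<^bsub>P\<^esub> t \<in> (p <#\<^bsub>P\<^esub> carrier P) \<inter> (q <#\<^bsub>P\<^esub> carrier P)"
    using eq closed by (auto simp: l_coset_def) metis
  then obtain r where r: "r \<in> carrier P" "(p <#\<^bsub>P\<^esub> carrier P) \<inter> (q <#\<^bsub>P\<^esub> carrier P) = r <#\<^bsub>P\<^esub> carrier P"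
    using P.right_lcm[of p q] closed by auto
  have "r \<in> (p <#\<^bsub>P\<^esub> carrier P) \<inter> (q <#\<^bsub>P\<^esub> carrier P)"
    unfolding r(2) using r(1) by (auto simp: l_coset_def intro!: bexI[of _ "\<one>\<^bsub>P\<^esub>"])
  then obtain p' q' where "p' \<in> carrier P" "q' \<in> carrier P" "r = p \<otimes>\<^bsub>P\<^esub> p'" "r = q \<otimes>\<^bsub>P\<^esub> q'"
    by (auto simp: l_coset_def)
  moreover have "g = \<theta> p h' \<otimes>\<^bsub>G\<^esub> \<theta> q (inv\<^bsub>G\<^esub> h)"
    using closed by (simp add: action_G_inv action_closed G.m_assoc flip: eq(1))
  ultimately have "ads_factor G P \<theta> p q g p' q' h' h"
    using closed r by (auto simp: ads_factor_def)
  then show ?thesis by blast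
qed

lemma word_simps:
  "fgen x = Poly_Mapping.single (Word [(x, False)]) 1"
  "fadj (Poly_Mapping.single w 1) = Poly_Mapping.single (word_adj w) 1"
  "Poly_Mapping.single v 1 * Poly_Mapping.single w (1 :: complex) = Poly_Mapping.single (v + w) 1"
  "word_adj (Word ls) = Word (rev (map (\<lambda>(x, b). (x, \<not> b)) ls))"
  "Word ls + Word ls' = Word (ls @ ls')"
  by (simp_all add: fgen_def fadj_single mult_single word_adj_def plus_star_word_def)

lemma op_seminorm_relator: "a \<in> ads_relators G P \<theta> \<Longrightarrow> reg.op_seminorm a = 0"
proof (induction rule: ads_relators.induct)
  case (unitary_left g)
  have "reg.word_rel (Word [(GenU g, True), (GenU g, False)]) = reg.word_rel (Word [])"
    using unitary_left by (auto simp: reg_rel_def relcomp_unfold Id_on_iff)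
  then show ?case
    by (simp add: word_simps one_eq_word reg.op_seminorm_word_diff_eq_0_iff del: reg.word_rel_Cons)
next
  case (unitary_right g)
  have "h = g \<otimes>\<^bsub>G\<^esub> (inv\<^bsub>G\<^esub> g \<otimes>\<^bsub>G\<^esub> h)" "inv\<^bsub>G\<^esub> g \<otimes>\<^bsub>G\<^esub> h \<in> carrier G" if "h \<in> carrier G" for h
    using unitary_right that by (simp_all flip: G.m_assoc)
  then have "reg.word_rel (Word [(GenU g, False), (GenU g, True)]) = reg.word_rel (Word [])"
    using unitary_right by (auto simp: reg_rel_def relcomp_unfold Id_on_iff)
  then show ?case
    by (simp add: word_simps one_eq_word reg.op_seminorm_word_diff_eq_0_iff del: reg.word_rel_Cons)
next
  case (u_mult g h)
  have "reg.word_rel (Word [(GenU (g \<otimes>\<^bsub>G\<^esub> h), False)]) = reg.word_rel (Word [(GenU g, False), (GenU h, False)])"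
    using u_mult by (auto simp: reg_rel_def relcomp_unfold Id_on_iff G.m_assoc)
  then show ?case
    by (simp add: word_simps reg.op_seminorm_word_diff_eq_0_iff del: reg.word_rel_Cons)
next
  case (isometry p)
  have "reg.word_rel (Word [(GenS p, True), (GenS p, False)]) = reg.word_rel (Word [])"
    using isometry by (auto simp: reg_rel_def relcomp_unfold Id_on_iff action_eq_iff P_left_cancel_iff)
  then show ?case
    by (simp add: word_simps one_eq_word reg.op_seminorm_word_diff_eq_0_iff del: reg.word_rel_Cons)
next
  case s_one
  have "reg.word_rel (Word [(GenS \<one>\<^bsub>P\<^esub>, False)]) = reg.word_rel (Word [])"
    by (auto simp: reg_rel_def relcomp_unfold Id_on_iff action_one)
  then show ?case
    by (simp add: word_simps one_eq_word reg.op_seminorm_word_diff_eq_0_iff del: reg.word_rel_Cons)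
next
  case (s_mult p q)
  have "reg.word_rel (Word [(GenS (p \<otimes>\<^bsub>P\<^esub> q), False)]) = reg.word_rel (Word [(GenS p, False), (GenS q, False)])"
    using s_mult by (auto simp: reg_rel_def relcomp_unfold Id_on_iff action_mult action_closed P.m_assoc)
  then show ?case
    by (simp add: word_simps reg.op_seminorm_word_diff_eq_0_iff del: reg.word_rel_Cons)
next
  case (covariance p g)
  have "reg.word_rel (Word [(GenS p, False), (GenU g, False)]) = reg.word_rel (Word [(GenU (\<theta> p g), False), (GenS p, False)])"
    using covariance by (auto simp: reg_rel_def relcomp_unfold Id_on_iff action_G_mult action_closed)
  then show ?case
    by (simp add: word_simps reg.op_seminorm_word_diff_eq_0_iff del: reg.word_rel_Cons)
next
  case (compress p q g p' q' k l)
  then show ?case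
    using word_rel_compress_eq_factored[OF compress]
    by (simp add: word_simps reg.op_seminorm_word_diff_eq_0_iff del: reg.word_rel_Cons)
next
  case (compress_zero p q g)
  have False if "((h, t), (h', t')) \<in> reg.word_rel (compress_word p g q)" for h t h' t'
    using word_rel_compress_factor[OF that] compress_zero by blast
  then have "reg.word_rel (compress_word p g q) = {}"
    by (auto simp del: reg.word_rel_Cons)
  then show ?case
    by (simp add: word_simps reg.op_seminorm_word_eq_0_iff del: reg.word_rel_Cons)
qed

lemma op_seminorm_rel_seminorm: "reg.op_seminorm \<in> rel_seminorms (ads_gens G P) (ads_relators G P \<theta>)"
  by (simp add: rel_seminorms_def reg.cstar_seminorm_op_seminorm op_seminorm_relator)

text \<open>
  The universal norm dominates the seminorm of the regular representation, which therefore cannot see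
  more than the universal algebra.
\<close>
lemma op_seminorm_eq_0:
  assumes a: "a \<in> free_alg (ads_gens G P)"
    and zero: "univ_elem (ads_gens G P) (ads_relators G P \<theta>) a = \<zero>\<^bsub>ads_cstar G P \<theta>\<^esub>"
  shows "reg.op_seminorm a = 0"
proof -
  interpret A: cstar_algebra "ads_cstar G P \<theta>"
    unfolding ads_cstar_def by (rule cstar_algebra_univ_cstar[OF ads_bounded])
  interpret cstar_seminorm "ads_gens G P" reg.op_seminorm
    by (rule reg.cstar_seminorm_op_seminorm)
  have "univ_norm (ads_gens G P) (ads_relators G P \<theta>) a = cnorm (ads_cstar G P \<theta>) \<zero>\<^bsub>ads_cstar G P \<theta>\<^esub>"
    using univ_elem_norm[OF ads_bounded a] zero by (simp add: ads_cstar_def)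
  then have "reg.op_seminorm a \<le> 0"
    using univ_norm_upper[OF ads_bounded a op_seminorm_rel_seminorm] by simp
  then show ?thesis
    using rho_nonneg[OF a] by simp
qed

lemma word_rel_empty:
  assumes "fst ` set (letters w) \<subseteq> ads_gens G P"
    and "univ_elem (ads_gens G P) (ads_relators G P \<theta>) (Poly_Mapping.single w 1) = \<zero>\<^bsub>ads_cstar G P \<theta>\<^esub>"
  shows "reg.word_rel w = {}"
  using op_seminorm_eq_0[OF free_alg_single assms(2)] assms(1)
  by (simp add: reg.op_seminorm_word_eq_0_iff)

lemma word_rel_cong:
  assumes vw: "fst ` set (letters v) \<subseteq> ads_gens G P" "fst ` set (letters w) \<subseteq> ads_gens G P"
    and eq: "univ_elem (ads_gens G P) (ads_relators G P \<theta>) (Poly_Mapping.single v 1) =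
      univ_elem (ads_gens G P) (ads_relators G P \<theta>) (Poly_Mapping.single w 1)"
  shows "reg.word_rel v = reg.word_rel w"
proof -
  let ?v = "Poly_Mapping.single v 1 :: ('g, 'p) ads_gen free_star"
  let ?w = "Poly_Mapping.single w 1 :: ('g, 'p) ads_gen free_star"
  let ?e = "univ_elem (ads_gens G P) (ads_relators G P \<theta>)"
  interpret A: cstar_algebra "ads_cstar G P \<theta>"
    unfolding ads_cstar_def by (rule cstar_algebra_univ_cstar[OF ads_bounded])
  have F: "?v \<in> free_alg (ads_gens G P)" "?w \<in> free_alg (ads_gens G P)"
    using vw by (simp_all add: free_alg_single)
  have "?e ?v \<in> carrier (ads_cstar G P \<theta>)"
    using univ_elem_closed[OF ads_bounded F(1)] by (simp add: ads_cstar_def)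
  then have "?e (?v - ?w) = \<zero>\<^bsub>ads_cstar G P \<theta>\<^esub>"
    using univ_elem_binary(3)[OF ads_bounded F] eq by (simp add: ads_cstar_def[symmetric] a_minus_def A.r_neg)
  then show ?thesis
    using op_seminorm_eq_0[of "?v - ?w"] F by (simp add: reg.op_seminorm_word_diff_eq_0_iff)
qed

lemma word_elem:
  assumes "p \<in> carrier P" "q \<in> carrier P" "g \<in> carrier G" "h \<in> carrier G"
  shows "adj (ads_cstar G P \<theta>) (ads_s G P \<theta> p) \<otimes>\<^bsub>ads_cstar G P \<theta>\<^esub> ads_u G P \<theta> g \<otimes>\<^bsub>ads_cstar G P \<theta>\<^esub> ads_s G P \<theta> q =
      univ_elem (ads_gens G P) (ads_relators G P \<theta>)
        (Poly_Mapping.single (compress_word p g q) 1)" (is ?compress)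
    and "ads_u G P \<theta> g \<otimes>\<^bsub>ads_cstar G P \<theta>\<^esub> ads_s G P \<theta> p \<otimes>\<^bsub>ads_cstar G P \<theta>\<^esub>
        adj (ads_cstar G P \<theta>) (ads_s G P \<theta> q) \<otimes>\<^bsub>ads_cstar G P \<theta>\<^esub> adj (ads_cstar G P \<theta>) (ads_u G P \<theta> h) =
      univ_elem (ads_gens G P) (ads_relators G P \<theta>)
        (Poly_Mapping.single (factored_word g p q h) 1)" (is ?factored)
proof -
  note F = assms fu_free fs_free ads_u_def ads_s_def ads_elem_hom(2-3)[symmetric]
  have "fadj (gen_s p) * gen_u g * gen_s q =
      Poly_Mapping.single (compress_word p g q) 1"
    "gen_u g * gen_s p * fadj (gen_s q) * fadj (gen_u h) =
      Poly_Mapping.single (factored_word g p q h) 1"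
    by (simp_all add: word_simps)
  then show ?compress ?factored
    by (simp_all add: F)
qed

lemma ads_compress_nonzero:
  assumes "p \<in> carrier P" "q \<in> carrier P" "g \<in> carrier G"
    and "h \<in> carrier G" "t \<in> carrier P" "h' \<in> carrier G" "t' \<in> carrier P"
    and "g \<otimes>\<^bsub>G\<^esub> \<theta> q h = \<theta> p h'" "q \<otimes>\<^bsub>P\<^esub> t = p \<otimes>\<^bsub>P\<^esub> t'"
  shows "adj (ads_cstar G P \<theta>) (ads_s G P \<theta> p) \<otimes>\<^bsub>ads_cstar G P \<theta>\<^esub> ads_u G P \<theta> g \<otimes>\<^bsub>ads_cstar G P \<theta>\<^esub> ads_s G P \<theta> q
    \<noteq> \<zero>\<^bsub>ads_cstar G P \<theta>\<^esub>"
proof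
  assume "adj (ads_cstar G P \<theta>) (ads_s G P \<theta> p) \<otimes>\<^bsub>ads_cstar G P \<theta>\<^esub> ads_u G P \<theta> g \<otimes>\<^bsub>ads_cstar G P \<theta>\<^esub> ads_s G P \<theta> q
    = \<zero>\<^bsub>ads_cstar G P \<theta>\<^esub>"
  then have "reg.word_rel (compress_word p g q) = {}"
    using assms by (intro word_rel_empty) (auto simp: ads_gens_def word_elem)
  moreover have "((h, t), (h', t')) \<in> reg.word_rel (compress_word p g q)"
    unfolding word_rel_compress_iff using assms by blast
  ultimately show False by blast
qed

text \<open>The first letter to act on \<open>(h, t)\<close> that changes \<open>t\<close> in the normal form is \<open>s\<^sub>q\<^sub>'\<^sup>*\<close>, which cancels \<open>q'\<close>.\<close>
lemma ads_compress_eq_factoredD: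
  assumes "p \<in> carrier P" "q \<in> carrier P" "g \<in> carrier G"
    and fac: "p' \<in> carrier P" "q' \<in> carrier P" "k \<in> carrier G" "l \<in> carrier G"
    and "h \<in> carrier G" "t \<in> carrier P" "h' \<in> carrier G" "t' \<in> carrier P"
    and "g \<otimes>\<^bsub>G\<^esub> \<theta> q h = \<theta> p h'" "q \<otimes>\<^bsub>P\<^esub> t = p \<otimes>\<^bsub>P\<^esub> t'"
    and eq: "adj (ads_cstar G P \<theta>) (ads_s G P \<theta> p) \<otimes>\<^bsub>ads_cstar G P \<theta>\<^esub> ads_u G P \<theta> g \<otimes>\<^bsub>ads_cstar G P \<theta>\<^esub> ads_s G P \<theta> q =
      ads_u G P \<theta> k \<otimes>\<^bsub>ads_cstar G P \<theta>\<^esub> ads_s G P \<theta> p' \<otimes>\<^bsub>ads_cstar G P \<theta>\<^esub>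
        adj (ads_cstar G P \<theta>) (ads_s G P \<theta> q') \<otimes>\<^bsub>ads_cstar G P \<theta>\<^esub> adj (ads_cstar G P \<theta>) (ads_u G P \<theta> l)"
  shows "t \<in> q' <#\<^bsub>P\<^esub> carrier P"
proof -
  have "reg.word_rel (compress_word p g q) = reg.word_rel (factored_word k p' q' l)"
    using assms by (intro word_rel_cong) (auto simp: ads_gens_def word_elem)
  moreover have "((h, t), (h', t')) \<in> reg.word_rel (compress_word p g q)"
    unfolding word_rel_compress_iff using assms by blast
  ultimately have "((h, t), (h', t')) \<in> reg.word_rel (factored_word k p' q' l)"
    by simp
  then show ?thesis
    unfolding word_rel_factored_iff by (auto simp: l_coset_def)
qed

end

section \<open>Induced *-homomorphisms\<close>

lemma star_homD:
  assumes "f \<in> star_hom A B" "x \<in> carrier A"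
  shows "y \<in> carrier A \<Longrightarrow> f (x \<otimes>\<^bsub>A\<^esub> y) = f x \<otimes>\<^bsub>B\<^esub> f y" "f (adj A x) = adj B (f x)"
  using assms by (auto simp: star_hom_def)

lemma star_hom_zero:
  assumes "cstar_algebra A" "cstar_algebra B" "f \<in> star_hom A B" shows "f \<zero>\<^bsub>A\<^esub> = \<zero>\<^bsub>B\<^esub>"
proof -
  interpret A: cstar_algebra A by fact
  interpret B: cstar_algebra B by fact
  have "f (0 \<odot>\<^bsub>A\<^esub> \<zero>\<^bsub>A\<^esub>) = 0 \<odot>\<^bsub>B\<^esub> f \<zero>\<^bsub>A\<^esub>" "f \<zero>\<^bsub>A\<^esub> \<in> carrier B"
    using assms(3) A.zero_closed unfolding star_hom_def by blast+
  then show ?thesis by simp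
qed

locale ads_system_morphism =
  S1: algebraic_dynamical_system G\<^sub>1 P\<^sub>1 \<theta>\<^sub>1 + S2: algebraic_dynamical_system G\<^sub>2 P\<^sub>2 \<theta>\<^sub>2
  for G\<^sub>1 :: "('g1, 'a) monoid_scheme" and P\<^sub>1 :: "('p1, 'b) monoid_scheme" and \<theta>\<^sub>1
    and G\<^sub>2 :: "('g2, 'c) monoid_scheme" and P\<^sub>2 :: "('p2, 'd) monoid_scheme" and \<theta>\<^sub>2 +
  fixes \<phi>\<^sub>G :: "'g1 \<Rightarrow> 'g2" and \<phi>\<^sub>P :: "'p1 \<Rightarrow> 'p2"
  assumes morphism: "ads_morphism G\<^sub>1 P\<^sub>1 \<theta>\<^sub>1 G\<^sub>2 P\<^sub>2 \<theta>\<^sub>2 \<phi>\<^sub>G \<phi>\<^sub>P"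
begin

lemma hom_G: "\<phi>\<^sub>G \<in> hom G\<^sub>1 G\<^sub>2" and hom_P: "\<phi>\<^sub>P \<in> hom P\<^sub>1 P\<^sub>2" and hom_P_one: "\<phi>\<^sub>P \<one>\<^bsub>P\<^sub>1\<^esub> = \<one>\<^bsub>P\<^sub>2\<^esub>"
  using morphism by (auto simp: ads_morphism_def)

lemma act: "p \<in> carrier P\<^sub>1 \<Longrightarrow> g \<in> carrier G\<^sub>1 \<Longrightarrow> \<phi>\<^sub>G (\<theta>\<^sub>1 p g) = \<theta>\<^sub>2 (\<phi>\<^sub>P p) (\<phi>\<^sub>G g)"
  using morphism by (auto simp: ads_morphism_def)

lemmas homs = hom_in_carrier[OF hom_P] hom_mult[OF hom_P]

sublocale \<phi>: group_hom G\<^sub>1 G\<^sub>2 \<phi>\<^sub>G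
  by unfold_locales (rule hom_G)

lemma factor_image:
  assumes adm: "ads_admissible G\<^sub>1 P\<^sub>1 \<theta>\<^sub>1 G\<^sub>2 P\<^sub>2 \<theta>\<^sub>2 \<phi>\<^sub>G \<phi>\<^sub>P"
    and pqg: "p \<in> carrier P\<^sub>1" "q \<in> carrier P\<^sub>1" "g \<in> carrier G\<^sub>1"
    and fac: "ads_factor G\<^sub>1 P\<^sub>1 \<theta>\<^sub>1 p q g p' q' k l"
  shows "ads_factor G\<^sub>2 P\<^sub>2 \<theta>\<^sub>2 (\<phi>\<^sub>P p) (\<phi>\<^sub>P q) (\<phi>\<^sub>G g) (\<phi>\<^sub>P p') (\<phi>\<^sub>P q') (\<phi>\<^sub>G k) (\<phi>\<^sub>G l)"
proof -
  have cl: "p' \<in> carrier P\<^sub>1" "q' \<in> carrier P\<^sub>1" "k \<in> carrier G\<^sub>1" "l \<in> carrier G\<^sub>1"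
    and r: "p \<otimes>\<^bsub>P\<^sub>1\<^esub> p' = q \<otimes>\<^bsub>P\<^sub>1\<^esub> q'"
    and lcm: "(p <#\<^bsub>P\<^sub>1\<^esub> carrier P\<^sub>1) \<inter> (q <#\<^bsub>P\<^sub>1\<^esub> carrier P\<^sub>1) = (p \<otimes>\<^bsub>P\<^sub>1\<^esub> p') <#\<^bsub>P\<^sub>1\<^esub> carrier P\<^sub>1"
    and g: "g = \<theta>\<^sub>1 p k \<otimes>\<^bsub>G\<^sub>1\<^esub> \<theta>\<^sub>1 q (inv\<^bsub>G\<^sub>1\<^esub> l)"
    using fac by (auto simp: ads_factor_def)
  have "(\<phi>\<^sub>P p <#\<^bsub>P\<^sub>2\<^esub> carrier P\<^sub>2) \<inter> (\<phi>\<^sub>P q <#\<^bsub>P\<^sub>2\<^esub> carrier P\<^sub>2) = \<phi>\<^sub>P ` ((p \<otimes>\<^bsub>P\<^sub>1\<^esub> p') <#\<^bsub>P\<^sub>1\<^esub> carrier P\<^sub>1) <#>\<^bsub>P\<^sub>2\<^esub> carrier P\<^sub>2"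
    using adm pqg by (simp add: ads_admissible_def lcm)
  also have "\<dots> = \<phi>\<^sub>P (p \<otimes>\<^bsub>P\<^sub>1\<^esub> p') <#\<^bsub>P\<^sub>2\<^esub> carrier P\<^sub>2"
  proof
    show "\<phi>\<^sub>P ` ((p \<otimes>\<^bsub>P\<^sub>1\<^esub> p') <#\<^bsub>P\<^sub>1\<^esub> carrier P\<^sub>1) <#>\<^bsub>P\<^sub>2\<^esub> carrier P\<^sub>2 \<subseteq> \<phi>\<^sub>P (p \<otimes>\<^bsub>P\<^sub>1\<^esub> p') <#\<^bsub>P\<^sub>2\<^esub> carrier P\<^sub>2"
      using pqg cl by (auto simp: l_coset_def set_mult_def homs S1.P.m_closed S2.P.m_assoc)
        (blast intro: S2.P.m_closed homs(1))
    have "p \<otimes>\<^bsub>P\<^sub>1\<^esub> p' \<in> (p \<otimes>\<^bsub>P\<^sub>1\<^esub> p') <#\<^bsub>P\<^sub>1\<^esub> carrier P\<^sub>1"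
      using pqg cl by (auto simp: l_coset_def intro!: bexI[of _ "\<one>\<^bsub>P\<^sub>1\<^esub>"])
    then show "\<phi>\<^sub>P (p \<otimes>\<^bsub>P\<^sub>1\<^esub> p') <#\<^bsub>P\<^sub>2\<^esub> carrier P\<^sub>2 \<subseteq> \<phi>\<^sub>P ` ((p \<otimes>\<^bsub>P\<^sub>1\<^esub> p') <#\<^bsub>P\<^sub>1\<^esub> carrier P\<^sub>1) <#>\<^bsub>P\<^sub>2\<^esub> carrier P\<^sub>2"
      unfolding l_coset_def set_mult_def by blast
  qed
  finally have "(\<phi>\<^sub>P p <#\<^bsub>P\<^sub>2\<^esub> carrier P\<^sub>2) \<inter> (\<phi>\<^sub>P q <#\<^bsub>P\<^sub>2\<^esub> carrier P\<^sub>2) = (\<phi>\<^sub>P p \<otimes>\<^bsub>P\<^sub>2\<^esub> \<phi>\<^sub>P p') <#\<^bsub>P\<^sub>2\<^esub> carrier P\<^sub>2"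
    using pqg cl by (simp add: homs)
  moreover have "\<phi>\<^sub>P p \<otimes>\<^bsub>P\<^sub>2\<^esub> \<phi>\<^sub>P p' = \<phi>\<^sub>P q \<otimes>\<^bsub>P\<^sub>2\<^esub> \<phi>\<^sub>P q'"
    using r pqg cl by (metis hom_mult[OF hom_P])
  moreover have "\<phi>\<^sub>G g = \<theta>\<^sub>2 (\<phi>\<^sub>P p) (\<phi>\<^sub>G k) \<otimes>\<^bsub>G\<^sub>2\<^esub> \<theta>\<^sub>2 (\<phi>\<^sub>P q) (inv\<^bsub>G\<^sub>2\<^esub> \<phi>\<^sub>G l)"
    using pqg cl by (simp add: g act S1.action_closed)
  ultimately show ?thesis
    using cl by (simp add: ads_factor_def homs)
qed

text \<open>
  By the ideal condition, \<open>p\<close> and \<open>q\<close> have a common right multiple if \<open>\<phi>\<^sub>P p\<close> and \<open>\<phi>\<^sub>P q\<close> have one. This is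
  the premise of the product condition, which then brings the factorisation of \<open>\<phi>\<^sub>G g\<close> back to \<open>g\<close>.
\<close>
lemma factor_reflect:
  assumes adm: "ads_admissible G\<^sub>1 P\<^sub>1 \<theta>\<^sub>1 G\<^sub>2 P\<^sub>2 \<theta>\<^sub>2 \<phi>\<^sub>G \<phi>\<^sub>P"
    and pqg: "p \<in> carrier P\<^sub>1" "q \<in> carrier P\<^sub>1" "g \<in> carrier G\<^sub>1"
    and fac: "ads_factor G\<^sub>2 P\<^sub>2 \<theta>\<^sub>2 (\<phi>\<^sub>P p) (\<phi>\<^sub>P q) (\<phi>\<^sub>G g) p'' q'' k'' l''"
  shows "\<exists>p' q' k l. ads_factor G\<^sub>1 P\<^sub>1 \<theta>\<^sub>1 p q g p' q' k l"
proof -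
  have cl: "p'' \<in> carrier P\<^sub>2" "k'' \<in> carrier G\<^sub>2" "l'' \<in> carrier G\<^sub>2"
    and lcm: "(\<phi>\<^sub>P p <#\<^bsub>P\<^sub>2\<^esub> carrier P\<^sub>2) \<inter> (\<phi>\<^sub>P q <#\<^bsub>P\<^sub>2\<^esub> carrier P\<^sub>2) = (\<phi>\<^sub>P p \<otimes>\<^bsub>P\<^sub>2\<^esub> p'') <#\<^bsub>P\<^sub>2\<^esub> carrier P\<^sub>2"
    and g: "\<phi>\<^sub>G g = \<theta>\<^sub>2 (\<phi>\<^sub>P p) k'' \<otimes>\<^bsub>G\<^sub>2\<^esub> \<theta>\<^sub>2 (\<phi>\<^sub>P q) (inv\<^bsub>G\<^sub>2\<^esub> l'')"
    using fac by (auto simp: ads_factor_def)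
  have "\<phi>\<^sub>P ` ((p <#\<^bsub>P\<^sub>1\<^esub> carrier P\<^sub>1) \<inter> (q <#\<^bsub>P\<^sub>1\<^esub> carrier P\<^sub>1)) <#>\<^bsub>P\<^sub>2\<^esub> carrier P\<^sub>2 = (\<phi>\<^sub>P p \<otimes>\<^bsub>P\<^sub>2\<^esub> p'') <#\<^bsub>P\<^sub>2\<^esub> carrier P\<^sub>2"
    using adm pqg lcm by (simp add: ads_admissible_def)
  moreover have "(\<phi>\<^sub>P p \<otimes>\<^bsub>P\<^sub>2\<^esub> p'') <#\<^bsub>P\<^sub>2\<^esub> carrier P\<^sub>2 \<noteq> {}"
    by (auto simp: l_coset_def)
  ultimately obtain r where r: "r \<in> (p <#\<^bsub>P\<^sub>1\<^esub> carrier P\<^sub>1) \<inter> (q <#\<^bsub>P\<^sub>1\<^esub> carrier P\<^sub>1)"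
    by (auto simp: set_mult_def)
  have "\<phi>\<^sub>G g \<in> \<theta>\<^sub>2 (\<phi>\<^sub>P p) ` carrier G\<^sub>2 <#>\<^bsub>G\<^sub>2\<^esub> \<theta>\<^sub>2 (\<phi>\<^sub>P q) ` carrier G\<^sub>2"
    using cl g by (auto simp: set_mult_def)
  then have "g \<in> {g \<in> carrier G\<^sub>1. \<phi>\<^sub>G g \<in> \<phi>\<^sub>G ` carrier G\<^sub>1 \<inter>
      (\<theta>\<^sub>2 (\<phi>\<^sub>P p) ` carrier G\<^sub>2 <#>\<^bsub>G\<^sub>2\<^esub> \<theta>\<^sub>2 (\<phi>\<^sub>P q) ` carrier G\<^sub>2)}"
    using pqg by auto
  then have "g \<in> \<theta>\<^sub>1 p ` carrier G\<^sub>1 <#>\<^bsub>G\<^sub>1\<^esub> \<theta>\<^sub>1 q ` carrier G\<^sub>1"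
    using adm pqg r unfolding ads_admissible_def by blast
  then obtain h' h where h: "h' \<in> carrier G\<^sub>1" "h \<in> carrier G\<^sub>1" "g = \<theta>\<^sub>1 p h' \<otimes>\<^bsub>G\<^sub>1\<^esub> \<theta>\<^sub>1 q h"
    by (auto simp: set_mult_def)
  obtain t t' where t: "t \<in> carrier P\<^sub>1" "t' \<in> carrier P\<^sub>1" "q \<otimes>\<^bsub>P\<^sub>1\<^esub> t = p \<otimes>\<^bsub>P\<^sub>1\<^esub> t'"
    using r by (auto simp: l_coset_def)
  (* The data for p, q and g say that this word of the first system is defined somewhere. *)
  have "((inv\<^bsub>G\<^sub>1\<^esub> h, t), (h', t')) \<in> S1.reg.word_rel (compress_word p g q)"
    unfolding S1.word_rel_compress_iff
    using pqg h t by (simp add: S1.action_closed S1.action_G_inv S1.G.m_assoc)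
  then show ?thesis
    by (rule S1.word_rel_compress_factor)
qed

lemma admissible_imp_induced:
  assumes adm: "ads_admissible G\<^sub>1 P\<^sub>1 \<theta>\<^sub>1 G\<^sub>2 P\<^sub>2 \<theta>\<^sub>2 \<phi>\<^sub>G \<phi>\<^sub>P"
  shows "\<exists>f\<in>star_hom (ads_cstar G\<^sub>1 P\<^sub>1 \<theta>\<^sub>1) (ads_cstar G\<^sub>2 P\<^sub>2 \<theta>\<^sub>2).
      (\<forall>g\<in>carrier G\<^sub>1. f (ads_u G\<^sub>1 P\<^sub>1 \<theta>\<^sub>1 g) = ads_u G\<^sub>2 P\<^sub>2 \<theta>\<^sub>2 (\<phi>\<^sub>G g)) \<and>
      (\<forall>p\<in>carrier P\<^sub>1. f (ads_s G\<^sub>1 P\<^sub>1 \<theta>\<^sub>1 p) = ads_s G\<^sub>2 P\<^sub>2 \<theta>\<^sub>2 (\<phi>\<^sub>P p))"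
proof -
  interpret R2: ads_representation G\<^sub>2 P\<^sub>2 \<theta>\<^sub>2 "ads_cstar G\<^sub>2 P\<^sub>2 \<theta>\<^sub>2" "ads_u G\<^sub>2 P\<^sub>2 \<theta>\<^sub>2" "ads_s G\<^sub>2 P\<^sub>2 \<theta>\<^sub>2"
    by (rule S2.ads_cstar_representation)
  note closed = hom_in_carrier[OF hom_G] hom_in_carrier[OF hom_P]
  interpret R: ads_representation G\<^sub>1 P\<^sub>1 \<theta>\<^sub>1 "ads_cstar G\<^sub>2 P\<^sub>2 \<theta>\<^sub>2"
    "\<lambda>g. ads_u G\<^sub>2 P\<^sub>2 \<theta>\<^sub>2 (\<phi>\<^sub>G g)" "\<lambda>p. ads_s G\<^sub>2 P\<^sub>2 \<theta>\<^sub>2 (\<phi>\<^sub>P p)"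
    (* Only the two relations for compressed products, 10 and 11, depend on admissibility. *)
  proof (unfold_locales, goal_cases)
    case (10 p q g p' q' k l)
    then show ?case
      by (intro R2.compress factor_image[OF adm]) (simp_all add: closed)
  next
    case (11 p q g)
    then have "\<nexists>p' q' k l. ads_factor G\<^sub>2 P\<^sub>2 \<theta>\<^sub>2 (\<phi>\<^sub>P p) (\<phi>\<^sub>P q) (\<phi>\<^sub>G g) p' q' k l"
      using factor_reflect[OF adm] by blast
    with 11 show ?case
      by (intro R2.compress_zero) (simp_all add: closed)
  qed (simp_all add: closed hom_P_one act R2.u_closed R2.s_closed R2.u_unitary R2.u_mult R2.s_isometry R2.s_one R2.s_mult
      R2.covariance hom_mult[OF hom_G] hom_mult[OF hom_P])
  show ?thesis
    using R.ads_cstar_universal by blast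
qed

text \<open>
  The homomorphism sends \<open>s\<^sub>p\<^sup>* u\<^sub>g s\<^sub>q\<close> to the corresponding word of the second system. The latter is not zero
  as soon as its relation has one pair, so neither is the former, and a factorisation exists by the
  relations of the first algebra (fact \<open>factor\<close>). This gives the product condition. The ideal condition
  needs more than some element of \<open>pP \<inter> qP\<close>: the normal forms are compared as well.
\<close>
lemma induced_imp_admissible:
  assumes f: "f \<in> star_hom (ads_cstar G\<^sub>1 P\<^sub>1 \<theta>\<^sub>1) (ads_cstar G\<^sub>2 P\<^sub>2 \<theta>\<^sub>2)"
    and fu: "\<And>g. g \<in> carrier G\<^sub>1 \<Longrightarrow> f (ads_u G\<^sub>1 P\<^sub>1 \<theta>\<^sub>1 g) = ads_u G\<^sub>2 P\<^sub>2 \<theta>\<^sub>2 (\<phi>\<^sub>G g)"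
    and fs: "\<And>p. p \<in> carrier P\<^sub>1 \<Longrightarrow> f (ads_s G\<^sub>1 P\<^sub>1 \<theta>\<^sub>1 p) = ads_s G\<^sub>2 P\<^sub>2 \<theta>\<^sub>2 (\<phi>\<^sub>P p)"
  shows "ads_admissible G\<^sub>1 P\<^sub>1 \<theta>\<^sub>1 G\<^sub>2 P\<^sub>2 \<theta>\<^sub>2 \<phi>\<^sub>G \<phi>\<^sub>P"
proof -
  let ?A = "ads_cstar G\<^sub>1 P\<^sub>1 \<theta>\<^sub>1" and ?u = "ads_u G\<^sub>1 P\<^sub>1 \<theta>\<^sub>1" and ?s = "ads_s G\<^sub>1 P\<^sub>1 \<theta>\<^sub>1"
  let ?B = "ads_cstar G\<^sub>2 P\<^sub>2 \<theta>\<^sub>2" and ?v = "ads_u G\<^sub>2 P\<^sub>2 \<theta>\<^sub>2" and ?t = "ads_s G\<^sub>2 P\<^sub>2 \<theta>\<^sub>2"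
  interpret R1: ads_representation G\<^sub>1 P\<^sub>1 \<theta>\<^sub>1 ?A ?u ?s
    by (rule S1.ads_cstar_representation)
  interpret R2: ads_representation G\<^sub>2 P\<^sub>2 \<theta>\<^sub>2 ?B ?v ?t
    by (rule S2.ads_cstar_representation)
  note f_hom = star_homD[OF f] fu fs R1.u_closed R1.s_closed
  have f_compress: "f (adj ?A (?s p) \<otimes>\<^bsub>?A\<^esub> ?u g \<otimes>\<^bsub>?A\<^esub> ?s q) = adj ?B (?t (\<phi>\<^sub>P p)) \<otimes>\<^bsub>?B\<^esub> ?v (\<phi>\<^sub>G g) \<otimes>\<^bsub>?B\<^esub> ?t (\<phi>\<^sub>P q)"
    if "p \<in> carrier P\<^sub>1" "q \<in> carrier P\<^sub>1" "g \<in> carrier G\<^sub>1" for p q g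
    using that by (simp add: f_hom)
  have factor: "\<exists>p' q' k l. ads_factor G\<^sub>1 P\<^sub>1 \<theta>\<^sub>1 p q g p' q' k l"
    if pqg: "p \<in> carrier P\<^sub>1" "q \<in> carrier P\<^sub>1" "g \<in> carrier G\<^sub>1"
      and ht: "h \<in> carrier G\<^sub>2" "t \<in> carrier P\<^sub>2" "h' \<in> carrier G\<^sub>2" "t' \<in> carrier P\<^sub>2"
        "\<phi>\<^sub>G g \<otimes>\<^bsub>G\<^sub>2\<^esub> \<theta>\<^sub>2 (\<phi>\<^sub>P q) h = \<theta>\<^sub>2 (\<phi>\<^sub>P p) h'" "\<phi>\<^sub>P q \<otimes>\<^bsub>P\<^sub>2\<^esub> t = \<phi>\<^sub>P p \<otimes>\<^bsub>P\<^sub>2\<^esub> t'"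
    for p q g h t h' t'
  proof (rule ccontr)
    assume "\<nexists>p' q' k l. ads_factor G\<^sub>1 P\<^sub>1 \<theta>\<^sub>1 p q g p' q' k l"
    then have "f (adj ?A (?s p) \<otimes>\<^bsub>?A\<^esub> ?u g \<otimes>\<^bsub>?A\<^esub> ?s q) = \<zero>\<^bsub>?B\<^esub>"
      using pqg R1.compress_zero star_hom_zero[OF _ _ f] R1.B.cstar_algebra_axioms R2.B.cstar_algebra_axioms by simp
    then show False
      using S2.ads_compress_nonzero[OF _ _ _ ht] pqg by (simp add: f_compress homs)
  qed
  show ?thesis
    unfolding ads_admissible_def
  proof (intro conjI ballI impI)
    fix p q assume pq: "p \<in> carrier P\<^sub>1" "q \<in> carrier P\<^sub>1"
    show "(\<phi>\<^sub>P p <#\<^bsub>P\<^sub>2\<^esub> carrier P\<^sub>2) \<inter> (\<phi>\<^sub>P q <#\<^bsub>P\<^sub>2\<^esub> carrier P\<^sub>2) =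
        \<phi>\<^sub>P ` ((p <#\<^bsub>P\<^sub>1\<^esub> carrier P\<^sub>1) \<inter> (q <#\<^bsub>P\<^sub>1\<^esub> carrier P\<^sub>1)) <#>\<^bsub>P\<^sub>2\<^esub> carrier P\<^sub>2"
    proof
      show "\<phi>\<^sub>P ` ((p <#\<^bsub>P\<^sub>1\<^esub> carrier P\<^sub>1) \<inter> (q <#\<^bsub>P\<^sub>1\<^esub> carrier P\<^sub>1)) <#>\<^bsub>P\<^sub>2\<^esub> carrier P\<^sub>2
          \<subseteq> (\<phi>\<^sub>P p <#\<^bsub>P\<^sub>2\<^esub> carrier P\<^sub>2) \<inter> (\<phi>\<^sub>P q <#\<^bsub>P\<^sub>2\<^esub> carrier P\<^sub>2)"
      proof
        fix x assume "x \<in> \<phi>\<^sub>P ` ((p <#\<^bsub>P\<^sub>1\<^esub> carrier P\<^sub>1) \<inter> (q <#\<^bsub>P\<^sub>1\<^esub> carrier P\<^sub>1)) <#>\<^bsub>P\<^sub>2\<^esub> carrier P\<^sub>2"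
        then obtain a b c where abc: "a \<in> carrier P\<^sub>1" "b \<in> carrier P\<^sub>1" "c \<in> carrier P\<^sub>2"
          "p \<otimes>\<^bsub>P\<^sub>1\<^esub> a = q \<otimes>\<^bsub>P\<^sub>1\<^esub> b" "x = \<phi>\<^sub>P (p \<otimes>\<^bsub>P\<^sub>1\<^esub> a) \<otimes>\<^bsub>P\<^sub>2\<^esub> c"
          by (auto simp: set_mult_def l_coset_def)
        have "x = \<phi>\<^sub>P p \<otimes>\<^bsub>P\<^sub>2\<^esub> (\<phi>\<^sub>P a \<otimes>\<^bsub>P\<^sub>2\<^esub> c)"
          unfolding abc(5) using abc(1-3) pq by (simp add: homs S2.P.m_assoc)
        moreover have "x = \<phi>\<^sub>P q \<otimes>\<^bsub>P\<^sub>2\<^esub> (\<phi>\<^sub>P b \<otimes>\<^bsub>P\<^sub>2\<^esub> c)"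
          unfolding abc(5,4) using abc(1-3) pq by (simp add: homs S2.P.m_assoc)
        ultimately show "x \<in> (\<phi>\<^sub>P p <#\<^bsub>P\<^sub>2\<^esub> carrier P\<^sub>2) \<inter> (\<phi>\<^sub>P q <#\<^bsub>P\<^sub>2\<^esub> carrier P\<^sub>2)"
          using abc homs S2.P.m_closed unfolding l_coset_def by blast
      qed
      show "(\<phi>\<^sub>P p <#\<^bsub>P\<^sub>2\<^esub> carrier P\<^sub>2) \<inter> (\<phi>\<^sub>P q <#\<^bsub>P\<^sub>2\<^esub> carrier P\<^sub>2)
          \<subseteq> \<phi>\<^sub>P ` ((p <#\<^bsub>P\<^sub>1\<^esub> carrier P\<^sub>1) \<inter> (q <#\<^bsub>P\<^sub>1\<^esub> carrier P\<^sub>1)) <#>\<^bsub>P\<^sub>2\<^esub> carrier P\<^sub>2"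
      proof
        fix x assume "x \<in> (\<phi>\<^sub>P p <#\<^bsub>P\<^sub>2\<^esub> carrier P\<^sub>2) \<inter> (\<phi>\<^sub>P q <#\<^bsub>P\<^sub>2\<^esub> carrier P\<^sub>2)"
        then obtain t t' where t: "t \<in> carrier P\<^sub>2" "t' \<in> carrier P\<^sub>2" "x = \<phi>\<^sub>P q \<otimes>\<^bsub>P\<^sub>2\<^esub> t"
          and tt': "\<phi>\<^sub>P q \<otimes>\<^bsub>P\<^sub>2\<^esub> t = \<phi>\<^sub>P p \<otimes>\<^bsub>P\<^sub>2\<^esub> t'"
          by (auto simp: l_coset_def)
        (* The word for g = 1 maps (1, t) to (1, t'). *)
        have point: "\<phi>\<^sub>G \<one>\<^bsub>G\<^sub>1\<^esub> \<otimes>\<^bsub>G\<^sub>2\<^esub> \<theta>\<^sub>2 (\<phi>\<^sub>P q) \<one>\<^bsub>G\<^sub>2\<^esub> = \<theta>\<^sub>2 (\<phi>\<^sub>P p) \<one>\<^bsub>G\<^sub>2\<^esub>"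
          using pq by (simp add: homs S2.action_G_one)
        obtain p' q' k l where fac: "ads_factor G\<^sub>1 P\<^sub>1 \<theta>\<^sub>1 p q \<one>\<^bsub>G\<^sub>1\<^esub> p' q' k l"
          using factor[OF pq _ _ t(1) _ t(2) point tt'] by auto
        then have cl: "p' \<in> carrier P\<^sub>1" "q' \<in> carrier P\<^sub>1" "k \<in> carrier G\<^sub>1" "l \<in> carrier G\<^sub>1"
          and r: "p \<otimes>\<^bsub>P\<^sub>1\<^esub> p' = q \<otimes>\<^bsub>P\<^sub>1\<^esub> q'"
          by (auto simp: ads_factor_def)
        have "adj ?A (?s p) \<otimes>\<^bsub>?A\<^esub> ?u \<one>\<^bsub>G\<^sub>1\<^esub> \<otimes>\<^bsub>?A\<^esub> ?s q = ?u k \<otimes>\<^bsub>?A\<^esub> ?s p' \<otimes>\<^bsub>?A\<^esub> adj ?A (?s q') \<otimes>\<^bsub>?A\<^esub> adj ?A (?u l)"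
          using pq fac by (intro R1.compress) auto
        then have "f (adj ?A (?s p) \<otimes>\<^bsub>?A\<^esub> ?u \<one>\<^bsub>G\<^sub>1\<^esub> \<otimes>\<^bsub>?A\<^esub> ?s q) =
            f (?u k \<otimes>\<^bsub>?A\<^esub> ?s p' \<otimes>\<^bsub>?A\<^esub> adj ?A (?s q') \<otimes>\<^bsub>?A\<^esub> adj ?A (?u l))"
          by simp
        then have "adj ?B (?t (\<phi>\<^sub>P p)) \<otimes>\<^bsub>?B\<^esub> ?v (\<phi>\<^sub>G \<one>\<^bsub>G\<^sub>1\<^esub>) \<otimes>\<^bsub>?B\<^esub> ?t (\<phi>\<^sub>P q) =
            ?v (\<phi>\<^sub>G k) \<otimes>\<^bsub>?B\<^esub> ?t (\<phi>\<^sub>P p') \<otimes>\<^bsub>?B\<^esub> adj ?B (?t (\<phi>\<^sub>P q')) \<otimes>\<^bsub>?B\<^esub> adj ?B (?v (\<phi>\<^sub>G l))"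
          using pq cl by (simp add: f_hom)
        then have "t \<in> \<phi>\<^sub>P q' <#\<^bsub>P\<^sub>2\<^esub> carrier P\<^sub>2"
          using pq cl by (intro S2.ads_compress_eq_factoredD[OF _ _ _ _ _ _ _ _ t(1) _ t(2) point tt']) (simp_all add: homs)
        then obtain c where c: "c \<in> carrier P\<^sub>2" "t = \<phi>\<^sub>P q' \<otimes>\<^bsub>P\<^sub>2\<^esub> c"
          by (auto simp: l_coset_def)
        then have "x = \<phi>\<^sub>P (q \<otimes>\<^bsub>P\<^sub>1\<^esub> q') \<otimes>\<^bsub>P\<^sub>2\<^esub> c"
          using t pq cl by (simp add: homs S2.P.m_assoc)
        moreover have "q \<otimes>\<^bsub>P\<^sub>1\<^esub> q' \<in> (p <#\<^bsub>P\<^sub>1\<^esub> carrier P\<^sub>1) \<inter> (q <#\<^bsub>P\<^sub>1\<^esub> carrier P\<^sub>1)"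
          using r[symmetric] cl unfolding l_coset_def by blast
        ultimately show "x \<in> \<phi>\<^sub>P ` ((p <#\<^bsub>P\<^sub>1\<^esub> carrier P\<^sub>1) \<inter> (q <#\<^bsub>P\<^sub>1\<^esub> carrier P\<^sub>1)) <#>\<^bsub>P\<^sub>2\<^esub> carrier P\<^sub>2"
          using c(1) unfolding set_mult_def by blast
      qed
    qed
    assume "(p <#\<^bsub>P\<^sub>1\<^esub> carrier P\<^sub>1) \<inter> (q <#\<^bsub>P\<^sub>1\<^esub> carrier P\<^sub>1) \<noteq> {}"
    then obtain a b where ab: "a \<in> carrier P\<^sub>1" "b \<in> carrier P\<^sub>1" "q \<otimes>\<^bsub>P\<^sub>1\<^esub> b = p \<otimes>\<^bsub>P\<^sub>1\<^esub> a"
      by (auto simp: l_coset_def) metis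
    have tt': "\<phi>\<^sub>P q \<otimes>\<^bsub>P\<^sub>2\<^esub> \<phi>\<^sub>P b = \<phi>\<^sub>P p \<otimes>\<^bsub>P\<^sub>2\<^esub> \<phi>\<^sub>P a"
      using ab pq by (metis hom_mult[OF hom_P])
    show "{g \<in> carrier G\<^sub>1. \<phi>\<^sub>G g \<in> \<phi>\<^sub>G ` carrier G\<^sub>1 \<inter>
          (\<theta>\<^sub>2 (\<phi>\<^sub>P p) ` carrier G\<^sub>2 <#>\<^bsub>G\<^sub>2\<^esub> \<theta>\<^sub>2 (\<phi>\<^sub>P q) ` carrier G\<^sub>2)} =
        \<theta>\<^sub>1 p ` carrier G\<^sub>1 <#>\<^bsub>G\<^sub>1\<^esub> \<theta>\<^sub>1 q ` carrier G\<^sub>1" (is "?L = ?R")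
    proof
      show "?R \<subseteq> ?L"
        using pq by (auto simp: set_mult_def S1.action_closed act) (blast intro: \<phi>.hom_closed)
      show "?L \<subseteq> ?R"
      proof
        fix g assume "g \<in> ?L"
        then obtain h' h where g: "g \<in> carrier G\<^sub>1" and h: "h' \<in> carrier G\<^sub>2" "h \<in> carrier G\<^sub>2"
          "\<phi>\<^sub>G g = \<theta>\<^sub>2 (\<phi>\<^sub>P p) h' \<otimes>\<^bsub>G\<^sub>2\<^esub> \<theta>\<^sub>2 (\<phi>\<^sub>P q) h"
          by (auto simp: set_mult_def)
        (* The word for g maps (inv h, \<phi>\<^sub>P b) to (h', \<phi>\<^sub>P a). *)
        have point: "\<phi>\<^sub>G g \<otimes>\<^bsub>G\<^sub>2\<^esub> \<theta>\<^sub>2 (\<phi>\<^sub>P q) (inv\<^bsub>G\<^sub>2\<^esub> h) = \<theta>\<^sub>2 (\<phi>\<^sub>P p) h'"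
          using pq h by (simp add: homs S2.action_closed S2.action_G_inv S2.G.m_assoc)
        obtain p' q' k l where "ads_factor G\<^sub>1 P\<^sub>1 \<theta>\<^sub>1 p q g p' q' k l"
          using factor[OF pq g _ _ h(1) _ point tt'] h ab by (auto simp: homs)
        then show "g \<in> ?R"
          by (auto simp: ads_factor_def set_mult_def)
      qed
    qed
  qed
qed

end

theorem corollary4p10:
  fixes G\<^sub>1 :: "('g1, 'a) monoid_scheme" and P\<^sub>1 :: "('p1, 'b) monoid_scheme"
    and \<theta>\<^sub>1 :: "'p1 \<Rightarrow> 'g1 \<Rightarrow> 'g1"
    and G\<^sub>2 :: "('g2, 'c) monoid_scheme" and P\<^sub>2 :: "('p2, 'd) monoid_scheme"
    and \<theta>\<^sub>2 :: "'p2 \<Rightarrow> 'g2 \<Rightarrow> 'g2"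
    and \<phi>\<^sub>G :: "'g1 \<Rightarrow> 'g2" and \<phi>\<^sub>P :: "'p1 \<Rightarrow> 'p2"
  assumes "algebraic_dynamical_system G\<^sub>1 P\<^sub>1 \<theta>\<^sub>1"
    and "algebraic_dynamical_system G\<^sub>2 P\<^sub>2 \<theta>\<^sub>2"
    and "ads_morphism G\<^sub>1 P\<^sub>1 \<theta>\<^sub>1 G\<^sub>2 P\<^sub>2 \<theta>\<^sub>2 \<phi>\<^sub>G \<phi>\<^sub>P"
  shows "(\<exists>f\<in>star_hom (ads_cstar G\<^sub>1 P\<^sub>1 \<theta>\<^sub>1) (ads_cstar G\<^sub>2 P\<^sub>2 \<theta>\<^sub>2).
      (\<forall>g\<in>carrier G\<^sub>1. f (ads_u G\<^sub>1 P\<^sub>1 \<theta>\<^sub>1 g) = ads_u G\<^sub>2 P\<^sub>2 \<theta>\<^sub>2 (\<phi>\<^sub>G g)) \<and>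
      (\<forall>p\<in>carrier P\<^sub>1. f (ads_s G\<^sub>1 P\<^sub>1 \<theta>\<^sub>1 p) = ads_s G\<^sub>2 P\<^sub>2 \<theta>\<^sub>2 (\<phi>\<^sub>P p)))
    \<longleftrightarrow> ads_admissible G\<^sub>1 P\<^sub>1 \<theta>\<^sub>1 G\<^sub>2 P\<^sub>2 \<theta>\<^sub>2 \<phi>\<^sub>G \<phi>\<^sub>P"
proof -
  interpret ads_system_morphism G\<^sub>1 P\<^sub>1 \<theta>\<^sub>1 G\<^sub>2 P\<^sub>2 \<theta>\<^sub>2 \<phi>\<^sub>G \<phi>\<^sub>P
    by (intro ads_system_morphism.intro ads_system_morphism_axioms.intro assms)
  show ?thesis
    using admissible_imp_induced induced_imp_admissible by blast
qed

end
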